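(* Let $A$ be a non-flat $SU(2)$ Yang-Mills connection on the sphere $S^4$ (with sectional curvature $1$), with curvature $F$ satisfying $$|F|_{L^\infty(S^4)}\le 4/\gamma .$$ Then, under a stereographic projection, the connection $A$ is gauge equivalent to the BPST instanton (or the anti-BPST instanton) on the Euclidean space $\mathbb{R}^4$ centered at the origin with unit scale.
   Context: $A$ is a connection on a vector bundle with structure group $SU(2)$, regarded as a subgroup of $SO(4)$ via $\mathbb{C}^2=\mathbb{R}^4$; $F$ is its curvature, a two-form with values in the adjoint bundle (fibres $su(2)\subset so(4)$). $A$ is Yang-Mills if $d_A^*F=0$, and non-flat if $F$ is not identically zero. Norms: fix $c>0$ and the inner product $\langle a,b\rangle=-c\,\mathrm{tr}(ab)$ on $so(4)$ (trace of real $4\times4$ matrices), and, in a local orthonormal frame, $|F|^2=\sum_{1\le i<j\le 4}|F_{ij}|^2$. Here the constant is $\gamma=4/\sqrt{6c}$; e.g. for $c=1/2$ the hypothesis reads $|F|_{L^\infty(S^4)}\le\sqrt3$. Stereographic projection identifies $S^4$ minus a point with $\mathbb{R}^4$, with $g_{S^4}=4(1+|x|^2)^{-2}g_{\mathbb{R}^4}$; "under a stereographic projection" means that $A$ restricted to $S^4$ minus a point is regarded as a connection over $\mathbb{R}^4$. Identify $\mathbb{R}^4$ with the quaternions and $su(2)$ with the imaginary quaternions. The BPST instanton centered at the origin with unit scale is the $SU(2)$ connection on $\mathbb{R}^4$ given by $\mathrm{Im}\left(\frac{x\,d\bar x}{1+|x|^2}\right)$, with curvature $\frac{dx\wedge d\bar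 x}{(1+|x|^2)^2}$; the anti-BPST instanton centered at the origin with unit scale is $\mathrm{Im}\left(\frac{\bar x\,dx}{1+|x|^2}\right)$, with curvature $\frac{d\bar x\wedge dx}{(1+|x|^2)^2}$ (one is self-dual and the other anti-self-dual). For $c=1/2$ both have $|F|^2_{g_{\mathbb{R}^4}}(x)=48(1+|x|^2)^{-4}$. *)

theory Defs
  imports "HOL-Analysis.Analysis"
begin

section \<open>Smooth maps\<close>

text \<open>Meant for open \<open>S\<close> in a finite-dimensional space, where continuity of all iterated
  directional derivatives is the usual \<open>C\<^sup>k\<close> condition.\<close>

primrec Ck_on ::
    "nat \<Rightarrow> 'a::real_normed_vector set \<Rightarrow> ('a \<Rightarrow> 'b::real_normed_vector) \<Rightarrow> bool" where
  "Ck_on 0 S f \<longleftrightarrow> continuous_on S f"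
| "Ck_on (Suc k) S f \<longleftrightarrow>
     (\<forall>x\<in>S. f differentiable (at x)) \<and> (\<forall>v. Ck_on k S (\<lambda>x. frechet_derivative f (at x) v))"

definition smooth_on ::
    "'a::real_normed_vector set \<Rightarrow> ('a \<Rightarrow> 'b::real_normed_vector) \<Rightarrow> bool" where
  "smooth_on S f \<longleftrightarrow> (\<forall>k. Ck_on k S f)"


section \<open>The group \<open>SU(2)\<close>, its Lie algebra, and the inner product\<close>

type_synonym cmat2 = "complex^2^2"

definition mat_adj :: "cmat2 \<Rightarrow> cmat2" where
  "mat_adj M = (\<chi> i j. cnj (M $ j $ i))"

definition SU2 :: "cmat2 set" where
  "SU2 = {U. U ** mat_adj U = mat 1 \<and> det U = 1}"

definition su2 :: "cmat2 set" where
  "su2 = {X. mat_adj X = - X \<and> trace X = 0}"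

definition comm :: "cmat2 \<Rightarrow> cmat2 \<Rightarrow> cmat2" where
  "comm X Y = X ** Y - Y ** X"

definition to_C2 :: "real^4 \<Rightarrow> complex^2" where
  "to_C2 x = vector [Complex (x$1) (x$2), Complex (x$3) (x$4)]"

definition to_R4 :: "complex^2 \<Rightarrow> real^4" where
  "to_R4 z = vector [Re (z$1), Im (z$1), Re (z$2), Im (z$2)]"

definition realify :: "cmat2 \<Rightarrow> real^4^4" where
  "realify M = matrix (\<lambda>x. to_R4 (M *v to_C2 x))"

definition so4_inner :: "real \<Rightarrow> real^4^4 \<Rightarrow> real^4^4 \<Rightarrow> real" where
  "so4_inner c a b = - c * trace (a ** b)"


section \<open>Matrix-valued one-forms on open subsets of four-space\<close>

text \<open>A one-form is a function \<open>a\<close> with \<open>a x v\<close> its value at the point \<open>x\<close> on the tangent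
  vector \<open>v\<close>.\<close>

definition curvature ::
    "(real^4 \<Rightarrow> real^4 \<Rightarrow> cmat2) \<Rightarrow> real^4 \<Rightarrow> real^4 \<Rightarrow> real^4 \<Rightarrow> cmat2" where
  "curvature a x u v =
     frechet_derivative (\<lambda>y. a y v) (at x) u - frechet_derivative (\<lambda>y. a y u) (at x) v
     + comm (a x u) (a x v)"

definition cov_deriv ::
    "(real^4 \<Rightarrow> real^4 \<Rightarrow> cmat2) \<Rightarrow> (real^4 \<Rightarrow> cmat2) \<Rightarrow> real^4 \<Rightarrow> real^4 \<Rightarrow> cmat2" where
  "cov_deriv a s x u = frechet_derivative s (at x) u + comm (a x u) (s x)"

text \<open>The one-form \<open>d\<^sub>A\<^sup>* F\<close> for a Riemannian metric with coefficient matrix \<open>G\<close>: with raised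
  indices, and because \<open>F\<close> is antisymmetric, component \<open>j\<close> is minus the covariant divergence
  \<open>(1 / sqrt (det G)) * (\<Sum>i. D\<^sub>i (sqrt (det G) * F\<^sup>i\<^sup>j))\<close>; the index \<open>j\<close> is then lowered.\<close>

definition curvature_raised ::
    "(real^4 \<Rightarrow> real^4^4) \<Rightarrow> (real^4 \<Rightarrow> real^4 \<Rightarrow> cmat2) \<Rightarrow> 4 \<Rightarrow> 4 \<Rightarrow> real^4 \<Rightarrow> cmat2" where
  "curvature_raised G a i j x =
     (\<Sum>k\<in>UNIV. \<Sum>l\<in>UNIV. (matrix_inv (G x) $ i $ k * matrix_inv (G x) $ j $ l)
        *\<^sub>R curvature a x (axis k 1) (axis l 1))"

definition codiff_curvature ::
    "(real^4 \<Rightarrow> real^4^4) \<Rightarrow> (real^4 \<Rightarrow> real^4 \<Rightarrow> cmat2) \<Rightarrow> real^4 \<Rightarrow> real^4 \<Rightarrow> cmat2" where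
  "codiff_curvature G a x w =
     (\<Sum>m\<in>UNIV. \<Sum>j\<in>UNIV. (w $ m * G x $ m $ j) *\<^sub>R
        (- (1 / sqrt (det (G x))) *\<^sub>R
          (\<Sum>i\<in>UNIV. cov_deriv a (\<lambda>y. sqrt (det (G y)) *\<^sub>R curvature_raised G a i j y)
                        x (axis i 1))))"


section \<open>The round sphere and its stereographic charts\<close>

definition S4 :: "(real^5) set" where
  "S4 = sphere 0 1"

definition tangent_S4 :: "real^5 \<Rightarrow> (real^5) set" where
  "tangent_S4 q = {v. q \<bullet> v = 0}"

text \<open>Stereographic projection is allowed from any pole \<open>p\<close>, the equatorial hyperplane being
  identified with four-space by any linear isometry \<open>L\<close>.\<close>

definition stereo_frame :: "real^5 \<Rightarrow> (real^4 \<Rightarrow> real^5) \<Rightarrow> bool" where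
  "stereo_frame p L \<longleftrightarrow>
     p \<in> S4 \<and> linear L \<and> (\<forall>x. norm (L x) = norm x) \<and> (\<forall>x. L x \<in> tangent_S4 p)"

definition inv_stereo :: "real^5 \<Rightarrow> (real^4 \<Rightarrow> real^5) \<Rightarrow> real^4 \<Rightarrow> real^5" where
  "inv_stereo p L x =
     (1 / (1 + (norm x)\<^sup>2)) *\<^sub>R (2 *\<^sub>R L x + ((norm x)\<^sup>2 - 1) *\<^sub>R p)"

definition round_metric :: "real^4 \<Rightarrow> real^4^4" where
  "round_metric x = mat (4 / (1 + (norm x)\<^sup>2)\<^sup>2)"

definition round_frame :: "real^4 \<Rightarrow> 4 \<Rightarrow> real^4" where
  "round_frame x i = ((1 + (norm x)\<^sup>2) / 2) *\<^sub>R axis i 1"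

definition pullback ::
    "(real^4 \<Rightarrow> real^5) \<Rightarrow> (real^5 \<Rightarrow> real^5 \<Rightarrow> cmat2) \<Rightarrow> real^4 \<Rightarrow> real^4 \<Rightarrow> cmat2" where
  "pullback \<phi> \<alpha> x v = \<alpha> (\<phi> x) (frechet_derivative \<phi> (at x) v)"


section \<open>\<open>SU(2)\<close> connections on the sphere\<close>

text \<open>A bundle with structure group \<open>SU(2)\<close> is given by an arbitrary trivializing open cover \<open>V\<close>
  and a smooth cocycle \<open>g\<close>. Smoothness on the sphere means smoothness in stereographic charts.\<close>

locale su2_bundle =
  fixes I :: "'i set"
    and V :: "'i \<Rightarrow> (real^5) set"
    and g :: "'i \<Rightarrow> 'i \<Rightarrow> real^5 \<Rightarrow> cmat2"
  assumes open_cover: "i \<in> I \<Longrightarrow> openin (top_of_set S4) (V i)"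
    and cover: "(\<Union>i\<in>I. V i) = S4"
    and transition_SU2: "\<lbrakk>i \<in> I; j \<in> I; q \<in> V i \<inter> V j\<rbrakk> \<Longrightarrow> g i j q \<in> SU2"
    and transition_refl: "\<lbrakk>i \<in> I; q \<in> V i\<rbrakk> \<Longrightarrow> g i i q = mat 1"
    and transition_cocycle:
      "\<lbrakk>i \<in> I; j \<in> I; k \<in> I; q \<in> V i \<inter> V j \<inter> V k\<rbrakk> \<Longrightarrow> g i j q ** g j k q = g i k q"
    and transition_smooth:
      "\<lbrakk>i \<in> I; j \<in> I; stereo_frame p L\<rbrakk> \<Longrightarrow>
        smooth_on (inv_stereo p L -` (V i \<inter> V j)) (\<lambda>x. g i j (inv_stereo p L x))"

text \<open>\<open>A i q\<close> is only constrained on vectors tangent to the sphere at \<open>q\<close>.\<close>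

locale su2_connection = su2_bundle I V g
  for I :: "'i set"
    and V :: "'i \<Rightarrow> (real^5) set"
    and g :: "'i \<Rightarrow> 'i \<Rightarrow> real^5 \<Rightarrow> cmat2" +
  fixes A :: "'i \<Rightarrow> real^5 \<Rightarrow> real^5 \<Rightarrow> cmat2"
  assumes form_su2: "\<lbrakk>i \<in> I; q \<in> V i; v \<in> tangent_S4 q\<rbrakk> \<Longrightarrow> A i q v \<in> su2"
    and form_add:
      "\<lbrakk>i \<in> I; q \<in> V i; u \<in> tangent_S4 q; v \<in> tangent_S4 q\<rbrakk> \<Longrightarrow> A i q (u + v) = A i q u + A i q v"
    and form_scaleR:
      "\<lbrakk>i \<in> I; q \<in> V i; v \<in> tangent_S4 q\<rbrakk> \<Longrightarrow> A i q (r *\<^sub>R v) = r *\<^sub>R A i q v"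
    and form_smooth:
      "\<lbrakk>i \<in> I; stereo_frame p L\<rbrakk> \<Longrightarrow>
        smooth_on (inv_stereo p L -` V i) (\<lambda>x. pullback (inv_stereo p L) (A i) x w)"
    and form_transition:
      "\<lbrakk>i \<in> I; j \<in> I; stereo_frame p L; inv_stereo p L x \<in> V i \<inter> V j\<rbrakk> \<Longrightarrow>
        pullback (inv_stereo p L) (A j) x w =
          matrix_inv (g i j (inv_stereo p L x)) ** pullback (inv_stereo p L) (A i) x w
            ** g i j (inv_stereo p L x)
          + matrix_inv (g i j (inv_stereo p L x))
            ** frechet_derivative (\<lambda>y. g i j (inv_stereo p L y)) (at x) w"
begin

definition yang_mills :: bool where
  "yang_mills \<longleftrightarrow>
     (\<forall>i\<in>I. \<forall>p L x w. stereo_frame p L \<longrightarrow> inv_stereo p L x \<in> V i \<longrightarrow>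
        codiff_curvature round_metric (pullback (inv_stereo p L) (A i)) x w = 0)"

definition flat :: bool where
  "flat \<longleftrightarrow>
     (\<forall>i\<in>I. \<forall>p L x u v. stereo_frame p L \<longrightarrow> inv_stereo p L x \<in> V i \<longrightarrow>
        curvature (pullback (inv_stereo p L) (A i)) x u v = 0)"

end

text \<open>The order of the index type \<open>4\<close> (in which \<open>4 = 0\<close> is the least element) only serves to
  count each unordered pair once; the summand is symmetric.\<close>

definition curvature_norm :: "real \<Rightarrow> (real^4 \<Rightarrow> real^4 \<Rightarrow> cmat2) \<Rightarrow> real^4 \<Rightarrow> real" where
  "curvature_norm c a x =
     sqrt (\<Sum>(i, j)\<in>{(i, j). i < j}.
       so4_inner c (realify (curvature a x (round_frame x i) (round_frame x j)))
                   (realify (curvature a x (round_frame x i) (round_frame x j))))"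

text \<open>The curvature is continuous, so its essential supremum is its supremum.\<close>

definition (in su2_connection) curvature_Linf :: "real \<Rightarrow> ereal" where
  "curvature_Linf c =
     Sup {ereal (curvature_norm c (pullback (inv_stereo p L) (A i)) x) | i p L x.
            i \<in> I \<and> stereo_frame p L \<and> inv_stereo p L x \<in> V i}"

definition gamma_const :: "real \<Rightarrow> real" where
  "gamma_const c = 4 / sqrt (6 * c)"

text \<open>Gauge equivalence, over the sphere minus the pole \<open>p\<close>, with the connection on the trivial
  bundle over four-space given by the form \<open>b\<close>: \<open>h\<close> is the isomorphism from the trivial bundle,
  expressed in the local trivializations.\<close>

definition (in su2_connection) gauge_equiv_stereo ::
    "real^5 \<Rightarrow> (real^4 \<Rightarrow> real^5) \<Rightarrow> (real^4 \<Rightarrow> real^4 \<Rightarrow> cmat2) \<Rightarrow> bool" where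
  "gauge_equiv_stereo p L b \<longleftrightarrow>
     (\<exists>h :: 'i \<Rightarrow> real^4 \<Rightarrow> cmat2.
        (\<forall>i\<in>I. smooth_on (inv_stereo p L -` V i) (h i)) \<and>
        (\<forall>i\<in>I. \<forall>x. inv_stereo p L x \<in> V i \<longrightarrow> h i x \<in> SU2) \<and>
        (\<forall>i\<in>I. \<forall>j\<in>I. \<forall>x. inv_stereo p L x \<in> V i \<inter> V j \<longrightarrow>
           h i x = g i j (inv_stereo p L x) ** h j x) \<and>
        (\<forall>i\<in>I. \<forall>x v. inv_stereo p L x \<in> V i \<longrightarrow>
           b x v =
             matrix_inv (h i x) ** pullback (inv_stereo p L) (A i) x v ** h i x
             + matrix_inv (h i x) ** frechet_derivative (h i) (at x) v))"


section \<open>The BPST instanton and the anti-BPST instanton\<close>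

text \<open>Quaternions are vectors in \<open>real^4\<close>, the first component being the real part.\<close>

definition qmult :: "real^4 \<Rightarrow> real^4 \<Rightarrow> real^4" where
  "qmult x y = vector
     [x$1 * y$1 - x$2 * y$2 - x$3 * y$3 - x$4 * y$4,
      x$1 * y$2 + x$2 * y$1 + x$3 * y$4 - x$4 * y$3,
      x$1 * y$3 - x$2 * y$4 + x$3 * y$1 + x$4 * y$2,
      x$1 * y$4 + x$2 * y$3 - x$3 * y$2 + x$4 * y$1]"

definition qcnj :: "real^4 \<Rightarrow> real^4" where
  "qcnj x = vector [x$1, - x$2, - x$3, - x$4]"

definition qIm :: "real^4 \<Rightarrow> real^4" where
  "qIm x = vector [0, x$2, x$3, x$4]"

text \<open>The standard algebra embedding of the quaternions; it maps the imaginary quaternions onto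
  \<open>su2\<close>.\<close>

definition quat_mat :: "real^4 \<Rightarrow> cmat2" where
  "quat_mat x = vector
     [vector [Complex (x$1) (x$2), Complex (x$3) (x$4)],
      vector [Complex (- x$3) (x$4), Complex (x$1) (- x$2)]]"

definition bpst :: "real^4 \<Rightarrow> real^4 \<Rightarrow> cmat2" where
  "bpst x v = quat_mat (qIm ((1 / (1 + (norm x)\<^sup>2)) *\<^sub>R qmult x (qcnj v)))"

definition anti_bpst :: "real^4 \<Rightarrow> real^4 \<Rightarrow> cmat2" where
  "anti_bpst x v = quat_mat (qIm ((1 / (1 + (norm x)\<^sup>2)) *\<^sub>R qmult (qcnj x) v))"

end

theory Submission
  imports Defs
begin

text \<open>By the Yang-Mills equation and the Bianchi identity, the self-dual part \<open>F\<^sup>+\<close> of the curvature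
  satisfies a Dirac-type equation. The resulting Weitzenboeck formula on the sphere,
  \<open>\<Delta>|F\<^sup>+|\<^sup>2 / 2 = |\<nabla>F\<^sup>+|\<^sup>2 + 4|F\<^sup>+|\<^sup>2 +\<close> a cubic term, does not involve the anti-self-dual part, and
  the bound on \<open>|F|\<close> is exactly what makes the right-hand side nonnegative. So \<open>|F\<^sup>+|\<^sup>2\<close> is a bounded
  subharmonic function on the sphere minus the pole, hence constant. Equality everywhere forces
  \<open>F\<^sup>+ = 0\<close>, or else \<open>F\<^sup>+\<close> is parallel and a fixed multiple of a frame of imaginary quaternion units.
  Such a frame lifts, uniquely up to sign, to \<open>SU(2)\<close>; the signs can be chosen coherently over
  four-space, and the lift transforms the connection into the BPST instanton.
  Quaternionic conjugation exchanges the two parts of the curvature and the two instantons. If both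
  parts vanish in one chart, the connection is flat.\<close>

section \<open>Calculus of smooth maps\<close>

text \<open>The constants fit because the BPST form attains every bound: its self-dual components
  \<open>sd1\<close>, \<open>sd2\<close>, \<open>sd3\<close> are -4 / (1 + |x|^2)^2 times
  \<open>E1\<close>, \<open>E2\<close>, \<open>E3\<close>, so the weighted norm
  \<open>wt x^4 * sd_norm a x\<close> equals 96. The cubic term is estimated by completing squares
  around this configuration; the leftover squares are what the equality case evaluates. Center and
  scale need no separate argument. In stereographic coordinates the Levi-Civita connection on
  self-dual forms is the BPST form acting by brackets, so a parallel orthonormal frame of this kind
  leaves no moduli. All computations with curvature are Euclidean: in dimension four the Yang-Mills
  equation is conformally invariant, and the sphere enters only through powers of \<open>wt\<close>.
  Two obstacles shape the rest. The bundle is given by an arbitrary cover, so each quantity is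
  computed in one trivialization and then shown to be independent of it or transported by the
  cocycle. And a chart misses the pole, which is harmless since a point is removable for bounded
  subharmonic functions in dimension four.\<close>

abbreviation fd :: "('a::real_normed_vector \<Rightarrow> 'b::real_normed_vector) \<Rightarrow> 'a \<Rightarrow> 'a \<Rightarrow> 'b" where
  "fd f x \<equiv> frechet_derivative f (at x)"

lemma fd_eq: "(f has_derivative f') (at x) \<Longrightarrow> fd f x = f'"
  using frechet_derivative_at by metis

lemma differentiable_fd: "f differentiable at x \<Longrightarrow> (f has_derivative fd f x) (at x)"
  using frechet_derivative_works by blast

lemma Ck_on_subset: "Ck_on k S f \<Longrightarrow> T \<subseteq> S \<Longrightarrow> Ck_on k T f"
  by (induction k arbitrary: f) (auto intro: continuous_on_subset)

lemma Ck_on_SucD: "Ck_on (Suc k) S f \<Longrightarrow> Ck_on k S f"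
proof (induction k arbitrary: f)
  case 0
  then show ?case
    by (auto intro!: differentiable_imp_continuous_on
        simp: differentiable_on_def differentiable_at_withinI)
next
  case (Suc k)
  have "Ck_on k S (\<lambda>x. frechet_derivative f (at x) v)" for v
    using Suc.prems by (intro Suc.IH) (simp only: Ck_on.simps(2)[of "Suc k"])
  then show ?case using Suc.prems by simp
qed

lemma Ck_on_cong:
  assumes "open S" "\<And>x. x \<in> S \<Longrightarrow> f x = g x" "Ck_on k S f"
  shows "Ck_on k S g"
  using assms(2,3)
proof (induction k arbitrary: f g)
  case 0
  then show ?case using continuous_on_cong by (metis Ck_on.simps(1))
next
  case (Suc k)
  have d: "(g has_derivative fd f x) (at x)" if "x \<in> S" for x
  proof -
    have "(f has_derivative fd f x) (at x)"
      using Suc that by (intro differentiable_fd) auto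
    then show ?thesis
      using has_derivative_transform_within_open[OF _ assms(1) that] Suc(2) by blast
  qed
  have "Ck_on k S (\<lambda>x. fd g x v)" for v
  proof (rule Suc.IH)
    show "Ck_on k S (\<lambda>x. fd f x v)" using Suc by simp
    show "fd f x v = fd g x v" if "x \<in> S" for x using fd_eq[OF d[OF that]] by simp
  qed
  then show ?case using d by (auto simp: differentiable_def)
qed

lemma Ck_on_SucI:
  assumes S: "open S" and k: "\<And>v. Ck_on k S (\<lambda>x. f' x v)"
    and d: "\<And>x. x \<in> S \<Longrightarrow> (f has_derivative f' x) (at x)"
  shows "Ck_on (Suc k) S f"
proof -
  have "Ck_on k S (\<lambda>x. fd f x v)" for v
    by (rule Ck_on_cong[OF S _ k]) (use fd_eq[OF d] in simp)
  then show ?thesis using d by (auto simp: differentiable_def)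
qed

lemma Ck_on_local:
  assumes "\<And>x. x \<in> S \<Longrightarrow> \<exists>T. open T \<and> x \<in> T \<and> Ck_on k T f"
  shows "Ck_on k S f"
  using assms
proof (induction k arbitrary: f)
  case 0
  then have "\<And>x. x \<in> S \<Longrightarrow> isCont f x"
    by (metis Ck_on.simps(1) continuous_on_eq_continuous_at)
  then show ?case by (simp add: continuous_at_imp_continuous_on)
next
  case (Suc k)
  have "Ck_on k S (\<lambda>x. fd f x v)" for v
    by (rule Suc.IH) (use Suc(2) in \<open>metis Ck_on.simps(2)\<close>)
  moreover have "\<forall>x\<in>S. f differentiable at x" using Suc(2) by (metis Ck_on.simps(2))
  ultimately show ?case by simp
qed

lemma Ck_on_const: "Ck_on k S (\<lambda>x. c)"
  by (induction k arbitrary: c) auto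

lemma Ck_on_linear:
  assumes "bounded_linear h" shows "Ck_on k S h"
proof (cases k)
  case 0
  then show ?thesis using assms by (simp add: linear_continuous_on)
next
  case (Suc n)
  have "fd h x = h" for x
    using assms by (intro fd_eq) (simp add: bounded_linear_imp_has_derivative)
  then show ?thesis
    using Suc assms by (simp add: Ck_on_const bounded_linear_imp_differentiable)
qed

lemma Ck_on_bounded_linear:
  assumes "open S" "bounded_linear h" "Ck_on k S f"
  shows "Ck_on k S (\<lambda>x. h (f x))"
  using assms(3)
proof (induction k arbitrary: f)
  case 0
  then show ?case using assms(2) by (simp add: bounded_linear.continuous_on)
next
  case (Suc k)
  have d: "((\<lambda>x. h (f x)) has_derivative (\<lambda>v. h (fd f x v))) (at x)" if "x \<in> S" for x
    using Suc that by (intro bounded_linear.has_derivative[OF assms(2)] differentiable_fd) auto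
  have "Ck_on k S (\<lambda>x. h (fd f x v))" for v using Suc by simp
  then show ?case using d by (rule Ck_on_SucI[OF assms(1)])
qed

lemma Ck_on_add:
  assumes "open S" "Ck_on k S f" "Ck_on k S g"
  shows "Ck_on k S (\<lambda>x. f x + g x)"
  using assms(2,3)
proof (induction k arbitrary: f g)
  case 0
  then show ?case by (simp add: continuous_on_add)
next
  case (Suc k)
  have d: "((\<lambda>x. f x + g x) has_derivative (\<lambda>v. fd f x v + fd g x v)) (at x)" if "x \<in> S" for x
    using Suc that by (intro has_derivative_add differentiable_fd) auto
  have "Ck_on k S (\<lambda>x. fd f x v + fd g x v)" for v using Suc by simp
  then show ?case using d by (rule Ck_on_SucI[OF assms(1)])
qed

lemma Ck_on_bilinear:
  assumes "open S" "bounded_bilinear B" "Ck_on k S f" "Ck_on k S g"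
  shows "Ck_on k S (\<lambda>x. B (f x) (g x))"
  using assms(3,4)
proof (induction k arbitrary: f g)
  case 0
  then show ?case by (simp add: bounded_bilinear.continuous_on[OF assms(2)])
next
  case (Suc k)
  have d: "((\<lambda>x. B (f x) (g x)) has_derivative (\<lambda>v. B (f x) (fd g x v) + B (fd f x v) (g x))) (at x)"
    if "x \<in> S" for x
    using Suc that by (intro bounded_bilinear.FDERIV[OF assms(2)] differentiable_fd) auto
  have "Ck_on k S (\<lambda>x. B (f x) (fd g x v) + B (fd f x v) (g x))" for v
    using Suc Ck_on_SucD[OF Suc(2)] Ck_on_SucD[OF Suc(3)]
    by (intro Ck_on_add[OF assms(1)]) (simp_all del: Ck_on.simps add: Ck_on.simps(2))
  then show ?case using d by (rule Ck_on_SucI[OF assms(1)])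
qed

text \<open>With h the function itself, the derivative is -1/2 h^3 f'. It arises from h and f' by
  products alone, so the induction on the order closes with the product rule.\<close>

lemma Ck_on_inverse_sqrt:
  fixes f :: "'a::real_normed_vector \<Rightarrow> real"
  assumes "open S" "Ck_on k S f" "\<And>x. x \<in> S \<Longrightarrow> f x > 0"
  shows "Ck_on k S (\<lambda>x. inverse (sqrt (f x)))"
  using assms(2)
proof (induction k)
  case 0
  then have "continuous_on S (\<lambda>x. sqrt (f x))" by (simp add: continuous_on_real_sqrt)
  moreover have "\<forall>x\<in>S. sqrt (f x) \<noteq> 0" using assms(3) by fastforce
  ultimately show ?case unfolding Ck_on.simps by (rule continuous_on_inverse)
next
  case (Suc k)
  note mult = Ck_on_bilinear[OF assms(1) bounded_bilinear_mult]
  let ?h = "\<lambda>x. inverse (sqrt (f x))"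
  have d: "(?h has_derivative
      (\<lambda>v. (- 1/2) * (?h x * (?h x * (?h x * fd f x v))))) (at x)" if "x \<in> S" for x
  proof -
    have pos: "f x > 0" using that assms(3) by simp
    have "((\<lambda>t. inverse (sqrt t)) has_field_derivative (- 1/2) * (?h x * (?h x * ?h x))) (at (f x))"
      by (rule DERIV_cong[OF DERIV_inverse_fun[OF DERIV_real_sqrt[OF pos]]])
        (use pos in \<open>simp_all flip: inverse_mult_distrib\<close>)
    then have "((\<lambda>t. inverse (sqrt t)) has_derivative (*) ((- 1/2) * (?h x * (?h x * ?h x)))) (at (f x))"
      by (simp add: has_field_derivative_def)
    moreover have "(f has_derivative fd f x) (at x)"
      using Suc that by (intro differentiable_fd) auto
    ultimately have "((\<lambda>t. inverse (sqrt t)) \<circ> f has_derivative (*) ((- 1/2) * (?h x * (?h x * ?h x))) \<circ> fd f x) (at x)"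
      by (rule diff_chain_at[rotated])
    then show ?thesis by (simp add: o_def mult.assoc)
  qed
  have "Ck_on k S (\<lambda>x. (- 1/2) * (?h x * (?h x * (?h x * fd f x v))))" for v
    using Suc Suc.IH[OF Ck_on_SucD[OF Suc(2)]]
    by (intro mult Ck_on_const) simp_all
  then show ?case using d by (rule Ck_on_SucI[OF assms(1)])
qed

lemma Ck_on_compose_linear:
  assumes "open S" "bounded_linear R" "Ck_on k S f"
  shows "Ck_on k (R -` S) (\<lambda>x. f (R x))"
  using assms(3)
proof (induction k arbitrary: f)
  case 0
  then show ?case
    using linear_continuous_on[OF assms(2)]
    by (auto intro!: continuous_on_compose2[of S f "R -` S" R])
next
  case (Suc k)
  have op: "open (R -` S)"
    using assms(1) linear_continuous_on[OF assms(2), of UNIV] by (simp add: open_vimage)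
  have d: "((\<lambda>x. f (R x)) has_derivative (\<lambda>v. fd f (R x) (R v))) (at x)" if "x \<in> R -` S" for x
  proof -
    have "(f has_derivative fd f (R x)) (at (R x))"
      using Suc that by (intro differentiable_fd) auto
    from diff_chain_at[OF bounded_linear_imp_has_derivative[OF assms(2)] this]
    show ?thesis by (simp add: o_def)
  qed
  have "Ck_on k (R -` S) (\<lambda>x. fd f (R x) (R v))" for v
    using Suc by (intro Suc.IH) simp
  then show ?case using d by (rule Ck_on_SucI[OF op])
qed

lemma smooth_on_differentiable: "smooth_on S f \<Longrightarrow> x \<in> S \<Longrightarrow> f differentiable at x"
  unfolding smooth_on_def by (metis Ck_on.simps(2))

lemma smooth_on_fd: "smooth_on S f \<Longrightarrow> smooth_on S (\<lambda>x. fd f x v)"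
  unfolding smooth_on_def by (metis Ck_on.simps(2))

lemma smooth_on_continuous: "smooth_on S f \<Longrightarrow> continuous_on S f"
  unfolding smooth_on_def by (metis Ck_on.simps(1))

lemma smooth_on_subset: "smooth_on S f \<Longrightarrow> T \<subseteq> S \<Longrightarrow> smooth_on T f"
  unfolding smooth_on_def using Ck_on_subset by blast

lemma smooth_on_cong:
  "open S \<Longrightarrow> smooth_on S f \<Longrightarrow> (\<And>x. x \<in> S \<Longrightarrow> f x = g x) \<Longrightarrow> smooth_on S g"
  unfolding smooth_on_def using Ck_on_cong by metis

lemma smooth_on_local:
  "(\<And>x. x \<in> S \<Longrightarrow> \<exists>T. open T \<and> x \<in> T \<and> smooth_on T f) \<Longrightarrow> smooth_on S f"
  unfolding smooth_on_def by (meson Ck_on_local)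

lemma smooth_on_const: "smooth_on S (\<lambda>x. c)"
  unfolding smooth_on_def by (simp add: Ck_on_const)

lemma smooth_on_linear: "bounded_linear h \<Longrightarrow> smooth_on S h"
  unfolding smooth_on_def by (simp add: Ck_on_linear)

lemma smooth_on_bounded_linear:
  "open S \<Longrightarrow> bounded_linear h \<Longrightarrow> smooth_on S f \<Longrightarrow> smooth_on S (\<lambda>x. h (f x))"
  unfolding smooth_on_def by (simp add: Ck_on_bounded_linear)

lemma smooth_on_add:
  "open S \<Longrightarrow> smooth_on S f \<Longrightarrow> smooth_on S g \<Longrightarrow> smooth_on S (\<lambda>x. f x + g x)"
  unfolding smooth_on_def by (simp add: Ck_on_add)

lemma smooth_on_bilinear:
  "open S \<Longrightarrow> bounded_bilinear B \<Longrightarrow> smooth_on S f \<Longrightarrow> smooth_on S g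
    \<Longrightarrow> smooth_on S (\<lambda>x. B (f x) (g x))"
  unfolding smooth_on_def by (simp add: Ck_on_bilinear)

lemmas smooth_on_scaleR = smooth_on_bilinear[OF _ bounded_bilinear_scaleR]

lemma smooth_on_minus: "open S \<Longrightarrow> smooth_on S f \<Longrightarrow> smooth_on S (\<lambda>x. - f x)"
  by (rule smooth_on_bounded_linear[OF _ bounded_linear_minus[OF bounded_linear_ident]])

lemma smooth_on_diff:
  "open S \<Longrightarrow> smooth_on S f \<Longrightarrow> smooth_on S g \<Longrightarrow> smooth_on S (\<lambda>x. f x - g x)"
  using smooth_on_add[of S f "\<lambda>x. - g x"] smooth_on_minus[of S g] by simp

lemma smooth_on_inverse_sqrt:
  fixes f :: "'a::real_normed_vector \<Rightarrow> real"
  shows "open S \<Longrightarrow> smooth_on S f \<Longrightarrow> (\<And>x. x \<in> S \<Longrightarrow> f x > 0) \<Longrightarrow> smooth_on S (\<lambda>x. inverse (sqrt (f x)))"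
  unfolding smooth_on_def by (simp add: Ck_on_inverse_sqrt)

text \<open>Here 1 / f = f h^2 with h = 1 / sqrt (f^2), which reduces a nonvanishing f of either
  sign to the positive case.\<close>

lemma smooth_on_inverse:
  fixes f :: "'a::real_normed_vector \<Rightarrow> real"
  assumes S: "open S" and f: "smooth_on S f" and "\<And>x. x \<in> S \<Longrightarrow> f x \<noteq> 0"
  shows "smooth_on S (\<lambda>x. inverse (f x))"
proof -
  note mult = smooth_on_bilinear[OF S bounded_bilinear_mult]
  have "smooth_on S (\<lambda>x. inverse (sqrt (f x * f x)))"
    by (rule smooth_on_inverse_sqrt[OF S mult[OF f f]]) (simp add: assms(3) zero_less_mult_iff linorder_neq_iff[symmetric])
  from mult[OF f mult[OF this this]] show ?thesis
    by (rule smooth_on_cong[OF S]) (simp add: field_simps assms(3) abs_mult_self_eq)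
qed

lemma smooth_on_compose_linear:
  "open S \<Longrightarrow> bounded_linear R \<Longrightarrow> smooth_on S f \<Longrightarrow> smooth_on (R -` S) (\<lambda>x. f (R x))"
  unfolding smooth_on_def by (simp add: Ck_on_compose_linear)

section \<open>Differentiation rules for \<open>fd\<close>\<close>

lemma fd_add:
  assumes "f differentiable at x" "g differentiable at x"
  shows "fd (\<lambda>x. f x + g x) x v = fd f x v + fd g x v"
  using fd_eq[OF has_derivative_add[OF assms[THEN differentiable_fd]]] by simp

lemma fd_diff:
  assumes "f differentiable at x" "g differentiable at x"
  shows "fd (\<lambda>x. f x - g x) x v = fd f x v - fd g x v"
  using fd_eq[OF has_derivative_diff[OF assms[THEN differentiable_fd]]] by simp

lemma fd_bounded_linear:
  assumes "bounded_linear h" "f differentiable at x"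
  shows "fd (\<lambda>x. h (f x)) x v = h (fd f x v)"
  using fd_eq[OF bounded_linear.has_derivative[OF assms(1) assms(2)[THEN differentiable_fd]]] by simp

lemma fd_bilinear:
  assumes "bounded_bilinear B" "f differentiable at x" "g differentiable at x"
  shows "fd (\<lambda>x. B (f x) (g x)) x v = B (f x) (fd g x v) + B (fd f x v) (g x)"
  using fd_eq[OF bounded_bilinear.FDERIV[OF assms(1) assms(2,3)[THEN differentiable_fd]]] by simp

lemma fd_compose:
  assumes "f differentiable at x" "g differentiable at (f x)"
  shows "fd (\<lambda>x. g (f x)) x v = fd g (f x) (fd f x v)"
  using fd_eq[OF diff_chain_at[OF assms[THEN differentiable_fd]]] by (simp add: o_def)

text \<open>Holds even at points of non-differentiability: \<open>frechet_derivative\<close> chooses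
  from the set of derivatives, and both functions have the same set.\<close>

lemma fd_cong:
  assumes "open S" "x \<in> S" "\<And>y. y \<in> S \<Longrightarrow> f y = g y"
  shows "fd f x = fd g x"
proof -
  have "(f has_derivative D) (at x) \<longleftrightarrow> (g has_derivative D) (at x)" for D
    using has_derivative_transform_within_open[OF _ assms(1,2)] assms(3) by metis
  then show ?thesis by (simp add: frechet_derivative_def)
qed

lemma fd_sum_axis:
  assumes "f differentiable at (x::real^'n::finite)"
  shows "fd f x v = (\<Sum>k\<in>UNIV. (v $ k) *\<^sub>R fd f x (axis k 1))"
proof -
  have "linear (fd f x)" using assms linear_frechet_derivative by blast
  then have "fd f x (\<Sum>k\<in>UNIV. (v $ k) *\<^sub>R axis k 1) = (\<Sum>k\<in>UNIV. (v $ k) *\<^sub>R fd f x (axis k 1))"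
    by (simp add: linear_sum linear_scale)
  moreover have "(\<Sum>k\<in>UNIV. (v $ k) *\<^sub>R axis k 1) = v"
    using basis_expansion[of v] by (simp add: scalar_mult_eq_scaleR)
  ultimately show ?thesis by simp
qed

lemma fd_line:
  assumes "f differentiable at (a + t *\<^sub>R u)"
  shows "((\<lambda>t. f (a + t *\<^sub>R u)) has_vector_derivative fd f (a + t *\<^sub>R u) u) (at t)"
proof -
  have "((\<lambda>t. a + t *\<^sub>R u) has_derivative (\<lambda>s. s *\<^sub>R u)) (at t)"
    by (auto intro!: derivative_eq_intros)
  from diff_chain_at[OF this differentiable_fd[OF assms]]
  have "((\<lambda>t. f (a + t *\<^sub>R u)) has_derivative (\<lambda>s. fd f (a + t *\<^sub>R u) (s *\<^sub>R u))) (at t)"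
    by (simp add: o_def)
  then show ?thesis
    using linear_frechet_derivative[OF assms]
    by (simp add: has_vector_derivative_def linear_scale)
qed

lemma fd_line_real:
  fixes f :: "'a::real_normed_vector \<Rightarrow> real"
  assumes "f differentiable at (a + t *\<^sub>R u)"
  shows "((\<lambda>t. f (a + t *\<^sub>R u)) has_real_derivative fd f (a + t *\<^sub>R u) u) (at t)"
  using fd_line[OF assms] by (simp add: has_real_derivative_iff_has_vector_derivative)

section \<open>Symmetry of mixed second derivatives\<close>

lemma second_difference_mvt:
  fixes f :: "'a::real_normed_vector \<Rightarrow> real"
  assumes "smooth_on S f" "t > 0"
    and "\<And>r s. \<lbrakk>0 \<le> r; r \<le> t; 0 \<le> s; s \<le> t\<rbrakk> \<Longrightarrow> x + r *\<^sub>R u + s *\<^sub>R v \<in> S"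
  obtains r s where "0 \<le> r" "r \<le> t" "0 \<le> s" "s \<le> t"
    "f (x + t *\<^sub>R u + t *\<^sub>R v) - f (x + t *\<^sub>R u) - f (x + t *\<^sub>R v) + f x
      = t\<^sup>2 * fd (\<lambda>y. fd f y u) (x + r *\<^sub>R u + s *\<^sub>R v) v"
proof -
  \<comment> \<open>The mixed difference is the increment of \<open>G\<close> from 0 to t. The mean
    value theorem is applied to \<open>G\<close> and then, in direction v, to its
    derivative.\<close>
  define G where "G r = f (x + t *\<^sub>R v + r *\<^sub>R u) - f (x + r *\<^sub>R u)" for r
  have "x + r *\<^sub>R u \<in> S \<and> x + t *\<^sub>R v + r *\<^sub>R u \<in> S" if "0 \<le> r" "r \<le> t" for r
    using assms(3)[of r 0] assms(3)[of r t] that assms(2) by (simp add: algebra_simps)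
  then have "(G has_real_derivative
      (fd f (x + t *\<^sub>R v + r *\<^sub>R u) u - fd f (x + r *\<^sub>R u) u)) (at r)" if "0 \<le> r" "r \<le> t" for r
    unfolding G_def using that
    by (intro DERIV_diff fd_line_real smooth_on_differentiable[OF assms(1)]) auto
  then obtain r where r: "0 < r" "r < t"
      "G t - G 0 = (t - 0) * (fd f (x + t *\<^sub>R v + r *\<^sub>R u) u - fd f (x + r *\<^sub>R u) u)"
    using MVT2[OF assms(2), of G "\<lambda>r. fd f (x + t *\<^sub>R v + r *\<^sub>R u) u - fd f (x + r *\<^sub>R u) u"]
    by metis
  have "((\<lambda>s. fd f (x + r *\<^sub>R u + s *\<^sub>R v) u) has_real_derivative
      fd (\<lambda>y. fd f y u) (x + r *\<^sub>R u + s *\<^sub>R v) v) (at s)" if "0 \<le> s" "s \<le> t" for s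
    by (rule fd_line_real[of "\<lambda>y. fd f y u"], rule smooth_on_differentiable[OF smooth_on_fd[OF assms(1)]])
      (use r assms(3) that in auto)
  then obtain s where s: "0 < s" "s < t"
      "fd f (x + r *\<^sub>R u + t *\<^sub>R v) u - fd f (x + r *\<^sub>R u + 0 *\<^sub>R v) u
        = (t - 0) * fd (\<lambda>y. fd f y u) (x + r *\<^sub>R u + s *\<^sub>R v) v"
    using MVT2[OF assms(2), of "\<lambda>s. fd f (x + r *\<^sub>R u + s *\<^sub>R v) u"
        "\<lambda>s. fd (\<lambda>y. fd f y u) (x + r *\<^sub>R u + s *\<^sub>R v) v"] by metis
  show thesis
  proof (rule that[of r s])
    show "f (x + t *\<^sub>R u + t *\<^sub>R v) - f (x + t *\<^sub>R u) - f (x + t *\<^sub>R v) + f x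
      = t\<^sup>2 * fd (\<lambda>y. fd f y u) (x + r *\<^sub>R u + s *\<^sub>R v) v"
      using r(3) s(3) unfolding G_def by (simp add: algebra_simps power2_eq_square)
  qed (use r s in auto)
qed

text \<open>The second difference over a small parallelogram is symmetric in u and v and equals t^2
  times either mixed derivative at some nearby point. If the two derivatives differed at x,
  continuity would keep their nearby values apart.\<close>

lemma fd_commute_real:
  fixes f :: "'a::real_normed_vector \<Rightarrow> real"
  assumes "open S" "x \<in> S" "smooth_on S f"
  shows "fd (\<lambda>y. fd f y u) x v = fd (\<lambda>y. fd f y v) x u"
proof (rule ccontr)
  let ?P = "\<lambda>y. fd (\<lambda>y. fd f y u) y v" and ?Q = "\<lambda>y. fd (\<lambda>y. fd f y v) y u"
  define e where "e = \<bar>?P x - ?Q x\<bar> / 2"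
  assume "?P x \<noteq> ?Q x"
  then have e: "e > 0" by (simp add: e_def)
  have "smooth_on S ?P" "smooth_on S ?Q"
    using assms smooth_on_fd by blast+
  then have "isCont ?P x" "isCont ?Q x"
    using assms smooth_on_continuous continuous_on_eq_continuous_at by blast+
  then obtain d1 d2 d3 where d: "d1 > 0" "\<And>y. dist y x < d1 \<Longrightarrow> dist (?P y) (?P x) < e"
      "d2 > 0" "\<And>y. dist y x < d2 \<Longrightarrow> dist (?Q y) (?Q x) < e" "d3 > 0" "ball x d3 \<subseteq> S"
    using e assms(1,2) unfolding continuous_at_eps_delta open_contains_ball by metis
  define d where "d = min d1 (min d2 d3)"
  define t where "t = d / (2 * (norm u + norm v + 1))"
  have pos: "d > 0" "norm u + norm v + 1 > 0"
    using d by (auto simp: d_def add_nonneg_pos)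
  then have t: "t > 0" by (simp add: t_def)
  have near: "dist (x + r *\<^sub>R u + s *\<^sub>R v) x < d" if "0 \<le> r" "r \<le> t" "0 \<le> s" "s \<le> t" for r s
  proof -
    have "dist (x + r *\<^sub>R u + s *\<^sub>R v) x \<le> r * norm u + s * norm v"
      using that norm_triangle_ineq[of "r *\<^sub>R u" "s *\<^sub>R v"] by (simp add: dist_norm algebra_simps)
    also have "\<dots> \<le> t * norm u + t * norm v"
      using that by (intro add_mono mult_right_mono) auto
    also have "\<dots> \<le> t * (norm u + norm v + 1)" using t by (simp add: algebra_simps)
    also have "\<dots> = d / 2"
      using pos by (simp only: t_def) (simp only: times_divide_eq_left nonzero_divide_eq_eq divide_eq_eq, simp)
    finally show ?thesis using pos by simp
  qed
  have inS: "x + r *\<^sub>R u + s *\<^sub>R v \<in> S" "x + s *\<^sub>R v + r *\<^sub>R u \<in> S"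
    if "0 \<le> r" "r \<le> t" "0 \<le> s" "s \<le> t" for r s
    using near[OF that] d(6) by (auto simp: d_def dist_commute subset_iff algebra_simps)
  obtain r s where rs: "0 \<le> r" "r \<le> t" "0 \<le> s" "s \<le> t"
      "f (x + t *\<^sub>R u + t *\<^sub>R v) - f (x + t *\<^sub>R u) - f (x + t *\<^sub>R v) + f x = t\<^sup>2 * ?P (x + r *\<^sub>R u + s *\<^sub>R v)"
    using second_difference_mvt[OF assms(3) t, of x u v] inS by metis
  obtain r' s' where rs': "0 \<le> r'" "r' \<le> t" "0 \<le> s'" "s' \<le> t"
      "f (x + t *\<^sub>R v + t *\<^sub>R u) - f (x + t *\<^sub>R v) - f (x + t *\<^sub>R u) + f x = t\<^sup>2 * ?Q (x + r' *\<^sub>R v + s' *\<^sub>R u)"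
    using second_difference_mvt[OF assms(3) t, of x v u] inS by metis
  have "t\<^sup>2 * ?P (x + r *\<^sub>R u + s *\<^sub>R v) = t\<^sup>2 * ?Q (x + s' *\<^sub>R u + r' *\<^sub>R v)"
    using rs(5) rs'(5) by (simp add: algebra_simps)
  then have eq: "?P (x + r *\<^sub>R u + s *\<^sub>R v) = ?Q (x + s' *\<^sub>R u + r' *\<^sub>R v)" using t by simp
  have "\<bar>?P (x + r *\<^sub>R u + s *\<^sub>R v) - ?P x\<bar> < e" "\<bar>?Q (x + s' *\<^sub>R u + r' *\<^sub>R v) - ?Q x\<bar> < e"
    using d(2)[of "x + r *\<^sub>R u + s *\<^sub>R v"] d(4)[of "x + s' *\<^sub>R u + r' *\<^sub>R v"] near rs rs'
    by (auto simp: d_def dist_real_def)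
  then show False using eq by (simp add: e_def abs_if split: if_splits)
qed

lemma fd_commute:
  fixes f :: "'a::real_normed_vector \<Rightarrow> 'b::euclidean_space"
  assumes "open S" "x \<in> S" "smooth_on S f"
  shows "fd (\<lambda>y. fd f y u) x v = fd (\<lambda>y. fd f y v) x u"
proof (rule euclidean_eqI)
  fix b :: 'b assume "b \<in> Basis"
  have bl: "bounded_linear (\<lambda>z::'b. z \<bullet> b)" by (rule bounded_linear_inner_left)
  have 1: "smooth_on S (\<lambda>y. f y \<bullet> b)" by (rule smooth_on_bounded_linear[OF assms(1) bl assms(3)])
  have 2: "fd (\<lambda>y. fd (\<lambda>y. f y \<bullet> b) y u) x v = fd (\<lambda>y. fd f y u) x v \<bullet> b" for u v
  proof -
    have "fd (\<lambda>y. fd (\<lambda>y. f y \<bullet> b) y u) x v = fd (\<lambda>y. fd f y u \<bullet> b) x v"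
      using fd_cong[OF assms(1,2), of "\<lambda>y. fd (\<lambda>y. f y \<bullet> b) y u" "\<lambda>y. fd f y u \<bullet> b"]
        fd_bounded_linear[OF bl smooth_on_differentiable[OF assms(3)]] by simp
    also have "\<dots> = fd (\<lambda>y. fd f y u) x v \<bullet> b"
      by (rule fd_bounded_linear[OF bl smooth_on_differentiable[OF smooth_on_fd[OF assms(3)] assms(2)]])
    finally show ?thesis .
  qed
  show "fd (\<lambda>y. fd f y u) x v \<bullet> b = fd (\<lambda>y. fd f y v) x u \<bullet> b"
    using fd_commute_real[OF assms(1,2) 1, of u v] by (simp only: 2)
qed

section \<open>Bounded subharmonic functions on the punctured sphere\<close>

lemma Ck_on_exp:
  fixes f :: "'a::real_normed_vector \<Rightarrow> real"
  assumes "open S" "Ck_on k S f"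
  shows "Ck_on k S (\<lambda>x. exp (f x))"
  using assms(2)
proof (induction k)
  case 0
  then show ?case by (simp add: continuous_on_exp)
next
  case (Suc k)
  have d: "((\<lambda>x. exp (f x)) has_derivative (\<lambda>v. exp (f x) * fd f x v)) (at x)" if "x \<in> S" for x
  proof -
    have "(f has_derivative fd f x) (at x)"
      using Suc that by (intro differentiable_fd) auto
    from has_derivative_exp[OF this] show ?thesis by (simp add: mult.commute)
  qed
  have "Ck_on k S (\<lambda>x. exp (f x) * fd f x v)" for v
    using Suc Suc.IH[OF Ck_on_SucD[OF Suc(2)]]
    by (intro Ck_on_bilinear[OF assms(1) bounded_bilinear_mult]) simp_all
  then show ?case using d by (rule Ck_on_SucI[OF assms(1)])
qed

lemma smooth_on_exp:
  fixes f :: "'a::real_normed_vector \<Rightarrow> real"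
  shows "open S \<Longrightarrow> smooth_on S f \<Longrightarrow> smooth_on S (\<lambda>x. exp (f x))"
  unfolding smooth_on_def by (simp add: Ck_on_exp)

lemmas smooth_on_mult = smooth_on_bilinear[OF _ bounded_bilinear_mult]
lemmas smooth_on_inner = smooth_on_bilinear[OF _ bounded_bilinear_inner]

lemma smooth_on_norm_sq:
  fixes f :: "'a::real_normed_vector \<Rightarrow> 'b::real_inner"
  shows "open S \<Longrightarrow> smooth_on S f \<Longrightarrow> smooth_on S (\<lambda>x. (norm (f x))\<^sup>2)"
  unfolding power2_norm_eq_inner by (rule smooth_on_inner)

lemma smooth_on_sqrt:
  fixes f :: "'a::real_normed_vector \<Rightarrow> real"
  assumes "open S" "smooth_on S f" "\<And>x. x \<in> S \<Longrightarrow> f x > 0"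
  shows "smooth_on S (\<lambda>x. sqrt (f x))"
proof (rule smooth_on_cong[OF assms(1)])
  show "smooth_on S (\<lambda>x. f x * inverse (sqrt (f x)))"
    using assms by (intro smooth_on_mult smooth_on_inverse_sqrt)
  show "f x * inverse (sqrt (f x)) = sqrt (f x)" if "x \<in> S" for x
    using assms(3)[OF that] real_div_sqrt[of "f x"] by (simp add: field_simps)
qed

abbreviation wt :: "real^4 \<Rightarrow> real" where "wt x \<equiv> 1 + (norm x)\<^sup>2"

lemma wt_pos: "wt x > 0"
  by (simp add: add_pos_nonneg)

text \<open>The operator \<open>\<rho>\<^sup>2\<Delta>\<close> of the round metric \<open>\<rho>\<^sup>2 g\<^sub>\<real>\<^sub>4\<close>, \<open>\<rho> = 2 / (1 + |x|\<^sup>2)\<close>, in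
  Euclidean coordinates.\<close>

definition slap :: "(real^4 \<Rightarrow> real) \<Rightarrow> real^4 \<Rightarrow> real" where
  "slap u x = (\<Sum>i\<in>UNIV. fd (\<lambda>y. fd u y (axis i 1)) x (axis i 1))
     - 4 / (wt x) * fd u x x"

lemma slap_add:
  assumes "smooth_on UNIV u" "smooth_on UNIV v"
  shows "slap (\<lambda>x. u x + e * v x) x = slap u x + e * slap v x"
proof -
  have du: "u differentiable at x" "(\<lambda>y. fd u y w) differentiable at x"
    and dv: "v differentiable at x" "(\<lambda>y. fd v y w) differentiable at x" for x w
    using smooth_on_differentiable[OF assms(1)] smooth_on_differentiable[OF assms(2)]
      smooth_on_differentiable[OF smooth_on_fd[OF assms(1)]]
      smooth_on_differentiable[OF smooth_on_fd[OF assms(2)]] by auto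
  have 1: "fd (\<lambda>x. f x + e * g x) x w = fd f x w + e * fd g x w"
    if "f differentiable at x" "g differentiable at x" for f g :: "real^4 \<Rightarrow> real" and x w
    using fd_eq[OF has_derivative_add[OF differentiable_fd[OF that(1)]
          has_derivative_mult_right[OF differentiable_fd[OF that(2)]]]] by simp
  have "(\<lambda>y. fd (\<lambda>x. u x + e * v x) y w) = (\<lambda>y. fd u y w + e * fd v y w)" for w
    using 1[OF du(1) dv(1)] by auto
  then show ?thesis
    unfolding slap_def using 1[OF du(1) dv(1)] 1[OF du(2) dv(2)]
    by (simp add: sum.distrib sum_distrib_left algebra_simps)
qed

section \<open>Maximum principles and barriers\<close>

lemma slap_le_0_at_max:
  assumes "smooth_on UNIV u" "open S" "x \<in> S" "\<And>y. y \<in> S \<Longrightarrow> u y \<le> u x"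
  shows "slap u x \<le> 0" "fd u x v = 0"
proof -
  have du: "u differentiable at y" "(\<lambda>y. fd u y w) differentiable at y" for y w
    using smooth_on_differentiable[OF assms(1)] smooth_on_differentiable[OF smooth_on_fd[OF assms(1)]]
    by auto
  have 0: "fd u x = (\<lambda>v. 0)"
    using differential_zero_maxmin[OF assms(3,2) differentiable_fd[OF du(1)]] assms(4) by blast
  then show "fd u x v = 0" by simp
  have "fd (\<lambda>y. fd u y e) x e \<le> 0" if "norm e = 1" for e
  proof (rule ccontr)
    assume "\<not> fd (\<lambda>y. fd u y e) x e \<le> 0"
    moreover have "((\<lambda>t. fd u (x + t *\<^sub>R e) e) has_real_derivative fd (\<lambda>y. fd u y e) x e) (at 0)"
      using fd_line_real[of "\<lambda>y. fd u y e" x 0 e] du(2) by simp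
    ultimately have "\<exists>d>0. \<forall>h>0. h < d \<longrightarrow> fd u (x + 0 *\<^sub>R e) e < fd u (x + (0 + h) *\<^sub>R e) e"
      by (intro DERIV_pos_inc_right) auto
    then obtain d where d: "d > 0" "\<And>h. 0 < h \<Longrightarrow> h < d \<Longrightarrow> fd u (x + h *\<^sub>R e) e > 0"
      using 0 by auto
    obtain r where r: "r > 0" "ball x r \<subseteq> S" using assms(2,3) open_contains_ball by blast
    define t where "t = min d r / 2"
    have t: "t > 0" "t < d" "t < r" using d(1) r(1) by (auto simp: t_def)
    have "((\<lambda>t. u (x + t *\<^sub>R e)) has_real_derivative fd u (x + s *\<^sub>R e) e) (at s)" for s
      by (rule fd_line_real[OF du(1)])
    then obtain s where s: "0 < s" "s < t" "u (x + t *\<^sub>R e) - u (x + 0 *\<^sub>R e) = (t - 0) * fd u (x + s *\<^sub>R e) e"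
      using MVT2[OF t(1), of "\<lambda>t. u (x + t *\<^sub>R e)" "\<lambda>s. fd u (x + s *\<^sub>R e) e"] by metis
    have "u (x + t *\<^sub>R e) > u x"
      using s t mult_pos_pos[OF t(1) d(2)[of s]] by simp
    moreover have "x + t *\<^sub>R e \<in> S"
      using r t that by (intro subsetD[OF r(2)]) (simp add: dist_norm)
    ultimately show False using assms(4) by fastforce
  qed
  then show "slap u x \<le> 0"
    unfolding slap_def using 0 by (simp add: sum_nonpos)
qed

text \<open>At an interior maximum \<open>slap\<close> would be nonpositive. The strict sign is
  obtained in the applications by adding a small multiple of a strict barrier to a subharmonic
  function.\<close>

lemma annulus_max:
  assumes "smooth_on UNIV v"
    and pos: "\<And>x. r1 < dist z x \<Longrightarrow> dist z x < r2 \<Longrightarrow> slap v x > 0"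
    and bdry: "\<And>x. dist z x = r1 \<or> dist z x = r2 \<Longrightarrow> v x \<le> M"
    and x: "r1 \<le> dist z x" "dist z x \<le> r2"
  shows "v x \<le> M"
proof (rule ccontr)
  assume vx: "\<not> v x \<le> M"
  let ?A = "{x. r1 \<le> dist z x \<and> dist z x \<le> r2}"
  have "?A = cball z r2 \<inter> (dist z -` {r1..})" by auto
  moreover have "closed (dist z -` {r1..})"
    by (intro closed_vimage) (auto intro: continuous_intros)
  ultimately have "compact ?A" by (simp add: compact_Int_closed)
  then obtain y where y: "y \<in> ?A" "\<And>x. x \<in> ?A \<Longrightarrow> v x \<le> v y"
    using continuous_attains_sup[of ?A v] smooth_on_continuous[OF assms(1)] x
      continuous_on_subset[of UNIV v ?A] by (metis (mono_tags, lifting) empty_iff mem_Collect_eq subset_UNIV)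
  then have "v y > M" using x vx by fastforce
  then have ys: "r1 < dist z y" "dist z y < r2" using bdry[of y] y(1) by force+
  let ?O = "{x. r1 < dist z x \<and> dist z x < r2}"
  have "open ?O" by (intro open_Collect_conj open_Collect_less continuous_intros)
  then have "slap v y \<le> 0"
    using slap_le_0_at_max(1)[OF assms(1), of ?O y] ys y(2) by auto
  then show False using pos[OF ys] by simp
qed

lemma sum_axis_inner_sq: "(\<Sum>i\<in>UNIV. (x \<bullet> axis i 1)\<^sup>2) = (norm (x::real^4))\<^sup>2"
  by (simp only: inner_axis power2_norm_eq_inner inner_vec_def[of x x])
    (simp add: power2_eq_square)

lemma smooth_on_ident: "smooth_on S (\<lambda>x. x)"
  by (rule smooth_on_linear) simp

text \<open>The sign of 4 - |x|^2 is the reason why the barrier at the pole is used outside the ball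
  of radius 2.\<close>

lemma slap_sqrt:
  defines "h \<equiv> \<lambda>x. sqrt (wt x)"
  shows "smooth_on UNIV h" "slap h x = (4 - (norm x)\<^sup>2) / (sqrt (wt x))^3"
proof -
  have w: "1 + x \<bullet> x > 0" for x :: "real^4" by (simp add: add_pos_nonneg)
  show "smooth_on UNIV h"
    unfolding h_def by (intro smooth_on_sqrt smooth_on_add smooth_on_const smooth_on_norm_sq smooth_on_ident)
      (auto simp: add_pos_nonneg)
  have d: "(h has_derivative (\<lambda>v. (x \<bullet> v) * inverse (h x))) (at x)" for x
    unfolding h_def power2_norm_eq_inner using w[of x]
    by (auto intro!: derivative_eq_intros simp: inner_commute field_simps)
  have 1: "fd h x = (\<lambda>v. (x \<bullet> v) * inverse (h x))" for x by (rule fd_eq[OF d])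
  have hp: "h x > 0" "(h x)\<^sup>2 = wt x" for x
    using w[of x] by (simp_all add: h_def power2_norm_eq_inner)
  have "((\<lambda>y. (y \<bullet> e) * inverse (h y)) has_derivative
      (\<lambda>v. (x \<bullet> e) * (- (inverse (h x) * ((x \<bullet> v) * inverse (h x)) * inverse (h x)))
        + (v \<bullet> e) * inverse (h x))) (at x)" for e
    using hp(1)[of x]
    by (intro has_derivative_mult Deriv.has_derivative_inverse d) (auto intro!: derivative_eq_intros)
  then have 2: "fd (\<lambda>y. fd h y e) x e = (e \<bullet> e) * inverse (h x) - (x \<bullet> e)\<^sup>2 * inverse (h x) ^ 3" for e
    unfolding 1 by (subst fd_eq, assumption) (simp add: power2_eq_square power3_eq_cube)
  have "slap h x = 4 * inverse (h x) - (norm x)\<^sup>2 * inverse (h x) ^ 3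
      - 4 / (h x)\<^sup>2 * ((norm x)\<^sup>2 * inverse (h x))"
    unfolding slap_def 2 unfolding 1
    by (simp add: sum_subtractf sum_axis_inner_sq sum_distrib_right[symmetric] inner_axis_axis hp
        power2_norm_eq_inner)
  also have "\<dots> = (4 * (h x)\<^sup>2 - 5 * (norm x)\<^sup>2) / h x ^ 3"
    using hp(1)[of x] by (simp add: field_simps power2_eq_square power3_eq_cube)
  also have "\<dots> = (4 - (norm x)\<^sup>2) / h x ^ 3" unfolding hp(2) by simp
  finally show "slap h x = (4 - (norm x)\<^sup>2) / (sqrt (wt x))^3" by (simp add: h_def)
qed

text \<open>Barrier for the Hopf lemma. The first-order term of \<open>slap\<close> is controlled by
  |x| / (1 + |x|^2) \<le> 1/2, so the bracket in the lower bound depends only on the distance from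
  z.\<close>

lemma slap_gauss:
  fixes z :: "real^4" and a :: real
  defines "G \<equiv> \<lambda>x. exp (- a * (norm (x - z))\<^sup>2)"
  assumes "a > 0"
  shows "smooth_on UNIV G" "fd G x v = - 2 * a * ((x - z) \<bullet> v) * G x"
    "slap G x \<ge> a * G x * (4 * a * (norm (x - z))\<^sup>2 - 8 - 4 * norm (x - z))"
proof -
  show "smooth_on UNIV G"
    unfolding G_def by (intro smooth_on_exp smooth_on_mult smooth_on_const smooth_on_norm_sq
        smooth_on_diff smooth_on_ident) auto
  have d: "(G has_derivative (\<lambda>v. - 2 * a * ((x - z) \<bullet> v) * G x)) (at x)" for x
    unfolding G_def power2_norm_eq_inner
    by (auto intro!: derivative_eq_intros simp: inner_commute algebra_simps)
  have 1: "fd G x = (\<lambda>v. - 2 * a * ((x - z) \<bullet> v) * G x)" for x by (rule fd_eq[OF d])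
  then show "fd G x v = - 2 * a * ((x - z) \<bullet> v) * G x" by simp
  have "((\<lambda>y. - 2 * a * ((y - z) \<bullet> e) * G y) has_derivative
      (\<lambda>v. - 2 * a * ((x - z) \<bullet> e) * (- 2 * a * ((x - z) \<bullet> v) * G x) + - 2 * a * (v \<bullet> e) * G x)) (at x)" for e
    by (intro has_derivative_mult d) (auto intro!: derivative_eq_intros)
  then have 2: "fd (\<lambda>y. fd G y e) x e = 4 * a\<^sup>2 * G x * ((x - z) \<bullet> e)\<^sup>2 - 2 * a * (e \<bullet> e) * G x" for e
    unfolding 1 by (subst fd_eq, assumption) (simp add: power2_eq_square)
  have Gp: "G x > 0" by (simp add: G_def)
  have "slap G x = 4 * a\<^sup>2 * G x * (norm (x - z))\<^sup>2 - 8 * a * G x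
      + 8 * a * G x * (((x - z) \<bullet> x) / (wt x))"
    unfolding slap_def 2 unfolding 1
    by (simp add: sum_subtractf sum_axis_inner_sq sum_distrib_left[symmetric] inner_axis_axis)
  moreover have "((x - z) \<bullet> x) / (wt x) \<ge> - norm (x - z) / 2"
  proof -
    have "- ((x - z) \<bullet> x) \<le> norm (x - z) * norm x"
      using norm_cauchy_schwarz[of "- (x - z)" x] by (simp only: inner_minus_left norm_minus_cancel)
    also have "\<dots> \<le> norm (x - z) * ((wt x) / 2)"
      using sum_squares_bound[of 1 "norm x"] by (intro mult_left_mono) auto
    finally show ?thesis by (simp add: divide_simps add_pos_nonneg)
  qed
  then have "8 * a * G x * (((x - z) \<bullet> x) / (wt x)) \<ge> 8 * a * G x * (- norm (x - z) / 2)"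
    using Gp assms(2) by (intro mult_left_mono) auto
  ultimately show "slap G x \<ge> a * G x * (4 * a * (norm (x - z))\<^sup>2 - 8 - 4 * norm (x - z))"
    by (simp add: algebra_simps power2_eq_square)
qed

text \<open>A point of the sphere is removable for bounded subharmonic functions: the barrier
  \<open>sqrt (1 + |x|\<^sup>2)\<close> is superharmonic outside a ball and tends to infinity at the pole.\<close>

lemma bounded_subharmonic_attains_max:
  assumes "smooth_on UNIV u" "\<And>x. u x \<le> C" "\<And>x. slap u x \<ge> 0"
  obtains y where "\<And>x. u x \<le> u y"
proof -
  have "continuous_on (cball 0 2) u"
    using smooth_on_continuous[OF assms(1)] continuous_on_subset by blast
  then obtain y where y: "\<And>x. x \<in> cball 0 2 \<Longrightarrow> u x \<le> u y"
    using continuous_attains_sup[of "cball (0::real^4) 2" u] by (metis compact_cball cball_eq_empty not_numeral_less_zero)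
  have "u x \<le> u y" for x
  proof (cases "norm x \<le> 2")
    case False
    show ?thesis
    proof (rule field_le_epsilon)
      fix e :: real assume e: "e > 0"
      define h where "h x = sqrt (wt x)" for x
      \<comment> \<open>Scaled so that the barrier costs exactly e at the given point x.\<close>
      define d where "d = e / h x"
      have hp: "h x > 0" for x by (simp add: h_def add_pos_nonneg)
      have d: "d > 0" using e hp by (simp add: d_def)
      \<comment> \<open>On the outer sphere h is at least R, so d h is at least C - u y there and
        the bound C on u suffices.\<close>
      define R where "R = max (norm x) ((C - u y) / d)"
      have hR: "h x \<ge> norm x" for x
        unfolding h_def by (rule real_le_rsqrt) simp
      note sq = slap_sqrt(1)[folded h_def] slap_sqrt(2)[folded h_def]
      have "u x + (-d) * h x \<le> u y"
      proof (rule annulus_max[of _ 2 0 R])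
        show "smooth_on UNIV (\<lambda>x. u x + (-d) * h x)"
          by (intro smooth_on_add smooth_on_mult smooth_on_const assms(1) sq(1)) auto
        show "slap (\<lambda>x. u x + (-d) * h x) x > 0" if "2 < dist 0 x" for x
        proof -
          have "slap h x < 0"
            unfolding sq(2) using that power_strict_mono[of 2 "norm x" 2] hp[of x]
            by (intro divide_neg_pos) auto
          then have "0 < - d * slap h x" using d by (simp add: mult_pos_neg)
          then show ?thesis
            unfolding slap_add[OF assms(1) sq(1)] using assms(3)[of x] by simp
        qed
        show "u x + (-d) * h x \<le> u y" if "dist 0 x = 2 \<or> dist 0 x = R" for x
          using that
        proof
          assume "dist 0 x = 2"
          then have "u x \<le> u y" using y by simp
          moreover have "d * h x > 0" using d hp by simp
          ultimately show ?thesis by simp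
        next
          assume "dist 0 x = R"
          then have "(C - u y) / d \<le> h x" using hR[of x] by (simp add: R_def)
          then have "C - u y \<le> d * h x" using d by (simp add: pos_divide_le_eq mult.commute)
          then show ?thesis using assms(2)[of x] by simp
        qed
      qed (use False in \<open>auto simp: R_def\<close>)
      then show "u x \<le> u y + e" using hp[of x] by (simp add: d_def)
    qed
  qed (use y in auto)
  then show thesis by (rule that)
qed

text \<open>Strong maximum principle by the Hopf lemma. Around a point z outside the maximum set
  take the largest open ball that misses this set, and let y be a boundary point of it where the
  maximum is attained. A barrier forces u to decrease from y towards z at a positive rate, but y is
  a critical point of u.\<close>

lemma liouville:
  assumes "smooth_on UNIV u" "\<And>x. u x \<le> C" "\<And>x. slap u x \<ge> 0"
  obtains M where "\<And>x. u x = M"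
proof -
  obtain y0 where y0: "\<And>x. u x \<le> u y0"
    using bounded_subharmonic_attains_max[OF assms] by blast
  define K where "K = u -` {u y0}"
  have cu: "continuous_on UNIV u" by (rule smooth_on_continuous[OF assms(1)])
  have "closed K" unfolding K_def by (intro closed_vimage cu) auto
  have "u z = u y0" for z
  proof (rule ccontr)
    assume z: "u z \<noteq> u y0"
    have "K \<noteq> {}" by (auto simp: K_def)
    then obtain y where y: "y \<in> K" "\<And>x. x \<in> K \<Longrightarrow> dist z y \<le> dist z x"
      using distance_attains_inf[OF \<open>closed K\<close>, of z] by blast
    define R where "R = dist z y"
    have R: "R > 0" using y(1) z by (auto simp: R_def K_def)
    have inside: "u x < u y0" if "dist z x < R" for x
      using y(2)[of x] y0[of x] that by (force simp: R_def K_def)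
    \<comment> \<open>Gives 4 a r^2 > 9 + 4 R for r > R/2, which makes the Gaussian strictly
      subharmonic on the annulus between R/2 and R.\<close>
    define a where "a = (9 + 4 * R) / R\<^sup>2"
    have a: "a > 0" using R by (simp add: a_def)
    define G where "G x = exp (- a * (norm (x - z))\<^sup>2)" for x :: "real^4"
    note Gs = slap_gauss[OF a, where z = z, folded G_def]
    define E where "E = exp (- a * R\<^sup>2)"
    define h where "h x = G x + (- E) * 1" for x :: "real^4"
    have hs: "smooth_on UNIV h"
      unfolding h_def by (intro smooth_on_add smooth_on_const Gs(1)) auto
    have slapc: "slap (\<lambda>x. 1) x = 0" for x by (simp add: slap_def)
    have slh: "slap h x > 0" if "R/2 < dist z x" "dist z x < R" for x
    proof -
      let ?r = "norm (x - z)"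
      have r: "R/2 < ?r" "?r < R" using that by (simp_all add: dist_norm norm_minus_commute)
      have "(R/2)\<^sup>2 < ?r\<^sup>2" using r R by (intro power_strict_mono) auto
      then have "a * R\<^sup>2 < 4 * a * ?r\<^sup>2" using a by (simp add: power_divide)
      moreover have "a * R\<^sup>2 = 9 + 4 * R" using R by (simp add: a_def)
      ultimately have "4 * a * ?r\<^sup>2 - 8 - 4 * ?r > 0" using r by simp
      then have "a * G x * (4 * a * ?r\<^sup>2 - 8 - 4 * ?r) > 0" using a by (simp add: G_def)
      then have "slap G x > 0" using Gs(3)[of x] by linarith
      then show ?thesis
        unfolding h_def slap_add[OF Gs(1) smooth_on_const] slapc by simp
    qed
    have "compact (sphere z (R/2))" "sphere z (R/2) \<noteq> {}" using R by auto
    moreover have "continuous_on (sphere z (R/2)) u" using cu continuous_on_subset by blast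
    ultimately obtain m where m: "m \<in> sphere z (R/2)" "\<And>x. x \<in> sphere z (R/2) \<Longrightarrow> u x \<le> u m"
      using continuous_attains_sup by metis
    \<comment> \<open>The gap below the maximum on the inner sphere. The barrier is at most 1, so
      adding e times it stays below the maximum there; on the outer sphere the barrier is
      zero.\<close>
    define e where "e = u y0 - u m"
    have e: "e > 0" using inside[of m] m(1) R by (simp add: e_def)
    have Gle: "G x \<le> 1" for x using a by (simp add: G_def)
    have Ep: "E > 0" by (simp add: E_def)
    have max: "u x + e * h x \<le> u y0" if "R/2 \<le> dist z x" "dist z x \<le> R" for x
    proof (rule annulus_max[of _ "R/2" z R])
      show "smooth_on UNIV (\<lambda>x. u x + e * h x)"
        by (intro smooth_on_add smooth_on_mult smooth_on_const assms(1) hs) auto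
      show "slap (\<lambda>x. u x + e * h x) x > 0" if "R/2 < dist z x" "dist z x < R" for x
        unfolding slap_add[OF assms(1) hs] using assms(3)[of x] mult_pos_pos[OF e slh[OF that]]
        by simp
      show "u x + e * h x \<le> u y0" if "dist z x = R/2 \<or> dist z x = R" for x
        using that
      proof
        assume "dist z x = R/2"
        then have "u x \<le> u m" by (intro m) simp
        moreover have "e * h x \<le> e * 1"
          using e Gle[of x] Ep by (intro mult_left_mono) (auto simp: h_def)
        ultimately show ?thesis by (simp add: e_def)
      next
        assume "dist z x = R"
        then have "h x = 0" by (simp add: h_def G_def E_def dist_norm norm_minus_commute)
        then show ?thesis using y0 by simp
      qed
    qed (use that in auto)
    define f where "f = (\<lambda>t. u (y + t *\<^sub>R (z - y)) + e * h (y + t *\<^sub>R (z - y)))"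
    have uy: "u y = u y0" using y(1) by (simp add: K_def)
    have fu: "fd u y (z - y) = 0"
      using slap_le_0_at_max(2)[OF assms(1) open_UNIV UNIV_I, of y] y0 uy by simp
    have Gd: "G y = E" by (simp add: G_def E_def R_def dist_norm norm_minus_commute)
    have zy: "(y - z) \<bullet> (z - y) = - R\<^sup>2"
      by (simp add: R_def dist_norm power2_norm_eq_inner inner_diff algebra_simps inner_commute)
    have "fd h y (z - y) = fd G y (z - y)"
      unfolding h_def using fd_add[OF smooth_on_differentiable[OF Gs(1) UNIV_I], where g = "\<lambda>x. (- E) * 1"]
      by simp
    then have fh: "fd h y (z - y) = 2 * a * R\<^sup>2 * E"
      unfolding Gs(2) zy Gd by simp
    \<comment> \<open>Only the barrier contributes to the derivative at y. Being positive, it pushes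
      the sum above its value \<open>u y0\<close>, against \<open>max\<close>.\<close>
    have "(f has_real_derivative (0 + e * (2 * a * R\<^sup>2 * E))) (at 0)"
      unfolding f_def
    proof (intro DERIV_add DERIV_cmult)
      show "((\<lambda>t. u (y + t *\<^sub>R (z - y))) has_real_derivative 0) (at 0)"
        using fd_line_real[OF smooth_on_differentiable[OF assms(1) UNIV_I], where a = y and t = 0 and u = "z - y"] fu by simp
      show "((\<lambda>t. h (y + t *\<^sub>R (z - y))) has_real_derivative (2 * a * R\<^sup>2 * E)) (at 0)"
        using fd_line_real[OF smooth_on_differentiable[OF hs UNIV_I], where a = y and t = 0 and u = "z - y"] fh by simp
    qed
    moreover have "0 + e * (2 * a * R\<^sup>2 * E) > 0" using e a R Ep by simp
    ultimately obtain d where d: "d > 0" "\<And>t. 0 < t \<Longrightarrow> t < d \<Longrightarrow> f 0 < f (0 + t)"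
      using DERIV_pos_inc_right by metis
    define t where "t = min d 1 / 2"
    have t: "0 < t" "t < d" "t \<le> 1/2" using d(1) by (auto simp: t_def)
    have "dist z (y + t *\<^sub>R (z - y)) = norm ((1 - t) *\<^sub>R (z - y))"
      by (simp add: dist_norm algebra_simps)
    also have "\<dots> = (1 - t) * R" using t by (simp add: R_def dist_norm)
    finally have dt: "dist z (y + t *\<^sub>R (z - y)) = (1 - t) * R" .
    have "f t \<le> u y0"
      unfolding f_def
    proof (rule max)
      have "R * (1/2) \<le> R * (1 - t)" "R * (1 - t) \<le> R * 1"
        using t R by (intro mult_left_mono; simp)+
      then show "R/2 \<le> dist z (y + t *\<^sub>R (z - y))" "dist z (y + t *\<^sub>R (z - y)) \<le> R"
        unfolding dt by (simp_all add: mult.commute)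
    qed
    moreover have "f 0 = u y0" using uy Gd by (simp add: f_def h_def)
    ultimately show False using d(2)[OF t(1,2)] by simp
  qed
  then show thesis by (rule that)
qed

section \<open>Quaternions and \<open>su(2)\<close>\<close>

lemma bounded_bilinear_cmat_mult: "bounded_bilinear ((**) :: cmat2 \<Rightarrow> cmat2 \<Rightarrow> cmat2)"
proof -
  have "bilinear ((**) :: cmat2 \<Rightarrow> cmat2 \<Rightarrow> cmat2)"
    unfolding bilinear_def
    by (intro conjI allI linearI)
      (simp_all add: vec_eq_iff matrix_matrix_mult_def sum.distrib scaleR_sum_right algebra_simps)
  then show ?thesis by (simp add: bilinear_conv_bounded_bilinear)
qed

interpretation mm: bounded_bilinear "(**) :: cmat2 \<Rightarrow> cmat2 \<Rightarrow> cmat2"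
  by (rule bounded_bilinear_cmat_mult)

lemmas cmat_ring = comm_def mm.add_left mm.add_right mm.diff_left mm.diff_right mm.minus_left
  mm.minus_right mm.scaleR_left mm.scaleR_right matrix_mul_assoc scaleR_add_right scaleR_diff_right

lemma bounded_bilinear_comm: "bounded_bilinear comm"
proof -
  have "bilinear comm"
    unfolding bilinear_def by (intro conjI allI linearI) (simp_all add: cmat_ring)
  then show ?thesis by (simp add: bilinear_conv_bounded_bilinear)
qed

interpretation cm: bounded_bilinear comm
  by (rule bounded_bilinear_comm)

lemma comm_swap: "comm X Y = - comm Y X"
  by (simp add: comm_def)

lemma comm_self [simp]: "comm X X = 0"
  by (simp add: comm_def)

lemma comm_jacobi: "comm (comm X Y) Z = comm X (comm Y Z) - comm Y (comm X Z)"
  by (simp add: cmat_ring)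

lemma quat_mat_nth:
  "quat_mat x $ 1 $ 1 = Complex (x$1) (x$2)" "quat_mat x $ 1 $ 2 = Complex (x$3) (x$4)"
  "quat_mat x $ 2 $ 1 = Complex (- x$3) (x$4)" "quat_mat x $ 2 $ 2 = Complex (x$1) (- x$2)"
  by (simp_all add: quat_mat_def)

lemma cmat_eq_iff:
  "(X::cmat2) = Y \<longleftrightarrow> X$1$1 = Y$1$1 \<and> X$1$2 = Y$1$2 \<and> X$2$1 = Y$2$1 \<and> X$2$2 = Y$2$2"
  by (auto simp: vec_eq_iff forall_2)

lemma cmat_mult_nth: "((X::cmat2) ** Y) $ i $ j = X$i$1 * Y$1$j + X$i$2 * Y$2$j"
  by (simp add: matrix_matrix_mult_def sum_2)

lemma vector4_nth [simp]:
  "(vector [a,b,c,d] :: real^4) $ 1 = a" "(vector [a,b,c,d] :: real^4) $ 2 = b"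
  "(vector [a,b,c,d] :: real^4) $ 3 = c" "(vector [a,b,c,d] :: real^4) $ 4 = d"
  unfolding vector_def by simp_all

lemma real4_eq_iff: "(x::real^4) = y \<longleftrightarrow> x$1 = y$1 \<and> x$2 = y$2 \<and> x$3 = y$3 \<and> x$4 = y$4"
  by (simp add: vec_eq_iff forall_4)

lemma inner_real4: "(x::real^4) \<bullet> y = x$1 * y$1 + x$2 * y$2 + x$3 * y$3 + x$4 * y$4"
  by (simp add: inner_vec_def sum_4)

lemma qmult_nth:
  "qmult x y $ 1 = x$1 * y$1 - x$2 * y$2 - x$3 * y$3 - x$4 * y$4"
  "qmult x y $ 2 = x$1 * y$2 + x$2 * y$1 + x$3 * y$4 - x$4 * y$3"
  "qmult x y $ 3 = x$1 * y$3 - x$2 * y$4 + x$3 * y$1 + x$4 * y$2"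
  "qmult x y $ 4 = x$1 * y$4 + x$2 * y$3 - x$3 * y$2 + x$4 * y$1"
  by (simp_all add: qmult_def)

lemma qcnj_nth: "qcnj x $ 1 = x$1" "qcnj x $ 2 = - x$2" "qcnj x $ 3 = - x$3" "qcnj x $ 4 = - x$4"
  by (simp_all add: qcnj_def)

lemma qIm_nth: "qIm x $ 1 = 0" "qIm x $ 2 = x$2" "qIm x $ 3 = x$3" "qIm x $ 4 = x$4"
  by (simp_all add: qIm_def)

lemma quat_mat_mult: "quat_mat x ** quat_mat y = quat_mat (qmult x y)"
  by (simp add: cmat_eq_iff cmat_mult_nth quat_mat_nth qmult_nth complex_eq_iff)

lemma linear_quat_mat: "linear quat_mat"
  by (rule linearI) (simp_all add: cmat_eq_iff quat_mat_nth complex_eq_iff)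

lemmas quat_mat_lin = linear_add[OF linear_quat_mat] linear_diff[OF linear_quat_mat]
  linear_scale[OF linear_quat_mat] linear_neg[OF linear_quat_mat]

lemma quat_mat_inner: "quat_mat x \<bullet> quat_mat y = 2 * (x \<bullet> y)"
  by (simp add: inner_vec_def[where 'b = 2] sum_2 quat_mat_nth inner_complex_def inner_real4)

lemma quat_mat_adj: "mat_adj (quat_mat x) = quat_mat (qcnj x)"
  by (simp add: cmat_eq_iff mat_adj_def quat_mat_nth qcnj_nth complex_eq_iff)

lemma quat_mat_det: "det (quat_mat x) = of_real ((norm x)\<^sup>2)"
  by (simp add: det_2 quat_mat_nth complex_eq_iff power2_norm_eq_inner inner_real4)

lemma quat_mat_eq_iff: "quat_mat x = quat_mat y \<longleftrightarrow> x = y"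
  by (auto simp: cmat_eq_iff quat_mat_nth real4_eq_iff)

lemma quat_mat_one: "quat_mat (axis 1 1) = mat 1"
  by (simp add: cmat_eq_iff quat_mat_nth complex_eq_iff axis_def mat_def)

lemma su2_quat: "X \<in> su2 \<longleftrightarrow> (\<exists>x. x$1 = 0 \<and> X = quat_mat x)"
proof
  assume "X \<in> su2"
  then have a: "mat_adj X = - X" "X$1$1 + X$2$2 = 0" by (simp_all add: su2_def trace_def sum_2)
  then have "cnj (X$1$1) = - X$1$1" "cnj (X$1$2) = - X$2$1"
    by (simp_all add: cmat_eq_iff mat_adj_def)
  then have "X = quat_mat (vector [0, Im (X$1$1), Re (X$1$2), Im (X$1$2)])"
    using a(2) by (auto simp: cmat_eq_iff quat_mat_nth complex_eq_iff)
  then show "\<exists>x. x$1 = 0 \<and> X = quat_mat x" by (metis vector4_nth(1))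
next
  assume "\<exists>x. x$1 = 0 \<and> X = quat_mat x"
  then obtain x where "x$1 = 0" and X: "X = quat_mat x" by blast
  then show "X \<in> su2"
    unfolding X by (auto simp: su2_def quat_mat_adj cmat_eq_iff quat_mat_nth qcnj_nth complex_eq_iff trace_def sum_2)
qed

lemma su2E:
  assumes "X \<in> su2" obtains x where "x$1 = 0" "X = quat_mat x"
  using assms su2_quat by blast

lemma quat_mat_su2: "quat_mat x \<in> su2 \<longleftrightarrow> x$1 = 0"
  by (auto simp: su2_quat quat_mat_eq_iff)

lemma subspace_su2: "subspace su2"
proof -
  have "subspace {x::real^4. x$1 = 0}" by (simp add: subspace_def)
  moreover have "su2 = quat_mat ` {x. x$1 = 0}" by (auto simp: su2_quat)
  ultimately show ?thesis using linear_subspace_image[OF linear_quat_mat] by metis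
qed

lemma comm_quat: "comm (quat_mat x) (quat_mat y) = quat_mat (qmult x y - qmult y x)"
  by (simp add: comm_def quat_mat_mult quat_mat_lin)

lemma comm_su2: "X \<in> su2 \<Longrightarrow> Y \<in> su2 \<Longrightarrow> comm X Y \<in> su2"
  by (elim su2E) (simp add: comm_quat quat_mat_su2 qmult_nth)

lemma ad_invariant:
  assumes "A \<in> su2" "X \<in> su2" "Y \<in> su2"
  shows "comm A X \<bullet> Y = - (X \<bullet> comm A Y)"
  using assms by (elim su2E) (simp add: comm_quat quat_mat_inner inner_real4 qmult_nth algebra_simps)

lemma comm_cyclic:
  assumes "X \<in> su2" "Y \<in> su2" "Z \<in> su2"
  shows "Y \<bullet> comm Z X = X \<bullet> comm Y Z"
  using assms by (elim su2E) (simp add: comm_quat quat_mat_inner inner_real4 qmult_nth algebra_simps)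

text \<open>The commutator of imaginary quaternions is twice the cross product, so this is the
  Lagrange identity with the square of the inner product dropped. The factor 2 comes from
  \<open>quat_mat\<close> multiplying squared norms by 2.\<close>

lemma norm_comm_le:
  assumes "X \<in> su2" "Y \<in> su2"
  shows "(norm (comm X Y))\<^sup>2 \<le> 2 * (norm X)\<^sup>2 * (norm Y)\<^sup>2"
proof -
  obtain x y where x: "x$1 = 0" "X = quat_mat x" and y: "y$1 = 0" "Y = quat_mat y"
    using assms su2E by metis
  have "2 * (X \<bullet> X) * (Y \<bullet> Y) - comm X Y \<bullet> comm X Y = 8 * (x$2 * y$2 + x$3 * y$3 + x$4 * y$4)\<^sup>2"
    unfolding x y by (simp add: comm_quat quat_mat_inner inner_real4 qmult_nth x y power2_eq_square algebra_simps)
  then show ?thesis unfolding power2_norm_eq_inner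
    using zero_le_power2[of "x$2 * y$2 + x$3 * y$3 + x$4 * y$4"] by linarith
qed

text \<open>Expanding the squares reduces the claim to: the squared norms of the three commutators
  sum to at most 64 N. By \<open>norm_comm_le\<close> and the inequality between quadratic means
  they sum to at most (2/3) N^2, and (2/3) 96 = 64 uses up the bound on N. With the coefficient 1/8
  the squares vanish at (-4 \<open>E1\<close>, -4 \<open>E2\<close>, -4 \<open>E3\<close>), the
  weighted BPST field.\<close>

lemma cubic_inequality:
  assumes "X \<in> su2" "Y \<in> su2" "Z \<in> su2"
    and N: "N = (norm X)\<^sup>2 + (norm Y)\<^sup>2 + (norm Z)\<^sup>2" "N \<le> 96"
  shows "8 * ((norm (X + (1/8) *\<^sub>R comm Y Z))\<^sup>2 + (norm (Y + (1/8) *\<^sub>R comm Z X))\<^sup>2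
      + (norm (Z + (1/8) *\<^sub>R comm X Y))\<^sup>2) \<le> 16 * N + 6 * (X \<bullet> comm Y Z)"
proof -
  have sq: "(norm (P + (1/8) *\<^sub>R Q))\<^sup>2 = (norm P)\<^sup>2 + (P \<bullet> Q) / 4 + (norm Q)\<^sup>2 / 64" for P Q :: cmat2
    unfolding power2_norm_eq_inner by (simp add: inner_add inner_commute)
  have cyc: "Y \<bullet> comm Z X = X \<bullet> comm Y Z" "Z \<bullet> comm X Y = X \<bullet> comm Y Z"
    using comm_cyclic assms by metis+
  let ?x = "(norm X)\<^sup>2" and ?y = "(norm Y)\<^sup>2" and ?z = "(norm Z)\<^sup>2"
  have n: "(norm (comm Y Z))\<^sup>2 \<le> 2 * ?y * ?z" "(norm (comm Z X))\<^sup>2 \<le> 2 * ?z * ?x"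
      "(norm (comm X Y))\<^sup>2 \<le> 2 * ?x * ?y"
    using norm_comm_le assms by blast+
  have "3 * (?y * ?z + ?z * ?x + ?x * ?y) \<le> N * N"
    using zero_le_power2[of "?x - ?y"] zero_le_power2[of "?y - ?z"] zero_le_power2[of "?z - ?x"]
    unfolding N(1) by (simp add: power2_eq_square algebra_simps)
  also have "N * N \<le> 96 * N" using N by (intro mult_right_mono) auto
  finally have "?y * ?z + ?z * ?x + ?x * ?y \<le> 32 * N" by simp
  then have "(norm (comm Y Z))\<^sup>2 + (norm (comm Z X))\<^sup>2 + (norm (comm X Y))\<^sup>2 \<le> 64 * N"
    using n by simp
  then show ?thesis unfolding sq cyc N(1) by simp
qed

section \<open>The self-dual curvature of a Yang-Mills field\<close>

locale gauge_field =
  fixes U :: "(real^4) set" and a :: "real^4 \<Rightarrow> real^4 \<Rightarrow> cmat2"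
  assumes open_U: "open U"
    and smooth_a: "smooth_on U (\<lambda>x. a x v)"
    and su2_a: "x \<in> U \<Longrightarrow> a x v \<in> su2"
    and linear_a: "x \<in> U \<Longrightarrow> linear (a x)"
begin

lemma diff_a: "x \<in> U \<Longrightarrow> (\<lambda>y. a y v) differentiable at x"
  using smooth_on_differentiable[OF smooth_a] .

text \<open>\<open>su2\<close> is cut out by real-linear equations, and these can be
  differentiated.\<close>

lemma fd_su2:
  assumes "s differentiable at x" "x \<in> U" "\<And>y. y \<in> U \<Longrightarrow> s y \<in> su2"
  shows "fd s x v \<in> su2"
proof -
  have l: "linear (\<lambda>M. mat_adj M + M)" "linear (trace :: cmat2 \<Rightarrow> complex)"
    by (rule linearI; simp add: cmat_eq_iff mat_adj_def trace_def sum_2 complex_eq_iff algebra_simps)+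
  then have "fd (\<lambda>y. mat_adj (s y) + s y) x v = mat_adj (fd s x v) + fd s x v"
      "fd (\<lambda>y. trace (s y)) x v = trace (fd s x v)"
    using fd_bounded_linear[OF _ assms(1), of "\<lambda>M. mat_adj M + M"] fd_bounded_linear[OF _ assms(1), of trace]
      l[unfolded linear_conv_bounded_linear] by simp_all
  moreover have "fd (\<lambda>y. mat_adj (s y) + s y) x = fd (\<lambda>y. 0) x" "fd (\<lambda>y. trace (s y)) x = fd (\<lambda>y. 0) x"
    using assms(3) by (intro fd_cong[OF open_U assms(2)]; simp add: su2_def)+
  ultimately show ?thesis by (simp add: su2_def eq_neg_iff_add_eq_0)
qed

lemma cov_deriv_su2:
  "s differentiable at x \<Longrightarrow> x \<in> U \<Longrightarrow> (\<And>y. y \<in> U \<Longrightarrow> s y \<in> su2) \<Longrightarrow> cov_deriv a s x v \<in> su2"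
  unfolding cov_deriv_def using fd_su2 comm_su2 su2_a subspace_add[OF subspace_su2] by simp

lemma curvature_su2: "x \<in> U \<Longrightarrow> curvature a x u v \<in> su2"
  unfolding curvature_def
  by (intro subspace_add[OF subspace_su2] subspace_diff[OF subspace_su2] fd_su2 diff_a comm_su2 su2_a)

lemma smooth_cov_deriv: "smooth_on U s \<Longrightarrow> smooth_on U (\<lambda>x. cov_deriv a s x u)"
  unfolding cov_deriv_def
  by (intro smooth_on_add smooth_on_fd smooth_on_bilinear[OF _ bounded_bilinear_comm] smooth_a open_U)

lemma smooth_curvature: "smooth_on U (\<lambda>x. curvature a x u v)"
  unfolding curvature_def
  by (intro smooth_on_add smooth_on_diff smooth_on_fd smooth_on_bilinear[OF _ bounded_bilinear_comm]
      smooth_a open_U)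

lemma cov_deriv_cong: "x \<in> U \<Longrightarrow> (\<And>y. y \<in> U \<Longrightarrow> s y = t y) \<Longrightarrow> cov_deriv a s x v = cov_deriv a t x v"
  unfolding cov_deriv_def using fd_cong[OF open_U, of x s t] by simp

lemma cov_deriv_zero: "cov_deriv a (\<lambda>y. 0) x v = 0"
  by (simp add: cov_deriv_def cm.zero_right)

lemma cov_deriv_add:
  "x \<in> U \<Longrightarrow> smooth_on U s \<Longrightarrow> smooth_on U t
    \<Longrightarrow> cov_deriv a (\<lambda>y. s y + t y) x v = cov_deriv a s x v + cov_deriv a t x v"
  unfolding cov_deriv_def by (simp add: fd_add smooth_on_differentiable cm.add_right)

lemma cov_deriv_diff:
  "x \<in> U \<Longrightarrow> smooth_on U s \<Longrightarrow> smooth_on U t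
    \<Longrightarrow> cov_deriv a (\<lambda>y. s y - t y) x v = cov_deriv a s x v - cov_deriv a t x v"
  unfolding cov_deriv_def by (simp add: fd_diff smooth_on_differentiable cm.diff_right)

lemma fd_comm:
  "f differentiable at x \<Longrightarrow> g differentiable at x
    \<Longrightarrow> fd (\<lambda>y. comm (f y) (g y)) x v = comm (f x) (fd g x v) + comm (fd f x v) (g x)"
  by (rule fd_bilinear[OF bounded_bilinear_comm])

text \<open>Metric compatibility: the bracket terms cancel because bracketing with an element of
  \<open>su2\<close> is skew.\<close>

lemma fd_inner:
  assumes "x \<in> U" "smooth_on U s" "smooth_on U t" "\<And>y. y \<in> U \<Longrightarrow> s y \<in> su2" "\<And>y. y \<in> U \<Longrightarrow> t y \<in> su2"
  shows "fd (\<lambda>y. s y \<bullet> t y) x u = cov_deriv a s x u \<bullet> t x + s x \<bullet> cov_deriv a t x u"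
proof -
  have "fd (\<lambda>y. s y \<bullet> t y) x u = s x \<bullet> fd t x u + fd s x u \<bullet> t x"
    using assms by (intro fd_bilinear[OF bounded_bilinear_inner] smooth_on_differentiable)
  then show ?thesis
    unfolding cov_deriv_def using ad_invariant[of "a x u" "s x" "t x"] assms su2_a
    by (simp add: inner_add)
qed

text \<open>The directions u and v are constant vector fields on flat space, so neither a
  Christoffel term nor a Lie bracket term appears.\<close>

lemma ricci:
  assumes x: "x \<in> U" and s: "smooth_on U s"
  shows "cov_deriv a (\<lambda>y. cov_deriv a s y v) x u - cov_deriv a (\<lambda>y. cov_deriv a s y u) x v
    = comm (curvature a x u v) (s x)"
proof -
  have 1: "cov_deriv a (\<lambda>y. cov_deriv a s y v) x u = fd (\<lambda>y. fd s y v) x u + comm (a x v) (fd s x u)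
      + comm (fd (\<lambda>y. a y v) x u) (s x) + comm (a x u) (fd s x v) + comm (a x u) (comm (a x v) (s x))" for u v
  proof -
    have d: "(\<lambda>y. fd s y v) differentiable at x" "s differentiable at x"
      using smooth_on_differentiable x s smooth_on_fd by blast+
    have "fd (\<lambda>y. comm (a y v) (s y)) x u = comm (a x v) (fd s x u) + comm (fd (\<lambda>y. a y v) x u) (s x)"
      by (intro fd_comm diff_a[OF x] d)
    moreover have "(\<lambda>y. comm (a y v) (s y)) differentiable at x"
      by (intro smooth_on_differentiable[OF _ x] smooth_on_bilinear[OF open_U bounded_bilinear_comm] smooth_a s)
    ultimately show ?thesis
      unfolding cov_deriv_def by (simp add: fd_add d cm.add_right)
  qed
  have 2: "fd (\<lambda>y. fd s y v) x u = fd (\<lambda>y. fd s y u) x v" by (rule fd_commute[OF open_U x s])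
  show ?thesis
    unfolding 1 2 curvature_def cm.add_left cm.diff_left comm_jacobi by simp
qed

text \<open>The second derivatives of the form cancel by symmetry, the brackets with one first
  derivative cancel in pairs by antisymmetry, and the double brackets cancel by the Jacobi
  identity.\<close>

lemma bianchi:
  assumes x: "x \<in> U"
  shows "cov_deriv a (\<lambda>y. curvature a y v w) x u + cov_deriv a (\<lambda>y. curvature a y w u) x v
    + cov_deriv a (\<lambda>y. curvature a y u v) x w = 0"
proof -
  have 1: "cov_deriv a (\<lambda>y. curvature a y v w) x u = fd (\<lambda>y. fd (\<lambda>y. a y w) y v) x u
      - fd (\<lambda>y. fd (\<lambda>y. a y v) y w) x u + comm (a x v) (fd (\<lambda>y. a y w) x u)
      + comm (fd (\<lambda>y. a y v) x u) (a x w) + comm (a x u) (fd (\<lambda>y. a y w) x v)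
      - comm (a x u) (fd (\<lambda>y. a y v) x w) + comm (a x u) (comm (a x v) (a x w))" for u v w
  proof -
    have d: "(\<lambda>y. fd (\<lambda>y. a y v) y w) differentiable at x" for v w
      using smooth_on_differentiable[OF smooth_on_fd[OF smooth_a] x] .
    have "fd (\<lambda>y. comm (a y v) (a y w)) x u
        = comm (a x v) (fd (\<lambda>y. a y w) x u) + comm (fd (\<lambda>y. a y v) x u) (a x w)"
      by (intro fd_comm diff_a[OF x])
    moreover have "(\<lambda>y. comm (a y v) (a y w)) differentiable at x"
      by (intro smooth_on_differentiable[OF _ x] smooth_on_bilinear[OF open_U bounded_bilinear_comm] smooth_a)
    ultimately show ?thesis
      unfolding cov_deriv_def curvature_def
      by (simp add: fd_add fd_diff differentiable_diff d cm.add_right cm.diff_right)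
  qed
  have 2: "fd (\<lambda>y. fd (\<lambda>y. a y t) y v) x u = fd (\<lambda>y. fd (\<lambda>y. a y t) y u) x v" for t u v
    by (rule fd_commute[OF open_U x smooth_a])
  have 3: "comm (a x u) (comm (a x v) (a x w)) + comm (a x v) (comm (a x w) (a x u))
      + comm (a x w) (comm (a x u) (a x v)) = 0"
    by (simp add: cmat_ring)
  note swap = comm_swap[of "fd (\<lambda>y. a y t) x r" "a x s" for t r s]
  show ?thesis
    unfolding 1 2[of w u v] 2[of v u w] 2[of u w v] swap using 3 by (simp add: add.assoc)
qed

lemma curvature_swap: "curvature a x u v = - curvature a x v u"
  unfolding curvature_def by (simp add: comm_swap[of "a x u"])

end

section \<open>The self-dual components and their differential equations\<close>

abbreviation e4 :: "4 \<Rightarrow> real^4" where "e4 i \<equiv> axis i 1"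

text \<open>Twice a component of F^+, for the orientation in which the BPST form is self-dual; the
  index pairs of \<open>sd2\<close> and \<open>sd3\<close> arise by cyclic permutation of 2, 3,
  4.\<close>

definition sd1 :: "(real^4 \<Rightarrow> real^4 \<Rightarrow> cmat2) \<Rightarrow> real^4 \<Rightarrow> cmat2" where
  "sd1 a x = curvature a x (e4 1) (e4 2) + curvature a x (e4 3) (e4 4)"
definition sd2 :: "(real^4 \<Rightarrow> real^4 \<Rightarrow> cmat2) \<Rightarrow> real^4 \<Rightarrow> cmat2" where
  "sd2 a x = curvature a x (e4 1) (e4 3) + curvature a x (e4 4) (e4 2)"
definition sd3 :: "(real^4 \<Rightarrow> real^4 \<Rightarrow> cmat2) \<Rightarrow> real^4 \<Rightarrow> cmat2" where
  "sd3 a x = curvature a x (e4 1) (e4 4) + curvature a x (e4 2) (e4 3)"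

definition sd_norm :: "(real^4 \<Rightarrow> real^4 \<Rightarrow> cmat2) \<Rightarrow> real^4 \<Rightarrow> real" where
  "sd_norm a x = sd1 a x \<bullet> sd1 a x + sd2 a x \<bullet> sd2 a x + sd3 a x \<bullet> sd3 a x"

text \<open>This is the Euclidean equation; \<open>yang_mills_conformal\<close> derives it from the
  one for the round metric.\<close>

locale yang_mills_field = gauge_field +
  assumes yang_mills: "x \<in> U \<Longrightarrow>
    (\<Sum>i\<in>UNIV. cov_deriv a (\<lambda>y. curvature a y (e4 i) (e4 j)) x (e4 i)) = 0"
begin

abbreviation D :: "4 \<Rightarrow> (real^4 \<Rightarrow> cmat2) \<Rightarrow> real^4 \<Rightarrow> cmat2" where
  "D i s x \<equiv> cov_deriv a s x (e4 i)"
abbreviation F :: "4 \<Rightarrow> 4 \<Rightarrow> real^4 \<Rightarrow> cmat2" where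
  "F i j x \<equiv> curvature a x (e4 i) (e4 j)"

lemma sd_smooth: "smooth_on U (sd1 a)" "smooth_on U (sd2 a)" "smooth_on U (sd3 a)"
  unfolding sd1_def[abs_def] sd2_def[abs_def] sd3_def[abs_def]
  by (intro smooth_on_add open_U smooth_curvature)+

lemma sd_su2: "x \<in> U \<Longrightarrow> sd1 a x \<in> su2" "x \<in> U \<Longrightarrow> sd2 a x \<in> su2" "x \<in> U \<Longrightarrow> sd3 a x \<in> su2"
  by (simp_all add: sd1_def sd2_def sd3_def subspace_add[OF subspace_su2] curvature_su2)

lemma D_curvature_swap: "x \<in> U \<Longrightarrow> D k (F i j) x = - D k (F j i) x"
proof -
  assume x: "x \<in> U"
  have "D k (\<lambda>y. 0 - F j i y) x = D k (\<lambda>y. 0) x - D k (F j i) x"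
    by (intro cov_deriv_diff smooth_curvature smooth_on_const x)
  moreover have "(\<lambda>y. 0 - F j i y) = F i j"
    using curvature_swap[of _ "e4 i" "e4 j"] by auto
  ultimately show ?thesis by (simp add: cov_deriv_zero)
qed

lemma sd_first_order:
  assumes x: "x \<in> U"
  shows "D 2 (sd1 a) x + D 3 (sd2 a) x + D 4 (sd3 a) x = 0" (is "?A = 0")
    "D 1 (sd1 a) x - D 3 (sd3 a) x + D 4 (sd2 a) x = 0" (is "?B = 0")
    "D 1 (sd2 a) x + D 2 (sd3 a) x - D 4 (sd1 a) x = 0" (is "?C = 0")
    "D 1 (sd3 a) x - D 2 (sd2 a) x + D 3 (sd1 a) x = 0" (is "?D = 0")
proof -
  have sd: "D i (sd1 a) x = D i (F 1 2) x + D i (F 3 4) x"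
      "D i (sd2 a) x = D i (F 1 3) x + D i (F 4 2) x"
      "D i (sd3 a) x = D i (F 1 4) x + D i (F 2 3) x" for i
    unfolding sd1_def[abs_def] sd2_def[abs_def] sd3_def[abs_def]
    by (intro cov_deriv_add smooth_curvature x)+
  note swap = D_curvature_swap[OF x]
  \<comment> \<open>The vanishing diagonal terms are needed below to complete the Yang-Mills
    sums.\<close>
  have "F j j = (\<lambda>y. 0)" for j by (rule ext) (simp add: curvature_def)
  then have F0: "D i (F j j) x = 0" for i j by (simp only: cov_deriv_zero)
  note sw = swap[where i = 2 and j = 1] swap[where i = 3 and j = 1] swap[where i = 4 and j = 1]
    swap[where i = 3 and j = 2] swap[where i = 2 and j = 4] swap[where i = 4 and j = 3]
  note ym = yang_mills[OF x, unfolded sum_4]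
  \<comment> \<open>Each of the four equations combines the Yang-Mills equation for one index with
    the Bianchi identity for the other three indices.\<close>
  have "?A =
      (D 3 (F 4 2) x + D 4 (F 2 3) x + D 2 (F 3 4) x)
      - (D 1 (F 1 1) x + D 2 (F 2 1) x + D 3 (F 3 1) x + D 4 (F 4 1) x)"
    by (simp add: sd F0 sw)
  then show "?A = 0"
    unfolding ym bianchi[OF x] by simp
  have "?B =
      (D 3 (F 4 1) x + D 4 (F 1 3) x + D 1 (F 3 4) x)
      + (D 1 (F 1 2) x + D 2 (F 2 2) x + D 3 (F 3 2) x + D 4 (F 4 2) x)"
    by (simp add: sd F0 sw)
  then show "?B = 0"
    unfolding ym bianchi[OF x] by simp
  have "?C =
      (D 4 (F 2 1) x + D 2 (F 1 4) x + D 1 (F 4 2) x)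
      + (D 1 (F 1 3) x + D 2 (F 2 3) x + D 3 (F 3 3) x + D 4 (F 4 3) x)"
    by (simp add: sd F0 sw)
  then show "?C = 0"
    unfolding ym bianchi[OF x] by simp
  have "?D =
      (D 2 (F 3 1) x + D 3 (F 1 2) x + D 1 (F 2 3) x)
      + (D 1 (F 1 4) x + D 2 (F 2 4) x + D 3 (F 3 4) x + D 4 (F 4 4) x)"
    by (simp add: sd F0 sw)
  then show "?D = 0"
    unfolding ym bianchi[OF x] by simp
qed

text \<open>The square of the Dirac-type operator: once the first-order equations are differentiated
  and combined, only commutators of covariant derivatives remain, hence curvature components. These
  pair up into \<open>sd1\<close>, \<open>sd2\<close>, \<open>sd3\<close>, and so the anti-self-dual
  part drops out.\<close>

lemma weitzenboeck:
  assumes x: "x \<in> U"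
  shows "(\<Sum>i\<in>UNIV. D i (D i (sd1 a)) x) = 2 *\<^sub>R comm (sd2 a x) (sd3 a x)" (is "?A = _")
    "(\<Sum>i\<in>UNIV. D i (D i (sd2 a)) x) = 2 *\<^sub>R comm (sd3 a x) (sd1 a x)" (is "?B = _")
    "(\<Sum>i\<in>UNIV. D i (D i (sd3 a)) x) = 2 *\<^sub>R comm (sd1 a x) (sd2 a x)" (is "?C = _")
proof -
  let ?s = "sd1 a" and ?t = "sd2 a" and ?u = "sd3 a"
  note sm = smooth_cov_deriv[OF sd_smooth(1)] smooth_cov_deriv[OF sd_smooth(2)]
    smooth_cov_deriv[OF sd_smooth(3)]
  have z: "D k f x = 0" if "\<And>y. y \<in> U \<Longrightarrow> f y = 0" for k f
    using cov_deriv_cong[OF x, of f "\<lambda>y. 0"] that cov_deriv_zero by simp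
  have pp: "D k (\<lambda>y. f y + g y + h y) x = D k f x + D k g x + D k h x"
    and pm: "D k (\<lambda>y. f y + g y - h y) x = D k f x + D k g x - D k h x"
    and mp: "D k (\<lambda>y. f y - g y + h y) x = D k f x - D k g x + D k h x"
    if "smooth_on U f" "smooth_on U g" "smooth_on U h" for k f g h
    using that x by (simp_all add: cov_deriv_add cov_deriv_diff smooth_on_add smooth_on_diff open_U)
  have E0: "D k (D 2 ?s) x + D k (D 3 ?t) x + D k (D 4 ?u) x = 0" for k
  proof -
    have "D k (\<lambda>y. D 2 ?s y + D 3 ?t y + D 4 ?u y) x = 0" by (rule z) (rule sd_first_order)
    then show ?thesis unfolding pp[OF sm] .
  qed
  have E1: "D k (D 1 ?s) x - D k (D 3 ?u) x + D k (D 4 ?t) x = 0" for k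
  proof -
    have "D k (\<lambda>y. D 1 ?s y - D 3 ?u y + D 4 ?t y) x = 0" by (rule z) (rule sd_first_order)
    then show ?thesis unfolding mp[OF sm(1,3,2)] .
  qed
  have E2: "D k (D 1 ?t) x + D k (D 2 ?u) x - D k (D 4 ?s) x = 0" for k
  proof -
    have "D k (\<lambda>y. D 1 ?t y + D 2 ?u y - D 4 ?s y) x = 0" by (rule z) (rule sd_first_order)
    then show ?thesis unfolding pm[OF sm(2,3,1)] .
  qed
  have E3: "D k (D 1 ?u) x - D k (D 2 ?t) x + D k (D 3 ?s) x = 0" for k
  proof -
    have "D k (\<lambda>y. D 1 ?u y - D 2 ?t y + D 3 ?s y) x = 0" by (rule z) (rule sd_first_order)
    then show ?thesis unfolding mp[OF sm(3,2,1)] .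
  qed
  note rc = ricci[OF x sd_smooth(1)] ricci[OF x sd_smooth(2)] ricci[OF x sd_smooth(3)]
  have F: "F 4 2 x = - F 2 4 x" by (rule curvature_swap)
  \<comment> \<open>The Laplacian is completed by the derivatives of the first-order equations:
    \<open>E1\<close> in direction 1, \<open>E0\<close> in direction 2, \<open>E3\<close> in
    direction 3 and \<open>E2\<close> in direction 4. The terms added for this pair up into
    commutators.\<close>
  have "?A =
      (D 1 (D 1 ?s) x - D 1 (D 3 ?u) x + D 1 (D 4 ?t) x)
    + (D 2 (D 2 ?s) x + D 2 (D 3 ?t) x + D 2 (D 4 ?u) x)
    + (D 3 (D 1 ?u) x - D 3 (D 2 ?t) x + D 3 (D 3 ?s) x)
    - (D 4 (D 1 ?t) x + D 4 (D 2 ?u) x - D 4 (D 4 ?s) x)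
    + (D 1 (D 3 ?u) x - D 3 (D 1 ?u) x) - (D 1 (D 4 ?t) x - D 4 (D 1 ?t) x)
    - (D 2 (D 3 ?t) x - D 3 (D 2 ?t) x) - (D 2 (D 4 ?u) x - D 4 (D 2 ?u) x)"
    unfolding sum_4 by simp
  also have "\<dots> = comm (F 1 3 x) (sd3 a x) - comm (F 1 4 x) (sd2 a x) - comm (F 2 3 x) (sd2 a x)
      - comm (F 2 4 x) (sd3 a x)"
    unfolding E0 E1 E2 E3 rc by simp
  also have "\<dots> = comm (sd2 a x) (sd3 a x) - comm (sd3 a x) (sd2 a x)"
    by (simp add: sd2_def sd3_def F cm.add_left cm.minus_left cm.diff_left)
  finally show "?A = 2 *\<^sub>R comm (sd2 a x) (sd3 a x)"
    using comm_swap[of "sd3 a x" "sd2 a x"] by (simp add: scaleR_2)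
  have "?B =
      (D 3 (D 2 ?s) x + D 3 (D 3 ?t) x + D 3 (D 4 ?u) x)
    + (D 1 (D 1 ?t) x + D 1 (D 2 ?u) x - D 1 (D 4 ?s) x)
    + (D 4 (D 1 ?s) x - D 4 (D 3 ?u) x + D 4 (D 4 ?t) x)
    - (D 2 (D 1 ?u) x - D 2 (D 2 ?t) x + D 2 (D 3 ?s) x)
    + (D 2 (D 3 ?s) x - D 3 (D 2 ?s) x) - (D 3 (D 4 ?u) x - D 4 (D 3 ?u) x)
    - (D 1 (D 2 ?u) x - D 2 (D 1 ?u) x) + (D 1 (D 4 ?s) x - D 4 (D 1 ?s) x)"
    unfolding sum_4 by simp
  also have "\<dots> = comm (F 2 3 x) (sd1 a x) - comm (F 3 4 x) (sd3 a x) - comm (F 1 2 x) (sd3 a x)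
      + comm (F 1 4 x) (sd1 a x)"
    unfolding E0 E1 E2 E3 rc by simp
  also have "\<dots> = comm (sd3 a x) (sd1 a x) - comm (sd1 a x) (sd3 a x)"
    by (simp add: sd1_def sd3_def cm.add_left)
  finally show "?B = 2 *\<^sub>R comm (sd3 a x) (sd1 a x)"
    using comm_swap[of "sd1 a x" "sd3 a x"] by (simp add: scaleR_2)
  have "?C =
      (D 4 (D 2 ?s) x + D 4 (D 3 ?t) x + D 4 (D 4 ?u) x)
    + (D 1 (D 1 ?u) x - D 1 (D 2 ?t) x + D 1 (D 3 ?s) x)
    - (D 3 (D 1 ?s) x - D 3 (D 3 ?u) x + D 3 (D 4 ?t) x)
    + (D 2 (D 1 ?t) x + D 2 (D 2 ?u) x - D 2 (D 4 ?s) x)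
    + (D 2 (D 4 ?s) x - D 4 (D 2 ?s) x) + (D 3 (D 4 ?t) x - D 4 (D 3 ?t) x)
    + (D 1 (D 2 ?t) x - D 2 (D 1 ?t) x) - (D 1 (D 3 ?s) x - D 3 (D 1 ?s) x)"
    unfolding sum_4 by simp
  also have "\<dots> = comm (F 2 4 x) (sd1 a x) + comm (F 3 4 x) (sd2 a x) + comm (F 1 2 x) (sd2 a x)
      - comm (F 1 3 x) (sd1 a x)"
    unfolding E0 E1 E2 E3 rc by simp
  also have "\<dots> = comm (sd1 a x) (sd2 a x) - comm (sd2 a x) (sd1 a x)"
    by (simp add: sd1_def sd2_def F cm.add_left cm.minus_left cm.diff_left)
  finally show "?C = 2 *\<^sub>R comm (sd1 a x) (sd2 a x)"
    using comm_swap[of "sd2 a x" "sd1 a x"] by (simp add: scaleR_2)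
qed

lemma fd_sd_norm:
  assumes x: "x \<in> U"
  shows "fd (sd_norm a) x v = 2 * (sd1 a x \<bullet> cov_deriv a (sd1 a) x v
    + sd2 a x \<bullet> cov_deriv a (sd2 a) x v + sd3 a x \<bullet> cov_deriv a (sd3 a) x v)"
proof -
  note di = smooth_on_differentiable[OF smooth_on_inner[OF open_U] x]
  note d = di[OF sd_smooth(1,1)] di[OF sd_smooth(2,2)] di[OF sd_smooth(3,3)]
  have "fd (\<lambda>x. sd1 a x \<bullet> sd1 a x + sd2 a x \<bullet> sd2 a x + sd3 a x \<bullet> sd3 a x) x v
      = fd (\<lambda>x. sd1 a x \<bullet> sd1 a x) x v + fd (\<lambda>x. sd2 a x \<bullet> sd2 a x) x v + fd (\<lambda>x. sd3 a x \<bullet> sd3 a x) x v"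
    by (simp only: fd_add differentiable_add d)
  then show ?thesis
    unfolding sd_norm_def[abs_def] using fd_inner[OF x] sd_smooth sd_su2
    by (simp add: inner_commute)
qed

lemma smooth_sd_norm: "smooth_on U (sd_norm a)"
  unfolding sd_norm_def[abs_def] by (intro smooth_on_add smooth_on_inner open_U sd_smooth)

text \<open>By cyclic symmetry each of the three components contributes twice the same triple
  product; differentiating a squared norm doubles the resulting 6 to 12.\<close>

lemma laplace_sd_norm:
  assumes x: "x \<in> U"
  shows "(\<Sum>i\<in>UNIV. fd (\<lambda>y. fd (sd_norm a) y (e4 i)) x (e4 i))
    = 2 * (\<Sum>i\<in>UNIV. (norm (D i (sd1 a) x))\<^sup>2 + (norm (D i (sd2 a) x))\<^sup>2 + (norm (D i (sd3 a) x))\<^sup>2)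
      + 12 * (sd1 a x \<bullet> comm (sd2 a x) (sd3 a x))"
proof -
  let ?s = "sd1 a" and ?t = "sd2 a" and ?u = "sd3 a"
  note sm = smooth_cov_deriv[OF sd_smooth(1)] smooth_cov_deriv[OF sd_smooth(2)]
    smooth_cov_deriv[OF sd_smooth(3)]
  have su: "y \<in> U \<Longrightarrow> D i ?s y \<in> su2" "y \<in> U \<Longrightarrow> D i ?t y \<in> su2"
    "y \<in> U \<Longrightarrow> D i ?u y \<in> su2" for y i
    using cov_deriv_su2[OF smooth_on_differentiable] sd_smooth sd_su2 by blast+
  have 1: "fd (\<lambda>y. s y \<bullet> D i s y) x (e4 i) = (norm (D i s x))\<^sup>2 + s x \<bullet> D i (D i s) x"
    if "smooth_on U s" "\<And>y. y \<in> U \<Longrightarrow> s y \<in> su2" for i s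
    using fd_inner[OF x that(1) smooth_cov_deriv[OF that(1)] that(2)
        cov_deriv_su2[OF smooth_on_differentiable[OF that(1)] _ that(2)]]
    by (simp add: power2_norm_eq_inner)
  have 2: "fd (\<lambda>y. fd (sd_norm a) y (e4 i)) x (e4 i) = 2 *
      ((norm (D i ?s x))\<^sup>2 + (norm (D i ?t x))\<^sup>2 + (norm (D i ?u x))\<^sup>2
      + (sd1 a x \<bullet> D i (D i ?s) x + sd2 a x \<bullet> D i (D i ?t) x + sd3 a x \<bullet> D i (D i ?u) x))" for i
  proof -
    let ?f = "\<lambda>y. sd1 a y \<bullet> D i ?s y + sd2 a y \<bullet> D i ?t y + sd3 a y \<bullet> D i ?u y"
    have d: "(\<lambda>y. sd1 a y \<bullet> D i ?s y) differentiable at x" "(\<lambda>y. sd2 a y \<bullet> D i ?t y) differentiable at x"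
        "(\<lambda>y. sd3 a y \<bullet> D i ?u y) differentiable at x"
      by (intro smooth_on_differentiable[OF smooth_on_inner[OF open_U] x] sd_smooth sm)+
    have df: "?f differentiable at x"
      using differentiable_add[OF differentiable_add[OF d(1,2)] d(3)] .
    have "fd (\<lambda>y. fd (sd_norm a) y (e4 i)) x (e4 i) = fd (\<lambda>y. 2 * ?f y) x (e4 i)"
      by (rule fun_cong[OF fd_cong[OF open_U x]]) (rule fd_sd_norm)
    also have "fd (\<lambda>y. 2 * ?f y) x (e4 i) = 2 * fd ?f x (e4 i)"
      by (rule fd_bounded_linear[OF bounded_linear_mult_right[of 2], of ?f x, OF df])
    also have "fd ?f x (e4 i) = fd (\<lambda>y. sd1 a y \<bullet> D i ?s y) x (e4 i)
        + fd (\<lambda>y. sd2 a y \<bullet> D i ?t y) x (e4 i) + fd (\<lambda>y. sd3 a y \<bullet> D i ?u y) x (e4 i)"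
      by (simp only: fd_add differentiable_add d)
    finally show ?thesis
      using 1[where s = ?s, OF sd_smooth(1) sd_su2(1)] 1[where s = ?t, OF sd_smooth(2) sd_su2(2)]
        1[where s = ?u, OF sd_smooth(3) sd_su2(3)] by simp
  qed
  have "(\<Sum>i\<in>UNIV. sd1 a x \<bullet> D i (D i ?s) x + sd2 a x \<bullet> D i (D i ?t) x + sd3 a x \<bullet> D i (D i ?u) x)
      = 6 * (sd1 a x \<bullet> comm (sd2 a x) (sd3 a x))"
    using comm_cyclic[OF sd_su2(1)[OF x] sd_su2(2)[OF x] sd_su2(3)[OF x]] comm_cyclic[OF sd_su2(2)[OF x] sd_su2(3)[OF x] sd_su2(1)[OF x]]
    by (simp only: sum.distrib inner_sum_right[symmetric] weitzenboeck[OF x] inner_scaleR_right)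
  then show ?thesis unfolding 2 by (simp add: sum.distrib sum_distrib_left[symmetric])
qed

end

text \<open>The norm of a two-form scales by the inverse square of the conformal factor. So
  \<open>wt\<close>^4 times the Euclidean squared norm is, up to a constant, the squared norm in the
  round metric, which is the function the Liouville argument needs.\<close>

lemma slap_weighted:
  assumes "open U" "x \<in> U" "smooth_on U N"
  defines "w \<equiv> wt x"
  shows "slap (\<lambda>y. wt y^4 * N y) x
    = w^4 * (\<Sum>i\<in>UNIV. fd (\<lambda>y. fd N y (e4 i)) x (e4 i)) + 12 * w^3 * fd N x x
      + w\<^sup>2 * (16 * (norm x)\<^sup>2 + 32 * w) * N x"
proof -
  define W where "W y = 1 + y \<bullet> y" for y :: "real^4"
  have dW: "(W has_derivative (\<lambda>v. 2 * (y \<bullet> v))) (at y)" for y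
    unfolding W_def by (auto intro!: derivative_eq_intros simp: inner_commute)
  have dN: "(N has_derivative fd N y) (at y)" if "y \<in> U" for y
    using differentiable_fd smooth_on_differentiable[OF assms(3) that] .
  have d: "((\<lambda>y. W y^4 * N y) has_derivative (\<lambda>v. 8 * W y^3 * (y \<bullet> v) * N y + W y^4 * fd N y v)) (at y)"
    if "y \<in> U" for y
    by (rule has_derivative_eq_rhs[OF has_derivative_mult[OF has_derivative_power[OF dW] dN[OF that]]])
      (auto simp: algebra_simps)
  have 1: "fd (\<lambda>y. W y^4 * N y) y = (\<lambda>v. 8 * W y^3 * (y \<bullet> v) * N y + W y^4 * fd N y v)" if "y \<in> U" for y
    by (rule fd_eq[OF d[OF that]])
  have 2: "fd (\<lambda>y. fd (\<lambda>y. W y^4 * N y) y (e4 i)) x (e4 i) =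
      48 * W x^2 * (x \<bullet> e4 i)\<^sup>2 * N x + 8 * W x^3 * N x + 16 * W x^3 * ((x \<bullet> e4 i) * fd N x (e4 i))
      + W x^4 * fd (\<lambda>y. fd N y (e4 i)) x (e4 i)" for i
  proof -
    let ?e = "e4 i"
    have dN': "((\<lambda>y. fd N y ?e) has_derivative fd (\<lambda>y. fd N y ?e) x) (at x)"
      using differentiable_fd smooth_on_differentiable[OF smooth_on_fd[OF assms(3)] assms(2)] .
    have di: "((\<lambda>y. y \<bullet> ?e) has_derivative (\<lambda>v. v \<bullet> ?e)) (at x)"
      by (auto intro!: derivative_eq_intros)
    have "((\<lambda>y. 8 * (W y^3 * ((y \<bullet> ?e) * N y)) + W y^4 * fd N y ?e) has_derivative
      (\<lambda>v. 8 * (W x^3 * ((x \<bullet> ?e) * fd N x v + (v \<bullet> ?e) * N x) + of_nat 3 * (2 * (x \<bullet> v)) * W x^(3-1) * ((x \<bullet> ?e) * N x))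
        + (W x^4 * fd (\<lambda>y. fd N y ?e) x v + of_nat 4 * (2 * (x \<bullet> v)) * W x^(4-1) * fd N x ?e))) (at x)"
      by (intro has_derivative_add has_derivative_mult_right has_derivative_mult has_derivative_power
          dW di dN dN' assms(2))
    from fd_eq[OF this]
    have "fd (\<lambda>y. 8 * (W y^3 * ((y \<bullet> ?e) * N y)) + W y^4 * fd N y ?e) x ?e =
      48 * W x^2 * (x \<bullet> ?e)\<^sup>2 * N x + 8 * W x^3 * N x + 16 * W x^3 * ((x \<bullet> ?e) * fd N x ?e)
      + W x^4 * fd (\<lambda>y. fd N y ?e) x ?e"
      by (simp add: inner_axis_axis power2_eq_square algebra_simps)
    moreover have "fd (\<lambda>y. fd (\<lambda>y. W y^4 * N y) y ?e) x = fd (\<lambda>y. 8 * (W y^3 * ((y \<bullet> ?e) * N y)) + W y^4 * fd N y ?e) x"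
      by (rule fd_cong[OF assms(1,2)]) (simp add: 1 mult.assoc)
    ultimately show ?thesis by simp
  qed
  have Ww: "W x = w" "(\<lambda>y. wt y^4 * N y) = (\<lambda>y. W y^4 * N y)"
    by (simp_all add: W_def w_def power2_norm_eq_inner)
  have lin: "(\<Sum>i\<in>UNIV. (x \<bullet> e4 i) * fd N x (e4 i)) = fd N x x"
    using fd_sum_axis[OF smooth_on_differentiable[OF assms(3,2)], of x] by (simp add: inner_axis)
  have wp: "w > 0" by (simp add: w_def add_pos_nonneg)
  have "slap (\<lambda>y. W y^4 * N y) x = 48 * w^2 * (norm x)\<^sup>2 * N x + 32 * w^3 * N x + 16 * w^3 * fd N x x
     + w^4 * (\<Sum>i\<in>UNIV. fd (\<lambda>y. fd N y (e4 i)) x (e4 i))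
     - 4 / w * (8 * w^3 * (norm x)\<^sup>2 * N x + w^4 * fd N x x)"
    unfolding slap_def 2 unfolding 1[OF assms(2)] Ww(1) w_def[symmetric]
    by (simp add: sum.distrib sum_distrib_left[symmetric] sum_distrib_right[symmetric] sum_axis_inner_sq lin
        power2_norm_eq_inner)
  also have "4 / w * (8 * w^3 * (norm x)\<^sup>2 * N x + w^4 * fd N x x)
      = 32 * w^2 * (norm x)\<^sup>2 * N x + 4 * w^3 * fd N x x"
    using wp by (simp add: field_simps power2_eq_square power3_eq_cube power4_eq_xxxx)
  finally show ?thesis unfolding Ww(2) by (simp add: algebra_simps power2_eq_square power3_eq_cube)
qed

text \<open>\<open>bpst_coeff x i\<close> are the coefficients of the BPST form, up to the factor \<open>1 / (1 + |x|\<^sup>2)\<close>; with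
  twice these coefficients as connection matrix, the bundle of self-dual forms carries the
  Levi-Civita connection of the sphere.\<close>

definition bpst_coeff :: "real^4 \<Rightarrow> 4 \<Rightarrow> real^4" where
  "bpst_coeff x i = qmult x (qcnj (e4 i))"

lemma bpst_coeff_nth:
  "bpst_coeff x 1 $ 2 = x$2" "bpst_coeff x 1 $ 3 = x$3" "bpst_coeff x 1 $ 4 = x$4"
  "bpst_coeff x 2 $ 2 = - x$1" "bpst_coeff x 2 $ 3 = - x$4" "bpst_coeff x 2 $ 4 = x$3"
  "bpst_coeff x 3 $ 2 = x$4" "bpst_coeff x 3 $ 3 = - x$1" "bpst_coeff x 3 $ 4 = - x$2"
  "bpst_coeff x 4 $ 2 = - x$3" "bpst_coeff x 4 $ 3 = x$2" "bpst_coeff x 4 $ 4 = - x$1"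
  by (simp_all add: bpst_coeff_def qmult_nth qcnj_nth axis_def)

text \<open>Up to weights, the squares are the components of the covariant derivative of F^+ for the
  round metric. The columns 2, 3, 4 of \<open>bpst_coeff x\<close> are orthogonal to each other and
  to x and have length |x|, hence 24 = 16 + 8. Of the mixed terms, 8 w comes from the radial part,
  and the four first-order equations turn the rotational part into a further 4 w.\<close>

lemma twistor_square:
  fixes P1 P2 P3 :: "4 \<Rightarrow> 'v::real_inner" and f1 f2 f3 :: 'v and x :: "real^4" and w :: real
  assumes "P1 2 + P2 3 + P3 4 = 0" "P1 1 - P3 3 + P2 4 = 0" "P2 1 + P3 2 - P1 4 = 0" "P3 1 - P2 2 + P1 3 = 0"
  defines "g \<equiv> bpst_coeff x"
  shows "(\<Sum>i\<in>UNIV. (norm (w *\<^sub>R P1 i + (4 * x$i) *\<^sub>R f1 + (2 * g i $ 3) *\<^sub>R f3 - (2 * g i $ 4) *\<^sub>R f2))\<^sup>2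
      + (norm (w *\<^sub>R P2 i + (4 * x$i) *\<^sub>R f2 + (2 * g i $ 4) *\<^sub>R f1 - (2 * g i $ 2) *\<^sub>R f3))\<^sup>2
      + (norm (w *\<^sub>R P3 i + (4 * x$i) *\<^sub>R f3 + (2 * g i $ 2) *\<^sub>R f2 - (2 * g i $ 3) *\<^sub>R f1))\<^sup>2)
    = w\<^sup>2 * (\<Sum>i\<in>UNIV. (norm (P1 i))\<^sup>2 + (norm (P2 i))\<^sup>2 + (norm (P3 i))\<^sup>2)
      + 12 * w * (\<Sum>i\<in>UNIV. x$i * (f1 \<bullet> P1 i + f2 \<bullet> P2 i + f3 \<bullet> P3 i))
      + 24 * (norm x)\<^sup>2 * (f1 \<bullet> f1 + f2 \<bullet> f2 + f3 \<bullet> f3)"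
proof -
  have P: "P1 1 = P3 3 - P2 4" "P2 1 = P1 4 - P3 2" "P3 1 = P2 2 - P1 3" "P1 2 = - P2 3 - P3 4"
    using assms(1-4) by (simp_all add: algebra_simps eq_neg_iff_add_eq_0)
  have sq: "(norm (w *\<^sub>R p + s *\<^sub>R u + t *\<^sub>R v - r *\<^sub>R z))\<^sup>2 = w\<^sup>2 * (norm p)\<^sup>2 + s * s * (u \<bullet> u)
      + t * t * (v \<bullet> v) + r * r * (z \<bullet> z) + 2 * w * (s * (u \<bullet> p) + t * (v \<bullet> p) - r * (z \<bullet> p))
      + 2 * (s * t * (u \<bullet> v) - s * r * (u \<bullet> z) - t * r * (v \<bullet> z))" for p u v z :: 'v and s t r
    unfolding power2_norm_eq_inner
    by (simp add: inner_add inner_diff inner_commute algebra_simps power2_eq_square)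
  show ?thesis
    unfolding sq sum_4 g_def bpst_coeff_nth
    unfolding P
    by (simp add: power2_norm_eq_inner inner_real4 inner_diff_right inner_commute[of f2 f1]
        inner_commute[of f3 f1] inner_commute[of f3 f2] algebra_simps)
qed

section \<open>The equality case\<close>

context yang_mills_field
begin

abbreviation twistor1 :: "4 \<Rightarrow> real^4 \<Rightarrow> cmat2" where
  "twistor1 i x \<equiv> wt x *\<^sub>R D i (sd1 a) x + (4 * x$i) *\<^sub>R sd1 a x
    + (2 * bpst_coeff x i $ 3) *\<^sub>R sd3 a x - (2 * bpst_coeff x i $ 4) *\<^sub>R sd2 a x"
abbreviation twistor2 :: "4 \<Rightarrow> real^4 \<Rightarrow> cmat2" where
  "twistor2 i x \<equiv> wt x *\<^sub>R D i (sd2 a) x + (4 * x$i) *\<^sub>R sd2 a x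
    + (2 * bpst_coeff x i $ 4) *\<^sub>R sd1 a x - (2 * bpst_coeff x i $ 2) *\<^sub>R sd3 a x"
abbreviation twistor3 :: "4 \<Rightarrow> real^4 \<Rightarrow> cmat2" where
  "twistor3 i x \<equiv> wt x *\<^sub>R D i (sd3 a) x + (4 * x$i) *\<^sub>R sd3 a x
    + (2 * bpst_coeff x i $ 2) *\<^sub>R sd2 a x - (2 * bpst_coeff x i $ 3) *\<^sub>R sd1 a x"

abbreviation twistor_sq :: "real^4 \<Rightarrow> real" where
  "twistor_sq x \<equiv> \<Sum>i\<in>UNIV. (norm (twistor1 i x))\<^sup>2 + (norm (twistor2 i x))\<^sup>2 + (norm (twistor3 i x))\<^sup>2"

text \<open>The radial terms of \<open>slap_weighted\<close> are those needed to complete the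
  squares of \<open>twistor_square\<close>. Because w - |x|^2 = 1, what remains of the zeroth order
  is 32 w^2 times the norm, the contribution of the curvature of the sphere. It absorbs the cubic
  term by \<open>cubic_inequality\<close>, used twice over.\<close>

lemma bochner:
  assumes x: "x \<in> U"
  defines "w \<equiv> wt x"
  defines "X \<equiv> w\<^sup>2 *\<^sub>R sd1 a x" and "Y \<equiv> w\<^sup>2 *\<^sub>R sd2 a x" and "Z \<equiv> w\<^sup>2 *\<^sub>R sd3 a x"
  assumes bound: "w^4 * sd_norm a x \<le> 96"
  shows "w\<^sup>2 * slap (\<lambda>y. wt y^4 * sd_norm a y) x \<ge> 2 * w^4 * twistor_sq x
      + 16 * ((norm (X + (1/8) *\<^sub>R comm Y Z))\<^sup>2 + (norm (Y + (1/8) *\<^sub>R comm Z X))\<^sup>2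
          + (norm (Z + (1/8) *\<^sub>R comm X Y))\<^sup>2)"
proof -
  let ?N = "sd_norm a x" and ?t = "sd1 a x \<bullet> comm (sd2 a x) (sd3 a x)"
  let ?P = "\<Sum>i\<in>UNIV. (norm (D i (sd1 a) x))\<^sup>2 + (norm (D i (sd2 a) x))\<^sup>2 + (norm (D i (sd3 a) x))\<^sup>2"
  let ?Q = "\<Sum>i\<in>UNIV. x$i * (sd1 a x \<bullet> D i (sd1 a) x + sd2 a x \<bullet> D i (sd2 a) x + sd3 a x \<bullet> D i (sd3 a) x)"
  let ?T = "twistor_sq x"
  have T: "?T = w\<^sup>2 * ?P + 12 * w * ?Q + 24 * (norm x)\<^sup>2 * ?N"
    unfolding w_def sd_norm_def
    by (rule twistor_square) (use sd_first_order[OF x] in simp_all)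
  have Q: "fd (sd_norm a) x x = 2 * ?Q"
  proof -
    have "fd (sd_norm a) x x = (\<Sum>i\<in>UNIV. x$i *\<^sub>R fd (sd_norm a) x (e4 i))"
      by (rule fd_sum_axis[OF smooth_on_differentiable[OF smooth_sd_norm x]])
    then show ?thesis unfolding fd_sd_norm[OF x] by (simp add: sum_distrib_left algebra_simps)
  qed
  have sl: "slap (\<lambda>y. wt y^4 * sd_norm a y) x =
      w^4 * (2 * ?P + 12 * ?t) + 24 * w^3 * ?Q + w\<^sup>2 * (16 * (norm x)\<^sup>2 + 32 * w) * ?N"
    unfolding slap_weighted[OF open_U x smooth_sd_norm] laplace_sd_norm[OF x] Q w_def by simp
  have "slap (\<lambda>y. wt y^4 * sd_norm a y) x = 2 * w\<^sup>2 * ?T + 12 * w^4 * ?t + 32 * w\<^sup>2 * ?N"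
    unfolding sl T by (simp add: w_def algebra_simps power2_eq_square power3_eq_cube power4_eq_xxxx)
  then have "w\<^sup>2 * slap (\<lambda>y. wt y^4 * sd_norm a y) x
      = 2 * w^4 * ?T + 2 * (16 * (w^4 * ?N) + 6 * (w^6 * ?t))"
    by (simp add: algebra_simps flip: power_add)
  moreover have "w^4 * ?N = (norm X)\<^sup>2 + (norm Y)\<^sup>2 + (norm Z)\<^sup>2"
    by (simp add: X_def Y_def Z_def sd_norm_def power2_norm_eq_inner algebra_simps flip: power_add)
  moreover have "w^6 * ?t = X \<bullet> comm Y Z"
    by (simp add: X_def Y_def Z_def cm.scaleR_left cm.scaleR_right flip: power_add)
  moreover have "X \<in> su2" "Y \<in> su2" "Z \<in> su2"
    using sd_su2[OF x] subspace_scale[OF subspace_su2] by (simp_all add: X_def Y_def Z_def)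
  then have "8 * ((norm (X + (1/8) *\<^sub>R comm Y Z))\<^sup>2 + (norm (Y + (1/8) *\<^sub>R comm Z X))\<^sup>2
      + (norm (Z + (1/8) *\<^sub>R comm X Y))\<^sup>2) \<le> 16 * (w^4 * ?N) + 6 * (X \<bullet> comm Y Z)"
    using cubic_inequality bound calculation(2) by metis
  ultimately show ?thesis by simp
qed

end

section \<open>Unit quaternions, quaternion triples and their lifts\<close>

lemma SU2_quat: "M \<in> SU2 \<longleftrightarrow> (\<exists>x. norm x = 1 \<and> M = quat_mat x)"
proof
  assume "M \<in> SU2"
  then have M: "M ** mat_adj M = mat 1" "det M = 1" by (simp_all add: SU2_def)
  \<comment> \<open>The adjugate. For determinant 1 it is the inverse, so it coincides with the
    adjoint.\<close>
  define R :: cmat2 where "R = vector [vector [M$2$2, - M$1$2], vector [- M$2$1, M$1$1]]"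
  have "R ** M = mat 1"
    using M(2) by (simp add: cmat_eq_iff cmat_mult_nth R_def mat_def det_2 algebra_simps)
  then have "mat_adj M = R"
    using M(1) matrix_mul_assoc[of R M "mat_adj M"] by simp
  then have e: "cnj (M$1$1) = M$2$2" "cnj (M$2$1) = - M$1$2"
    by (simp_all add: cmat_eq_iff mat_adj_def R_def)
  define x :: "real^4" where "x = vector [Re (M$1$1), Im (M$1$1), Re (M$1$2), Im (M$1$2)]"
  have "M = quat_mat x"
    using e by (auto simp: cmat_eq_iff quat_mat_nth complex_eq_iff x_def)
  moreover from this have "norm x = 1"
    using M(2) quat_mat_det[of x] norm_ge_zero[of x]
    by (simp only: of_real_eq_1_iff power2_eq_1_iff) linarith
  ultimately show "\<exists>x. norm x = 1 \<and> M = quat_mat x" by blast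
next
  assume "\<exists>x. norm x = 1 \<and> M = quat_mat x"
  then obtain x where x: "norm x = 1" and M: "M = quat_mat x" by blast
  have "qmult x (qcnj x) = axis 1 1"
    using x by (simp add: real4_eq_iff qmult_nth qcnj_nth axis_def norm_eq_1 inner_real4)
  then show "M \<in> SU2"
    unfolding M SU2_def using x by (simp add: quat_mat_det quat_mat_adj quat_mat_mult quat_mat_one)
qed

lemma matrix_inv_eq:
  fixes A :: "'a::semiring_1^'n^'n"
  assumes "A ** B = mat 1" "B ** A = mat 1" shows "matrix_inv A = B"
proof -
  have "A ** matrix_inv A = mat 1"
    unfolding matrix_inv_def
    using someI[of "\<lambda>C. A ** C = mat 1 \<and> C ** A = mat 1" B, OF conjI[OF assms]] by (rule conjunct1)
  then show ?thesis
    using assms(2) matrix_mul_assoc[of B A "matrix_inv A"] by simp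
qed

lemma SU2_adj:
  assumes "M \<in> SU2" shows "M ** mat_adj M = mat 1" "mat_adj M ** M = mat 1" "matrix_inv M = mat_adj M"
proof -
  show 1: "M ** mat_adj M = mat 1" using assms by (simp add: SU2_def)
  then show 2: "mat_adj M ** M = mat 1" by (rule matrix_left_right_inverse[THEN iffD1])
  show "matrix_inv M = mat_adj M" using 1 2 by (rule matrix_inv_eq)
qed

lemma norm_qmult: "norm (qmult x y) = norm x * norm y"
proof -
  have "(norm (qmult x y))\<^sup>2 = (norm x * norm y)\<^sup>2"
    unfolding power_mult_distrib power2_norm_eq_inner inner_real4 qmult_nth by algebra
  then show ?thesis by simp
qed

lemma SU2_mult: "M \<in> SU2 \<Longrightarrow> N \<in> SU2 \<Longrightarrow> M ** N \<in> SU2"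
  unfolding SU2_quat by (metis quat_mat_mult norm_qmult mult_1)

lemma norm_quat_mat: "norm (quat_mat x) = sqrt 2 * norm x"
  by (simp add: norm_eq_sqrt_inner quat_mat_inner real_sqrt_mult)

lemma norm_conj_SU2:
  assumes "M \<in> SU2" "X \<in> su2" "Y \<in> su2" "M ** X = Y ** M"
  shows "norm X = norm Y"
proof -
  obtain m x y where m: "norm m = 1" "M = quat_mat m" and x: "X = quat_mat x" and y: "Y = quat_mat y"
    using assms(1-3) unfolding SU2_quat su2_quat by blast
  have "qmult m x = qmult y m" using assms(4) by (simp add: m x y quat_mat_mult quat_mat_eq_iff)
  then have "norm (qmult m x) = norm (qmult y m)" by simp
  then show ?thesis using m by (simp add: norm_qmult x y norm_quat_mat)
qed

definition E1 :: cmat2 where "E1 = quat_mat (axis 2 1)"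
definition E2 :: cmat2 where "E2 = quat_mat (axis 3 1)"
definition E3 :: cmat2 where "E3 = quat_mat (axis 4 1)"

text \<open>The whole multiplication table of the quaternion units is recorded, so that a product
  can be rewritten in either order.\<close>

definition quat_triple :: "cmat2 \<Rightarrow> cmat2 \<Rightarrow> cmat2 \<Rightarrow> bool" where
  "quat_triple X Y Z \<longleftrightarrow> X \<in> su2 \<and> Y \<in> su2 \<and> Z \<in> su2 \<and>
     X ** X = - mat 1 \<and> Y ** Y = - mat 1 \<and> Z ** Z = - mat 1 \<and>
     X ** Y = Z \<and> Y ** X = - Z \<and> Y ** Z = X \<and> Z ** Y = - X \<and> Z ** X = Y \<and> X ** Z = - Y"

lemma quat_triple_E: "quat_triple E1 E2 E3"
  by (simp add: quat_triple_def E1_def E2_def E3_def quat_mat_su2 quat_mat_mult quat_mat_lin[symmetric]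
      quat_mat_one[symmetric] quat_mat_eq_iff real4_eq_iff qmult_nth axis_def)

text \<open>For the vectors of imaginary parts the relations read x = y \<times> z and its cyclic
  permutations. They force orthogonality and a common squared length d, and the Lagrange identity
  gives d^2 = d. A nonzero solution is therefore an oriented orthonormal basis.\<close>

lemma quat_tripleI:
  assumes "X \<in> su2" "Y \<in> su2" "Z \<in> su2"
    and rel: "2 *\<^sub>R X = comm Y Z" "2 *\<^sub>R Y = comm Z X" "2 *\<^sub>R Z = comm X Y"
    and nz: "X \<noteq> 0 \<or> Y \<noteq> 0 \<or> Z \<noteq> 0"
  shows "quat_triple X Y Z"
proof -
  obtain x y z where q: "x$1 = 0" "X = quat_mat x" "y$1 = 0" "Y = quat_mat y" "z$1 = 0" "Z = quat_mat z"
    using assms(1-3) su2E by metis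
  have r: "x$2 = y$3 * z$4 - y$4 * z$3" "x$3 = y$4 * z$2 - y$2 * z$4" "x$4 = y$2 * z$3 - y$3 * z$2"
    "y$2 = z$3 * x$4 - z$4 * x$3" "y$3 = z$4 * x$2 - z$2 * x$4" "y$4 = z$2 * x$3 - z$3 * x$2"
    "z$2 = x$3 * y$4 - x$4 * y$3" "z$3 = x$4 * y$2 - x$2 * y$4" "z$4 = x$2 * y$3 - x$3 * y$2"
    using rel unfolding q comm_quat
    by (simp_all add: quat_mat_lin[symmetric] quat_mat_eq_iff real4_eq_iff qmult_nth q mult.commute)
  have perp: "x$2 * y$2 + x$3 * y$3 + x$4 * y$4 = 0" "y$2 * z$2 + y$3 * z$3 + y$4 * z$4 = 0"
    "z$2 * x$2 + z$3 * x$3 + z$4 * x$4 = 0"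
    using r by algebra+
  define d where "d = x$2 * x$2 + x$3 * x$3 + x$4 * x$4"
  have dy: "y$2 * y$2 + y$3 * y$3 + y$4 * y$4 = d" and dz: "z$2 * z$2 + z$3 * z$3 + z$4 * z$4 = d"
    unfolding d_def using r by algebra+
  have "d * d = (y$2 * y$2 + y$3 * y$3 + y$4 * y$4) * (z$2 * z$2 + z$3 * z$3 + z$4 * z$4)
      - (y$2 * z$2 + y$3 * z$3 + y$4 * z$4) * (y$2 * z$2 + y$3 * z$3 + y$4 * z$4)"
    unfolding dy dz perp by simp
  also have "\<dots> = d" unfolding d_def r(1,2,3) by (simp add: algebra_simps)
  finally have "d = 0 \<or> d = 1" by simp
  moreover have "d \<noteq> 0"
  proof
    assume "d = 0"
    then have "x \<bullet> x = 0" "y \<bullet> y = 0" "z \<bullet> z = 0"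
      using dy dz q by (simp_all add: inner_real4 d_def)
    then show False using nz q by (simp add: linear_0[OF linear_quat_mat])
  qed
  ultimately have d1: "d = 1" by simp
  note n = d_def[unfolded d1] dy[unfolded d1] dz[unfolded d1]
  have ax: "axis 1 1 $ 1 = (1::real)" "axis (1::4) 1 $ 2 = (0::real)" "axis (1::4) 1 $ 3 = (0::real)"
    "axis (1::4) 1 $ 4 = (0::real)"
    by (simp_all add: axis_def)
  show ?thesis
    unfolding quat_triple_def q(2,4,6) quat_mat_su2 quat_mat_mult quat_mat_one[symmetric]
      quat_mat_lin(4)[symmetric] quat_mat_eq_iff real4_eq_iff qmult_nth vector_uminus_component q(1,3,5) ax
    by (intro conjI; (simp; fail | use n in \<open>simp; linarith\<close> | use perp in algebra | use r in algebra))
qed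

lemmas E_rel = quat_triple_E[unfolded quat_triple_def]

lemma E_rel_right:
  fixes A :: cmat2
  shows "A ** E1 ** E1 = - A" "A ** E2 ** E2 = - A" "A ** E3 ** E3 = - A"
  "A ** E1 ** E2 = A ** E3" "A ** E2 ** E1 = - (A ** E3)" "A ** E2 ** E3 = A ** E1"
  "A ** E3 ** E2 = - (A ** E1)" "A ** E3 ** E1 = A ** E2" "A ** E1 ** E3 = - (A ** E2)"
  by (simp_all add: matrix_mul_assoc[symmetric] E_rel mm.minus_right)

text \<open>Averaging over the quaternion group turns any matrix \<open>k\<close> into an intertwiner of the triples
  \<open>(E1, E2, E3)\<close> and \<open>(X, Y, Z)\<close>.\<close>

definition intertwiner :: "cmat2 \<Rightarrow> cmat2 \<Rightarrow> cmat2 \<Rightarrow> cmat2 \<Rightarrow> cmat2" where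
  "intertwiner X Y Z k = k - (X ** k ** E1 + Y ** k ** E2 + Z ** k ** E3)"

lemma intertwiner_rel:
  assumes "quat_triple X Y Z"
  shows "X ** intertwiner X Y Z k = intertwiner X Y Z k ** E1"
    "Y ** intertwiner X Y Z k = intertwiner X Y Z k ** E2"
    "Z ** intertwiner X Y Z k = intertwiner X Y Z k ** E3"
  using assms unfolding quat_triple_def intertwiner_def
  by (simp_all add: cmat_ring E_rel_right)

text \<open>The averages of 1, \<open>E1\<close>, \<open>E2\<close>, \<open>E3\<close> recombine to
  four times the identity, whatever X, Y and Z are.\<close>

lemma intertwiner_nonzero: "\<exists>k\<in>{mat 1, E1, E2, E3}. intertwiner X Y Z k \<noteq> 0"
proof (rule ccontr)
  assume "\<not> ?thesis"
  then have z: "intertwiner X Y Z (mat 1) = 0" "intertwiner X Y Z E1 = 0" "intertwiner X Y Z E2 = 0"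
    "intertwiner X Y Z E3 = 0" by auto
  have "intertwiner X Y Z (mat 1) - intertwiner X Y Z E1 ** E1 - intertwiner X Y Z E2 ** E2
      - intertwiner X Y Z E3 ** E3 = mat 1 + mat 1 + mat 1 + mat 1"
    unfolding intertwiner_def by (simp add: cmat_ring E_rel_right E_rel)
  then have "mat 1 + mat 1 + mat 1 + mat 1 = (0::cmat2)" unfolding z by simp
  then show False by (simp add: cmat_eq_iff mat_def)
qed

text \<open>Linear on all matrices: followed by \<open>quat_mat\<close> it is a linear map fixing
  the quaternionic matrices, which shows that derivatives of quaternionic maps are
  quaternionic.\<close>

definition unquat :: "cmat2 \<Rightarrow> real^4" where
  "unquat M = vector [Re (M$1$1), Im (M$1$1), Re (M$1$2), Im (M$1$2)]"

lemma unquat_quat_mat [simp]: "unquat (quat_mat x) = x"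
  by (simp add: unquat_def real4_eq_iff quat_mat_nth)

lemma bounded_linear_quat_unquat: "bounded_linear (\<lambda>M. quat_mat (unquat M))"
proof -
  have "linear unquat" by (rule linearI) (simp_all add: unquat_def real4_eq_iff)
  then have "linear (\<lambda>M. quat_mat (unquat M))"
    using linear_compose[OF _ linear_quat_mat, of unquat] by (simp add: o_def)
  then show ?thesis by (simp add: linear_conv_bounded_linear)
qed

lemma SU2_normalize:
  assumes "quat_mat x \<noteq> 0"
  shows "inverse (sqrt (quat_mat x \<bullet> quat_mat x / 2)) *\<^sub>R quat_mat x \<in> SU2"
proof -
  have "x \<noteq> 0" using assms linear_0[OF linear_quat_mat] by auto
  moreover have "sqrt (quat_mat x \<bullet> quat_mat x / 2) = norm x"
    by (simp add: quat_mat_inner norm_eq_sqrt_inner)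
  ultimately show ?thesis
    unfolding SU2_quat by (intro exI[of _ "inverse (norm x) *\<^sub>R x"]) (simp add: quat_mat_lin)
qed

lemma intertwiner_quat:
  assumes "quat_triple X Y Z" "k \<in> {mat 1, E1, E2, E3}"
  obtains x where "intertwiner X Y Z k = quat_mat x"
proof -
  obtain x y z where "X = quat_mat x" "Y = quat_mat y" "Z = quat_mat z"
    using assms(1) unfolding quat_triple_def su2_quat by blast
  moreover obtain c where "k = quat_mat c"
    using assms(2) unfolding E1_def E2_def E3_def quat_mat_one[symmetric] by blast
  ultimately show thesis
    using that by (simp add: intertwiner_def E1_def E2_def E3_def quat_mat_mult flip: quat_mat_lin)
qed

lemmas smooth_on_cmat_mult = smooth_on_bilinear[OF _ bounded_bilinear_cmat_mult]

text \<open>A local lift through the double cover of the rotation group by \<open>SU2\<close>. A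
  matrix whose average is nonzero at p keeps this property near p, and there the normalized average
  is the lift.\<close>

lemma local_lift:
  fixes X Y Z :: "real^4 \<Rightarrow> cmat2"
  assumes "open S" "p \<in> S" "smooth_on S X" "smooth_on S Y" "smooth_on S Z"
    and q: "\<And>x. x \<in> S \<Longrightarrow> quat_triple (X x) (Y x) (Z x)"
  obtains T h where "open T" "p \<in> T" "T \<subseteq> S" "smooth_on T h" "\<And>x. x \<in> T \<Longrightarrow> h x \<in> SU2"
    "\<And>x. x \<in> T \<Longrightarrow> X x ** h x = h x ** E1" "\<And>x. x \<in> T \<Longrightarrow> Y x ** h x = h x ** E2"
    "\<And>x. x \<in> T \<Longrightarrow> Z x ** h x = h x ** E3"
proof -
  obtain k where k: "k \<in> {mat 1, E1, E2, E3}" "intertwiner (X p) (Y p) (Z p) k \<noteq> 0"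
    using intertwiner_nonzero by blast
  define Q where "Q x = intertwiner (X x) (Y x) (Z x) k" for x
  have sQ: "smooth_on S Q"
    unfolding Q_def intertwiner_def
    by (intro smooth_on_diff smooth_on_add smooth_on_cmat_mult smooth_on_const assms(1,3-5))
  define T where "T = {x \<in> S. Q x \<noteq> 0}"
  have "T = S \<inter> Q -` (- {0})" by (auto simp: T_def)
  then have T: "open T" "T \<subseteq> S" "p \<in> T"
    using continuous_open_preimage[OF smooth_on_continuous[OF sQ] assms(1), of "- {0}"] k(2) assms(2)
    by (auto simp: Q_def T_def)
  \<comment> \<open>The division by 2 compensates for the doubling of squared norms under
    \<open>quat_mat\<close>.\<close>
  define h where "h x = inverse (sqrt (Q x \<bullet> Q x / 2)) *\<^sub>R Q x" for x
  have sQT: "smooth_on T Q" using smooth_on_subset[OF sQ T(2)] .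
  have "smooth_on T (\<lambda>x. inverse (sqrt (Q x \<bullet> Q x * (1/2))))"
    by (intro smooth_on_inverse_sqrt smooth_on_mult smooth_on_inner smooth_on_const T(1) sQT)
      (simp add: T_def)
  then have sh: "smooth_on T h"
    unfolding h_def by (intro smooth_on_scaleR T(1) sQT) simp
  have SU: "h x \<in> SU2" if "x \<in> T" for x
  proof -
    have "x \<in> S" using that T(2) by blast
    from intertwiner_quat[OF q[OF this] k(1)] obtain y where "Q x = quat_mat y"
      unfolding Q_def .
    then show ?thesis using that SU2_normalize[of y] by (simp add: h_def T_def)
  qed
  show thesis
    by (rule that[OF T(1,3,2) sh SU])
      (use q T(2) intertwiner_rel in \<open>auto simp: h_def Q_def mm.scaleR_left mm.scaleR_right\<close>)
qed

text \<open>Faithfulness of the adjoint representation: connection forms can be compared through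
  their action on \<open>E1\<close> and \<open>E2\<close>.\<close>

lemma su2_commute_zero:
  assumes "M \<in> su2" "comm M E1 = 0" "comm M E2 = 0"
  shows "M = 0"
proof -
  obtain m where m: "m$1 = 0" "M = quat_mat m" using assms(1) by (rule su2E)
  have "quat_mat (qmult m (axis 2 1) - qmult (axis 2 1) m) = quat_mat 0"
    "quat_mat (qmult m (axis 3 1) - qmult (axis 3 1) m) = quat_mat 0"
    using assms(2,3) unfolding m E1_def E2_def comm_quat linear_0[OF linear_quat_mat] by auto
  then have "m = 0"
    unfolding quat_mat_eq_iff using m(1) by (simp add: real4_eq_iff qmult_nth axis_def)
  then show ?thesis using m linear_0[OF linear_quat_mat] by simp
qed

text \<open>For a curve e of unit quaternions the real part of (conjugate of e) e' is e \<bullet>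
  e', which vanishes as |e| is constant.\<close>

lemma SU2_logarithmic_derivative:
  assumes "open T" "x \<in> T" "smooth_on T h" "\<And>y. y \<in> T \<Longrightarrow> h y \<in> SU2"
  shows "mat_adj (h x) ** fd h x v \<in> su2"
proof -
  have d: "h differentiable at x" using smooth_on_differentiable assms(2,3) by blast
  have "fd (\<lambda>y. quat_mat (unquat (h y))) x v = fd h x v"
  proof (rule fun_cong[OF fd_cong[OF assms(1,2)]])
    show "quat_mat (unquat (h y)) = h y" if "y \<in> T" for y
      using assms(4)[OF that] unfolding SU2_quat by auto
  qed
  then have K: "fd h x v = quat_mat (unquat (fd h x v))"
    using fd_bounded_linear[OF bounded_linear_quat_unquat d, of v] by simp
  obtain e where e: "h x = quat_mat e" using assms(2,4) SU2_quat by blast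
  have "fd (\<lambda>y. h y \<bullet> h y) x v = fd (\<lambda>y. 2) x v"
  proof (rule fun_cong[OF fd_cong[OF assms(1,2)]])
    show "h y \<bullet> h y = 2" if "y \<in> T" for y
      using assms(4)[OF that] unfolding SU2_quat by (auto simp: quat_mat_inner norm_eq_1)
  qed
  then have "h x \<bullet> fd h x v = 0"
    using fd_bilinear[OF bounded_bilinear_inner d d, of v] by (simp add: inner_commute)
  then have "e \<bullet> unquat (fd h x v) = 0"
    by (subst (asm) K) (simp add: e quat_mat_inner)
  then show ?thesis
    by (subst K) (simp add: e quat_mat_adj quat_mat_mult quat_mat_su2 qmult_nth qcnj_nth inner_real4)
qed

lemma SU2_conj_su2:
  assumes "H \<in> SU2" "X \<in> su2" shows "mat_adj H ** X ** H \<in> su2"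
proof -
  obtain e x where "H = quat_mat e" "X = quat_mat x" "x$1 = 0"
    using assms unfolding SU2_quat su2_quat by blast
  then show ?thesis
    by (simp add: quat_mat_adj quat_mat_mult quat_mat_su2 qmult_nth qcnj_nth algebra_simps)
qed

abbreviation gauge_transform :: "(real^4 \<Rightarrow> cmat2) \<Rightarrow> (real^4 \<Rightarrow> real^4 \<Rightarrow> cmat2) \<Rightarrow> real^4 \<Rightarrow> real^4 \<Rightarrow> cmat2" where
  "gauge_transform h a x v \<equiv> mat_adj (h x) ** a x v ** h x + mat_adj (h x) ** fd h x v"

text \<open>Differentiating X h = h \<open>E1\<close> and inserting the covariant derivative of X
  shows that the difference of the two sides commutes with \<open>E1\<close>. The same holds for Y
  and \<open>E2\<close>, so the difference is zero.\<close>

lemma gauge_transform_from_frame: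
  assumes T: "open T" "x \<in> T" and smooth: "smooth_on T h" "smooth_on T X" "smooth_on T Y"
    and SU: "\<And>y. y \<in> T \<Longrightarrow> h y \<in> SU2" and "b \<in> su2" "a x v \<in> su2"
    and X: "\<And>y. y \<in> T \<Longrightarrow> X y ** h y = h y ** E1" and Y: "\<And>y. y \<in> T \<Longrightarrow> Y y ** h y = h y ** E2"
    and par: "cov_deriv a X x v = comm (h x ** b ** mat_adj (h x)) (X x)"
      "cov_deriv a Y x v = comm (h x ** b ** mat_adj (h x)) (Y x)"
  shows "b = gauge_transform h a x v"
proof -
  define H H' K where "H = h x" and "H' = mat_adj (h x)" and "K = fd h x v"
  define M where "M = H' ** a x v ** H + H' ** K - b"
  have H: "H' ** H = mat 1" "H ** H' = mat 1" using SU2_adj[OF SU[OF T(2)]] by (auto simp: H_def H'_def)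
  have key: "comm M E = 0" if Z: "smooth_on T Z" "\<And>y. y \<in> T \<Longrightarrow> Z y ** h y = h y ** E"
    and pZ: "cov_deriv a Z x v = comm (h x ** b ** mat_adj (h x)) (Z x)" for Z E
  proof -
    note d = smooth_on_differentiable[OF smooth(1) T(2)] smooth_on_differentiable[OF Z(1) T(2)]
    have "fd (\<lambda>y. Z y ** h y) x v = fd (\<lambda>y. h y ** E) x v"
      by (rule fun_cong[OF fd_cong[OF T]]) (rule Z(2))
    then have 1: "fd Z x v ** H = K ** E - Z x ** K"
      using fd_bilinear[OF bounded_bilinear_cmat_mult d(2,1), of v]
        fd_bounded_linear[OF mm.bounded_linear_left[of E] d(1), of v]
      unfolding H_def K_def by (simp add: algebra_simps)
    have ZH: "Z x ** H = H ** E" using Z(2)[OF T(2)] by (simp add: H_def)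
    have "H' ** (Z x ** H) ** H' = H' ** (H ** E) ** H'" by (simp add: ZH)
    then have ZH': "H' ** Z x = E ** H'" by (simp add: matrix_mul_assoc H) (simp add: H flip: matrix_mul_assoc)
    have "H' ** cov_deriv a Z x v ** H = H' ** (fd Z x v ** H) + H' ** a x v ** (Z x ** H) - (H' ** Z x) ** a x v ** H"
      by (simp add: cov_deriv_def cmat_ring)
    also have "\<dots> = H' ** K ** E - E ** H' ** K + H' ** a x v ** H ** E - E ** H' ** a x v ** H"
      unfolding 1 ZH ZH' by (simp add: cmat_ring) (simp add: ZH' flip: matrix_mul_assoc)
    finally have lhs: "H' ** cov_deriv a Z x v ** H = \<dots>" .
    have "H' ** comm (H ** b ** H') (Z x) ** H = (H' ** H) ** b ** (H' ** (Z x ** H)) - (H' ** Z x) ** H ** b ** (H' ** H)"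
      by (simp add: cmat_ring)
    also have "\<dots> = b ** E - E ** b"
      unfolding ZH ZH' by (simp add: matrix_mul_assoc H) (simp add: H flip: matrix_mul_assoc)
    finally have "b ** E - E ** b = H' ** cov_deriv a Z x v ** H"
      unfolding pZ by (simp only: H_def H'_def)
    moreover have "comm M E = (H' ** K ** E - E ** H' ** K + H' ** a x v ** H ** E - E ** H' ** a x v ** H)
        - (b ** E - E ** b)"
      by (simp add: M_def cmat_ring)
    ultimately show ?thesis unfolding lhs by simp
  qed
  have "M \<in> su2"
    unfolding M_def H_def H'_def K_def
    by (intro subspace_add[OF subspace_su2] subspace_diff[OF subspace_su2] SU2_conj_su2 SU
        SU2_logarithmic_derivative[OF T smooth(1)] assms)
  then have "M = 0"
    using su2_commute_zero key[OF smooth(2) X par(1)] key[OF smooth(3) Y par(2)] by blast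
  then show ?thesis unfolding M_def H_def H'_def K_def by simp
qed

text \<open>The transformation rule is used in multiplied form, so that no inverse has to be
  differentiated. Antisymmetrizing its derivative in u and v removes the second derivatives of
  g.\<close>

lemma gauge_covariance:
  assumes S: "open S" "x \<in> S" and smooth: "\<And>v. smooth_on S (\<lambda>y. a y v)" "\<And>v. smooth_on S (\<lambda>y. a' y v)" "smooth_on S g"
    and eq: "\<And>y v. y \<in> S \<Longrightarrow> g y ** a' y v = a y v ** g y + fd g y v"
  shows "g x ** curvature a' x u v = curvature a x u v ** g x"
proof -
  have d: "(\<lambda>y. a y v) differentiable at x" "(\<lambda>y. a' y v) differentiable at x" "g differentiable at x"
      "(\<lambda>y. fd g y v) differentiable at x" for v
    using smooth smooth_on_fd smooth_on_differentiable S(2) by blast+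
  have gd: "fd g x v = g x ** a' x v - a x v ** g x" for v
    using eq[OF S(2), of v] by simp
  have 1: "g x ** fd (\<lambda>y. a' y v) x u = a x v ** fd g x u + fd (\<lambda>y. a y v) x u ** g x
      + fd (\<lambda>y. fd g y v) x u - fd g x u ** a' x v" for u v
  proof -
    have "fd (\<lambda>y. g y ** a' y v) x u = fd (\<lambda>y. a y v ** g y + fd g y v) x u"
      by (rule fun_cong[OF fd_cong[OF S]]) (rule eq)
    moreover have "(\<lambda>y. a y v ** g y) differentiable at x"
      by (rule smooth_on_differentiable[OF smooth_on_cmat_mult[OF S(1) smooth(1,3)] S(2)])
    ultimately show ?thesis
      using fd_bilinear[OF bounded_bilinear_cmat_mult d(3) d(2), of v u]
        fd_bilinear[OF bounded_bilinear_cmat_mult d(1) d(3), of v u]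
        fd_add[OF _ d(4), of "\<lambda>y. a y v ** g y" v u] by (simp add: eq_diff_eq)
  qed
  have 2: "fd (\<lambda>y. fd g y v) x u = fd (\<lambda>y. fd g y u) x v" by (rule fd_commute[OF S smooth(3)])
  show ?thesis
    unfolding curvature_def mm.add_right mm.diff_right 1 2 gd by (simp add: cmat_ring)
qed

section \<open>The normalized self-dual frame and the BPST form\<close>

lemma smooth_wt: "open S \<Longrightarrow> smooth_on S wt"
  by (intro smooth_on_add smooth_on_const smooth_on_norm_sq smooth_on_ident)

text \<open>The factor, sign included, is the one for which the self-dual components of the BPST
  form become the constants \<open>E1\<close>, \<open>E2\<close>, \<open>E3\<close>.\<close>

definition frame :: "(real^4 \<Rightarrow> cmat2) \<Rightarrow> real^4 \<Rightarrow> cmat2" where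
  "frame s x = (- ((wt x)\<^sup>2 / 4)) *\<^sub>R s x"

lemma smooth_frame:
  assumes "open S" "smooth_on S s" shows "smooth_on S (frame s)"
proof -
  have "smooth_on S (\<lambda>x. (- 1 / 4) * (wt x * wt x))"
    by (intro smooth_on_mult smooth_on_const smooth_wt assms(1))
  then have "smooth_on S (\<lambda>x. - ((wt x)\<^sup>2 / 4))"
    by (simp add: power2_eq_square)
  then show ?thesis unfolding frame_def[abs_def] using assms by (intro smooth_on_scaleR)
qed

lemma bpst_axis:
  "bpst x (e4 i) = (1 / wt x) *\<^sub>R (bpst_coeff x i $ 2 *\<^sub>R E1 + bpst_coeff x i $ 3 *\<^sub>R E2 + bpst_coeff x i $ 4 *\<^sub>R E3)"
  unfolding bpst_def bpst_coeff_def[symmetric] E1_def E2_def E3_def quat_mat_lin[symmetric] quat_mat_eq_iff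
  by (simp add: real4_eq_iff qIm_nth axis_def)

lemma bpst_su2: "bpst x v \<in> su2"
  by (simp add: bpst_def quat_mat_su2 qIm_nth)

lemma linear_bpst: "linear (bpst x)"
proof (rule linearI)
  show "bpst x (u + v) = bpst x u + bpst x v" for u v
    unfolding bpst_def quat_mat_lin[symmetric] quat_mat_eq_iff
    by (simp add: real4_eq_iff qIm_nth qmult_nth qcnj_nth algebra_simps)
  show "bpst x (r *\<^sub>R v) = r *\<^sub>R bpst x v" for r v
    unfolding bpst_def quat_mat_lin[symmetric] quat_mat_eq_iff
    by (simp add: real4_eq_iff qIm_nth qmult_nth qcnj_nth algebra_simps)
qed

definition intertwines :: "(real^4 \<Rightarrow> real^4 \<Rightarrow> cmat2) \<Rightarrow> real^4 \<Rightarrow> cmat2 \<Rightarrow> bool" where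
  "intertwines a x h \<longleftrightarrow> frame (sd1 a) x ** h = h ** E1 \<and> frame (sd2 a) x ** h = h ** E2
     \<and> frame (sd3 a) x ** h = h ** E3"

context yang_mills_field
begin

text \<open>Where \<open>slap\<close> vanishes, \<open>bochner\<close> bounds a sum of nonnegative
  terms by zero. The twistor terms give the differential equations, the completed squares the
  algebraic ones.\<close>

lemma extremal:
  assumes x: "x \<in> U"
    and bound: "wt x^4 * sd_norm a x \<le> 96" "sd_norm a x \<noteq> 0"
    and slap: "slap (\<lambda>y. wt y^4 * sd_norm a y) x = 0"
  defines "w \<equiv> wt x"
  shows "quat_triple (frame (sd1 a) x) (frame (sd2 a) x) (frame (sd3 a) x)"
    "twistor1 i x = 0" "twistor2 i x = 0"
proof -
  have wp: "w > 0" by (simp add: w_def wt_pos)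
  let ?X = "w\<^sup>2 *\<^sub>R sd1 a x" and ?Y = "w\<^sup>2 *\<^sub>R sd2 a x" and ?Z = "w\<^sup>2 *\<^sub>R sd3 a x"
  define S where "S = twistor_sq x"
  have "0 \<ge> 2 * w^4 * S
      + 16 * ((norm (?X + (1/8) *\<^sub>R comm ?Y ?Z))\<^sup>2 + (norm (?Y + (1/8) *\<^sub>R comm ?Z ?X))\<^sup>2
          + (norm (?Z + (1/8) *\<^sub>R comm ?X ?Y))\<^sup>2)"
    using bochner[OF x bound(1)] slap unfolding S_def w_def by simp
  moreover have "S \<ge> 0" unfolding S_def by (intro sum_nonneg) simp
  then have "2 * w^4 * S \<ge> 0" using wp by simp
  moreover have "p = 0 \<and> q = 0 \<and> r = 0 \<and> t = 0"
    if "(0::real) \<ge> p + 16 * (q + r + t)" "p \<ge> 0" "q \<ge> 0" "r \<ge> 0" "t \<ge> 0" for p q r t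
  proof -
    have "p \<le> 0" "q \<le> 0" "r \<le> 0" "t \<le> 0" using that by simp_all
    with that show ?thesis by simp
  qed
  ultimately have z4: "2 * w^4 * S = 0 \<and> (norm (?X + (1/8) *\<^sub>R comm ?Y ?Z))\<^sup>2 = 0
      \<and> (norm (?Y + (1/8) *\<^sub>R comm ?Z ?X))\<^sup>2 = 0 \<and> (norm (?Z + (1/8) *\<^sub>R comm ?X ?Y))\<^sup>2 = 0"
    using zero_le_power2 by blast
  then have z: "?X + (1/8) *\<^sub>R comm ?Y ?Z = 0" "?Y + (1/8) *\<^sub>R comm ?Z ?X = 0"
      "?Z + (1/8) *\<^sub>R comm ?X ?Y = 0"
    by (simp_all only: zero_eq_power2 norm_eq_zero)
  have "S = 0" using z4 wp by simp
  then have "\<forall>i\<in>UNIV. (norm (twistor1 i x))\<^sup>2 + (norm (twistor2 i x))\<^sup>2 + (norm (twistor3 i x))\<^sup>2 = 0"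
    unfolding S_def by (subst (asm) sum_nonneg_eq_0_iff) auto
  then show "twistor1 i x = 0" "twistor2 i x = 0"
    by (simp_all add: add_nonneg_eq_0_iff)
  let ?r1 = "frame (sd1 a) x" and ?r2 = "frame (sd2 a) x" and ?r3 = "frame (sd3 a) x"
  \<comment> \<open>In terms of the frame, X + [Y, Z] / 8 = 0 reads 2 r1 = [r2, r3], the hypothesis
    of \<open>quat_tripleI\<close>.\<close>
  have r: "?X = (-4) *\<^sub>R ?r1" "?Y = (-4) *\<^sub>R ?r2" "?Z = (-4) *\<^sub>R ?r3"
    by (simp_all add: frame_def w_def)
  have quarter: "2 *\<^sub>R p = q" if "(-4) *\<^sub>R p + (1/8) *\<^sub>R (16 *\<^sub>R q) = 0" for p q :: cmat2
  proof -
    have "2 *\<^sub>R q = 2 *\<^sub>R (2 *\<^sub>R p)" using that by (simp add: eq_neg_iff_add_eq_0 add.commute)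
    then show ?thesis by (simp only: scaleR_cancel_left) simp
  qed
  have rel: "2 *\<^sub>R ?r1 = comm ?r2 ?r3" "2 *\<^sub>R ?r2 = comm ?r3 ?r1" "2 *\<^sub>R ?r3 = comm ?r1 ?r2"
    using z unfolding r by (intro quarter; simp add: cm.scaleR_left cm.scaleR_right cm.minus_left cm.minus_right)+
  have "sd1 a x \<noteq> 0 \<or> sd2 a x \<noteq> 0 \<or> sd3 a x \<noteq> 0"
    using bound(2) by (auto simp: sd_norm_def)
  then have "?r1 \<noteq> 0 \<or> ?r2 \<noteq> 0 \<or> ?r3 \<noteq> 0"
    using wp by (auto simp: frame_def w_def)
  moreover have "?r1 \<in> su2" "?r2 \<in> su2" "?r3 \<in> su2"
    unfolding frame_def by (intro subspace_scale[OF subspace_su2] sd_su2 x)+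
  ultimately show "quat_triple ?r1 ?r2 ?r3" using rel by (intro quat_tripleI)
qed

text \<open>The weight absorbs the radial term of the twistor equations: the i-th derivative of (1 +
  |x|^2)^2 is 4 x_i (1 + |x|^2).\<close>

lemma cov_deriv_frame:
  assumes x: "x \<in> U" and s: "smooth_on U s"
  shows "D i (frame s) x = (- (wt x / 4)) *\<^sub>R (wt x *\<^sub>R D i s x + (4 * x$i) *\<^sub>R s x)"
proof -
  define f where "f = (\<lambda>y::real^4. - ((1 + y \<bullet> y)\<^sup>2 / 4))"
  have "(f has_derivative (\<lambda>v. - ((1 + x \<bullet> x) * (x \<bullet> v)))) (at x)"
    unfolding f_def by (auto intro!: derivative_eq_intros simp: inner_commute algebra_simps)
  then have "fd f x = (\<lambda>v. - ((1 + x \<bullet> x) * (x \<bullet> v)))" and df: "f differentiable at x"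
    by (auto simp: fd_eq differentiable_def)
  then have "fd (\<lambda>y. f y *\<^sub>R s y) x (e4 i) = f x *\<^sub>R fd s x (e4 i) + (- ((1 + x \<bullet> x) * (x $ i))) *\<^sub>R s x"
    using fd_bilinear[OF bounded_bilinear_scaleR df smooth_on_differentiable[OF s x]]
    by (simp add: inner_axis)
  moreover have "frame s = (\<lambda>y. f y *\<^sub>R s y)"
    by (rule ext) (simp add: frame_def f_def power2_norm_eq_inner)
  moreover have "wt x = 1 + x \<bullet> x" by (simp add: power2_norm_eq_inner)
  ultimately show ?thesis
    unfolding cov_deriv_def
    by (simp add: f_def cm.scaleR_right cm.minus_right scaleR_add_right power2_eq_square)
qed

text \<open>By the twistor equations the frame is rotated infinitesimally with coefficients
  \<open>bpst_coeff x i\<close>. Since h carries the units to the frame, conjugating the BPST form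
  by h expresses this rotation as a bracket.\<close>

lemma frame_parallel:
  assumes x: "x \<in> U" and q: "quat_triple (frame (sd1 a) x) (frame (sd2 a) x) (frame (sd3 a) x)"
    and T: "twistor1 i x = 0" "twistor2 i x = 0"
    and h: "h \<in> SU2" "intertwines a x h"
  defines "B \<equiv> h ** bpst x (e4 i) ** mat_adj h"
  shows "D i (frame (sd1 a)) x = comm B (frame (sd1 a) x)"
    "D i (frame (sd2 a)) x = comm B (frame (sd2 a) x)"
proof -
  let ?r1 = "frame (sd1 a) x" and ?r2 = "frame (sd2 a) x" and ?r3 = "frame (sd3 a) x"
  let ?g = "bpst_coeff x i"
  note wp = wt_pos[of x]
  have T': "wt x *\<^sub>R D i (sd1 a) x + (4 * x$i) *\<^sub>R sd1 a x = (2 * ?g $ 4) *\<^sub>R sd2 a x - (2 * ?g $ 3) *\<^sub>R sd3 a x"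
    "wt x *\<^sub>R D i (sd2 a) x + (4 * x$i) *\<^sub>R sd2 a x = (2 * ?g $ 2) *\<^sub>R sd3 a x - (2 * ?g $ 4) *\<^sub>R sd1 a x"
    using T by (simp_all add: eq_diff_eq)
  have "h ** E1 ** mat_adj h = ?r1" "h ** E2 ** mat_adj h = ?r2" "h ** E3 ** mat_adj h = ?r3"
    using h(2) SU2_adj(1)[OF h(1)] unfolding intertwines_def
    by (metis matrix_mul_assoc matrix_mul_rid)+
  then have B: "B = (1 / wt x) *\<^sub>R (?g $ 2 *\<^sub>R ?r1 + ?g $ 3 *\<^sub>R ?r2 + ?g $ 4 *\<^sub>R ?r3)"
    unfolding B_def bpst_axis by (simp add: mm.scaleR_left mm.scaleR_right mm.add_left mm.add_right)
  have c: "comm ?r2 ?r1 = (-2) *\<^sub>R ?r3" "comm ?r3 ?r1 = 2 *\<^sub>R ?r2" "comm ?r1 ?r2 = 2 *\<^sub>R ?r3"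
      "comm ?r3 ?r2 = (-2) *\<^sub>R ?r1"
    using q unfolding quat_triple_def comm_def by (simp_all add: scaleR_2)
  have s: "(wt x / 4) *\<^sub>R (k *\<^sub>R s x) = (- (k / wt x)) *\<^sub>R frame s x" for k s
    using wp by (simp add: frame_def power2_eq_square)
  have "D i (frame (sd1 a)) x = (- (wt x / 4)) *\<^sub>R ((2 * ?g $ 4) *\<^sub>R sd2 a x - (2 * ?g $ 3) *\<^sub>R sd3 a x)"
    unfolding cov_deriv_frame[OF x sd_smooth(1)] T'(1) by simp
  also have "\<dots> = (2 * ?g $ 4 / wt x) *\<^sub>R ?r2 - (2 * ?g $ 3 / wt x) *\<^sub>R ?r3"
    unfolding scaleR_minus_left scaleR_diff_right s by simp
  also have "\<dots> = comm B ?r1"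
    unfolding B by (simp add: cm.scaleR_left cm.add_left c scaleR_add_right mult.commute)
  finally show "D i (frame (sd1 a)) x = comm B ?r1" .
  have "D i (frame (sd2 a)) x = (- (wt x / 4)) *\<^sub>R ((2 * ?g $ 2) *\<^sub>R sd3 a x - (2 * ?g $ 4) *\<^sub>R sd1 a x)"
    unfolding cov_deriv_frame[OF x sd_smooth(2)] T'(2) by simp
  also have "\<dots> = (2 * ?g $ 2 / wt x) *\<^sub>R ?r3 - (2 * ?g $ 4 / wt x) *\<^sub>R ?r1"
    unfolding scaleR_minus_left scaleR_diff_right s by simp
  also have "\<dots> = comm B ?r2"
    unfolding B by (simp add: cm.scaleR_left cm.add_left c scaleR_add_right mult.commute)
  finally show "D i (frame (sd2 a)) x = comm B ?r2" .
qed

lemma local_gauge: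
  assumes p: "p \<in> U"
    and ex: "\<And>x. x \<in> U \<Longrightarrow> wt x^4 * sd_norm a x \<le> 96" "\<And>x. x \<in> U \<Longrightarrow> sd_norm a x \<noteq> 0"
      "\<And>x. x \<in> U \<Longrightarrow> slap (\<lambda>y. wt y^4 * sd_norm a y) x = 0"
  obtains T h where "open T" "p \<in> T" "T \<subseteq> U" "smooth_on T h" "\<And>x. x \<in> T \<Longrightarrow> h x \<in> SU2"
    "\<And>x. x \<in> T \<Longrightarrow> intertwines a x (h x)"
    "\<And>x v. x \<in> T \<Longrightarrow> bpst x v = gauge_transform h a x v"
proof -
  note fr = smooth_frame[OF open_U sd_smooth(1)] smooth_frame[OF open_U sd_smooth(2)]
    smooth_frame[OF open_U sd_smooth(3)]
  obtain T h where T: "open T" "p \<in> T" "T \<subseteq> U" "smooth_on T h" "\<And>x. x \<in> T \<Longrightarrow> h x \<in> SU2"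
    "\<And>x. x \<in> T \<Longrightarrow> frame (sd1 a) x ** h x = h x ** E1" "\<And>x. x \<in> T \<Longrightarrow> frame (sd2 a) x ** h x = h x ** E2"
    "\<And>x. x \<in> T \<Longrightarrow> frame (sd3 a) x ** h x = h x ** E3"
    using local_lift[OF open_U p fr extremal(1)[OF _ ex]] by metis
  then have int: "intertwines a x (h x)" if "x \<in> T" for x using that by (simp add: intertwines_def)
  have "bpst x v = gauge_transform h a x v" if x: "x \<in> T" for x v
  proof -
    have xU: "x \<in> U" using x T(3) by blast
    let ?R = "gauge_transform h a x"
    have e: "bpst x (e4 i) = ?R (e4 i)" for i
    proof (rule gauge_transform_from_frame[where X = "frame (sd1 a)" and Y = "frame (sd2 a)" and a = a
          and h = h and x = x and T = T and b = "bpst x (e4 i)" and v = "e4 i", OF T(1) x T(4) smooth_on_subset[OF fr(1) T(3)]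
          smooth_on_subset[OF fr(2) T(3)] T(5) bpst_su2 su2_a[OF xU] T(6,7)])
      show "D i (frame (sd1 a)) x = comm (h x ** bpst x (e4 i) ** mat_adj (h x)) (frame (sd1 a) x)"
        "D i (frame (sd2 a)) x = comm (h x ** bpst x (e4 i) ** mat_adj (h x)) (frame (sd2 a) x)"
        using frame_parallel[OF xU extremal(1)[OF xU ex[OF xU]] extremal(2,3)[OF xU ex[OF xU]] T(5)[OF x] int[OF x]]
        by blast+
    qed
    have lf: "linear (fd h x)"
      using linear_frechet_derivative smooth_on_differentiable[OF T(4) x] .
    have lR: "linear ?R"
    proof (rule linearI)
      show "?R (u + v) = ?R u + ?R v" for u v
        by (simp add: linear_add[OF lf] linear_add[OF linear_a[OF xU]] mm.add_left mm.add_right)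
      show "?R (r *\<^sub>R v) = r *\<^sub>R ?R v" for r v
        by (simp add: linear_scale[OF lf] linear_scale[OF linear_a[OF xU]] mm.scaleR_left
            mm.scaleR_right scaleR_add_right)
    qed
    have "bpst x = ?R"
    proof (rule linear_eq_stdbasis[OF linear_bpst lR])
      fix b :: "real^4" assume "b \<in> Basis"
      then obtain i where "b = e4 i" by (auto simp: Basis_vec_def)
      then show "bpst x b = ?R b" using e by simp
    qed
    then show ?thesis by metis
  qed
  then show thesis using that T int by blast
qed

end

section \<open>Global gauge transformations\<close>

lemma slap_cong:
  assumes "open S" "x \<in> S" "\<And>y. y \<in> S \<Longrightarrow> f y = g y"
  shows "slap f x = slap g x"
proof -
  have "fd f y = fd g y" if "y \<in> S" for y using fd_cong[OF assms(1) that assms(3)] .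
  moreover from this have "fd (\<lambda>y. fd f y e) x = fd (\<lambda>y. fd g y e) x" for e
    by (intro fd_cong[OF assms(1,2)]) simp
  ultimately show ?thesis unfolding slap_def using assms(2) by simp
qed

text \<open>The quotient of the two commutes with \<open>E1\<close> and \<open>E2\<close>, so it is
  a real unit quaternion.\<close>

lemma intertwines_unique_up_to_sign:
  assumes "h \<in> SU2" "k \<in> SU2" "intertwines a x h" "intertwines a x k"
  shows "k = h \<or> k = - h"
proof -
  obtain p q where p: "norm p = 1" "h = quat_mat p" and q: "norm q = 1" "k = quat_mat q"
    using assms(1,2) SU2_quat by blast
  define m where "m = qmult (qcnj p) q"
  have M: "mat_adj h ** k = quat_mat m" by (simp add: p q m_def quat_mat_adj quat_mat_mult)
  have hm: "k = h ** quat_mat m"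
    unfolding M[symmetric] by (simp add: matrix_mul_assoc SU2_adj(1)[OF assms(1)])
  have c: "quat_mat m ** E = E ** quat_mat m" if "X ** h = h ** E" "X ** k = k ** E" for X E
  proof -
    have "mat_adj h ** X ** h = E" using that(1) SU2_adj(2)[OF assms(1)]
      by (metis matrix_mul_assoc matrix_mul_lid)
    then have "mat_adj h ** X ** k = E ** quat_mat m" unfolding hm by (simp add: matrix_mul_assoc)
    moreover have "mat_adj h ** X ** k = quat_mat m ** E"
      using that(2) unfolding M[symmetric] by (metis matrix_mul_assoc)
    ultimately show ?thesis by simp
  qed
  have "quat_mat m ** E1 = E1 ** quat_mat m" "quat_mat m ** E2 = E2 ** quat_mat m"
    using c assms(3,4) unfolding intertwines_def by blast+
  then have "m$2 = 0" "m$3 = 0" "m$4 = 0"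
    unfolding E1_def E2_def quat_mat_mult quat_mat_eq_iff by (simp_all add: real4_eq_iff qmult_nth axis_def)
  moreover have "norm (qcnj p) = norm p"
    by (simp add: norm_eq_sqrt_inner inner_real4 qcnj_nth)
  then have "norm m = 1" using p q by (simp add: m_def norm_qmult)
  ultimately have "m$1 = 1 \<or> m$1 = - 1" by (simp add: norm_eq_1 inner_real4 square_eq_1_iff)
  then have "m = axis 1 1 \<or> m = - axis 1 1"
    using \<open>m$2 = 0\<close> \<open>m$3 = 0\<close> \<open>m$4 = 0\<close> by (auto simp: real4_eq_iff axis_def)
  then show ?thesis unfolding hm by (auto simp: quat_mat_one quat_mat_lin mm.minus_right)
qed

lemma convex_nbhd:
  fixes K :: "'a::euclidean_space set"
  assumes "compact K" "convex K" "open W" "K \<subseteq> W"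
  obtains C where "open C" "convex C" "K \<subseteq> C" "C \<subseteq> W"
proof -
  obtain e where e: "e > 0" "(\<Union>x\<in>K. ball x e) \<subseteq> W"
    using compact_subset_open_imp_ball_epsilon_subset[OF assms(1,3,4)] by blast
  have "(\<Union>x\<in>K. ball x e) = (\<Union>x\<in>K. \<Union>y\<in>ball 0 e. {x + y})"
  proof (intro equalityI subsetI)
    fix z assume "z \<in> (\<Union>x\<in>K. ball x e)"
    then obtain x where "x \<in> K" "dist x z < e" by auto
    then show "z \<in> (\<Union>x\<in>K. \<Union>y\<in>ball 0 e. {x + y})"
      by (intro UN_I[of x] UN_I[of "z - x"]) (auto simp: dist_norm norm_minus_commute)
  next
    fix z assume "z \<in> (\<Union>x\<in>K. \<Union>y\<in>ball 0 e. {x + y})"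
    then obtain x y where "x \<in> K" "norm y < e" "z = x + y" by auto
    then show "z \<in> (\<Union>x\<in>K. ball x e)" by (intro UN_I[of x]) (auto simp: dist_norm)
  qed
  then have "convex (\<Union>x\<in>K. ball x e)"
    using convex_sums[OF assms(2) convex_ball[of 0 e]] by simp
  moreover have "open (\<Union>x\<in>K. ball x e)" by blast
  moreover have "K \<subseteq> (\<Union>x\<in>K. ball x e)" using e(1) by auto
  ultimately show thesis using that e(2) by blast
qed

section \<open>Connections over four-space given by a cocycle\<close>

locale r4_connection =
  fixes I :: "'i set" and U :: "'i \<Rightarrow> (real^4) set" and G :: "'i \<Rightarrow> 'i \<Rightarrow> real^4 \<Rightarrow> cmat2"
    and a :: "'i \<Rightarrow> real^4 \<Rightarrow> real^4 \<Rightarrow> cmat2"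
  assumes cover: "\<exists>i\<in>I. x \<in> U i"
    and G_SU2: "\<lbrakk>i \<in> I; j \<in> I; x \<in> U i \<inter> U j\<rbrakk> \<Longrightarrow> G i j x \<in> SU2"
    and G_cocycle: "\<lbrakk>i \<in> I; j \<in> I; k \<in> I; x \<in> U i \<inter> U j \<inter> U k\<rbrakk> \<Longrightarrow> G i j x ** G j k x = G i k x"
    and G_smooth: "\<lbrakk>i \<in> I; j \<in> I\<rbrakk> \<Longrightarrow> smooth_on (U i \<inter> U j) (G i j)"
    and ym: "i \<in> I \<Longrightarrow> yang_mills_field (U i) (a i)"
    and trans: "\<lbrakk>i \<in> I; j \<in> I; x \<in> U i \<inter> U j\<rbrakk> \<Longrightarrow>
        a j x w = gauge_transform (G i j) (a i) x w"
begin

lemma gauge: "i \<in> I \<Longrightarrow> gauge_field (U i) (a i)"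
  using ym yang_mills_field.axioms(1) by blast

lemma open_U: "i \<in> I \<Longrightarrow> open (U i)"
  using gauge gauge_field.open_U by blast

lemma trans_mult:
  assumes "i \<in> I" "j \<in> I" "x \<in> U i \<inter> U j"
  shows "G i j x ** a j x w = a i x w ** G i j x + fd (G i j) x w"
  using SU2_adj(1)[OF G_SU2[OF assms]] unfolding trans[OF assms] mm.add_right
  by (simp add: matrix_mul_assoc)

lemma curvature_trans:
  assumes "i \<in> I" "j \<in> I" "x \<in> U i \<inter> U j"
  shows "G i j x ** curvature (a j) x u v = curvature (a i) x u v ** G i j x"
proof (rule gauge_covariance[of "U i \<inter> U j"])
  show "open (U i \<inter> U j)" using open_U assms by blast
  show "smooth_on (U i \<inter> U j) (\<lambda>y. a i y v)" "smooth_on (U i \<inter> U j) (\<lambda>y. a j y v)" for v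
    using gauge_field.smooth_a[OF gauge] assms smooth_on_subset by (metis inf_le1, metis inf_le2)
qed (use assms G_smooth trans_mult in auto)

lemma sd_trans:
  assumes "i \<in> I" "j \<in> I" "x \<in> U i \<inter> U j"
  shows "G i j x ** sd1 (a j) x = sd1 (a i) x ** G i j x" "G i j x ** sd2 (a j) x = sd2 (a i) x ** G i j x"
    "G i j x ** sd3 (a j) x = sd3 (a i) x ** G i j x"
  unfolding sd1_def sd2_def sd3_def using curvature_trans[OF assms]
  by (simp_all add: mm.add_left mm.add_right)

lemma sd_norm_trans:
  assumes "i \<in> I" "j \<in> I" "x \<in> U i \<inter> U j"
  shows "sd_norm (a j) x = sd_norm (a i) x"
proof -
  have "x \<in> U i" "x \<in> U j" using assms by auto
  note su = yang_mills_field.sd_su2[OF ym[OF assms(1)] this(1)] yang_mills_field.sd_su2[OF ym[OF assms(2)] this(2)]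
  show ?thesis
    using norm_conj_SU2[OF G_SU2[OF assms] _ _ sd_trans(1)[OF assms]]
      norm_conj_SU2[OF G_SU2[OF assms] _ _ sd_trans(2)[OF assms]]
      norm_conj_SU2[OF G_SU2[OF assms] _ _ sd_trans(3)[OF assms]] su
    unfolding sd_norm_def power2_norm_eq_inner[symmetric] by simp
qed

lemma sd_norm_constant:
  assumes bound: "\<And>i x. i \<in> I \<Longrightarrow> x \<in> U i \<Longrightarrow> wt x^4 * sd_norm (a i) x \<le> 96"
  obtains M where "\<And>i x. i \<in> I \<Longrightarrow> x \<in> U i \<Longrightarrow> wt x^4 * sd_norm (a i) x = M"
    "\<And>i x. i \<in> I \<Longrightarrow> x \<in> U i \<Longrightarrow> slap (\<lambda>y. wt y^4 * sd_norm (a i) y) x = 0"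
proof -
  \<comment> \<open>An arbitrary trivialization is picked at each point. The norm does not depend on
    it, so the resulting function is smooth although the choice is not even continuous.\<close>
  define c where "c x = (SOME i. i \<in> I \<and> x \<in> U i)" for x
  have c: "c x \<in> I \<and> x \<in> U (c x)" for x
    unfolding c_def by (rule someI_ex) (use cover in blast)
  define u where "u x = wt x^4 * sd_norm (a (c x)) x" for x
  have loc: "u y = wt y^4 * sd_norm (a i) y" if "i \<in> I" "y \<in> U i" for i y
    using sd_norm_trans[OF that(1), of "c y" y] c[of y] that unfolding u_def by simp
  have sm: "smooth_on (U i) (\<lambda>y. wt y^4 * sd_norm (a i) y)" if "i \<in> I" for i
  proof -
    have "smooth_on (U i) (\<lambda>y. (wt y * wt y) * (wt y * wt y))"
      by (intro smooth_on_mult smooth_wt open_U that)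
    then have "smooth_on (U i) (\<lambda>y. wt y^4)" by (simp add: power4_eq_xxxx mult.assoc)
    then show ?thesis
      by (intro smooth_on_mult open_U that yang_mills_field.smooth_sd_norm[OF ym])
  qed
  have su: "smooth_on UNIV u"
  proof (rule smooth_on_local)
    fix x :: "real^4"
    show "\<exists>T. open T \<and> x \<in> T \<and> smooth_on T u"
      using smooth_on_cong[OF open_U sm, of "c x" u] c[of x] loc open_U by metis
  qed
  have sl: "slap u x = slap (\<lambda>y. wt y^4 * sd_norm (a i) y) x" if "i \<in> I" "x \<in> U i" for i x
    by (rule slap_cong[OF open_U[OF that(1)] that(2)]) (rule loc[OF that(1)])
  have ge: "slap u x \<ge> 0" for x
  proof -
    have "0 \<le> (wt x)\<^sup>2 * slap (\<lambda>y. wt y^4 * sd_norm (a (c x)) y) x"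
      using c[of x] wt_pos[of x]
      by (intro order_trans[OF _ yang_mills_field.bochner[OF ym, of "c x" x]])
        (auto intro!: add_nonneg_nonneg mult_nonneg_nonneg sum_nonneg bound)
    then show ?thesis
      using sl[of "c x" x] c[of x] wt_pos[of x] by (simp add: zero_le_mult_iff)
  qed
  have "u x \<le> 96" for x unfolding u_def using bound c by blast
  then obtain M where M: "\<And>x. u x = M" using liouville[OF su _ ge] by metis
  have "u = (\<lambda>x. M)" using M by (rule ext)
  then have "slap u x = 0" for x by (simp only: slap_def frechet_derivative_const) simp
  then show thesis
    using M loc sl by (intro that[of M]) simp_all
qed

text \<open>Over a connected set there are exactly two sections or none, differing by a sign: the
  isomorphisms from the trivial bundle with the BPST connection that carry \<open>E1, E2, E3\<close> to the
  normalized self-dual curvature.\<close>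

definition is_section :: "(real^4) set \<Rightarrow> ('i \<Rightarrow> real^4 \<Rightarrow> cmat2) \<Rightarrow> bool" where
  "is_section S h \<longleftrightarrow> open S \<and> (\<forall>i\<in>I. smooth_on (S \<inter> U i) (h i) \<and>
     (\<forall>x\<in>S \<inter> U i. h i x \<in> SU2 \<and> intertwines (a i) x (h i x) \<and>
        (\<forall>v. bpst x v = gauge_transform (h i) (a i) x v) \<and>
        (\<forall>j\<in>I. x \<in> U j \<longrightarrow> h i x = G i j x ** h j x)))"

lemma is_sectionD:
  assumes "is_section S h"
  shows "open S" "i \<in> I \<Longrightarrow> smooth_on (S \<inter> U i) (h i)"
    "i \<in> I \<Longrightarrow> x \<in> S \<Longrightarrow> x \<in> U i \<Longrightarrow> h i x \<in> SU2"
    "i \<in> I \<Longrightarrow> x \<in> S \<Longrightarrow> x \<in> U i \<Longrightarrow> intertwines (a i) x (h i x)"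
    "i \<in> I \<Longrightarrow> x \<in> S \<Longrightarrow> x \<in> U i \<Longrightarrow>
      bpst x v = gauge_transform (h i) (a i) x v"
    "i \<in> I \<Longrightarrow> j \<in> I \<Longrightarrow> x \<in> S \<Longrightarrow> x \<in> U i \<Longrightarrow> x \<in> U j \<Longrightarrow> h i x = G i j x ** h j x"
  using assms unfolding is_section_def by blast+

lemma is_section_uminus:
  assumes "is_section S h" shows "is_section S (\<lambda>i x. - h i x)"
proof -
  have adj: "mat_adj (- M) = - mat_adj M" for M by (simp add: vec_eq_iff mat_adj_def)
  have d: "fd (\<lambda>x. - h i x) x v = - fd (h i) x v" if "i \<in> I" "x \<in> S \<inter> U i" for i x v
    using is_sectionD(2)[OF assms that(1)] that(2)
    by (intro fd_bounded_linear[OF bounded_linear_minus[OF bounded_linear_ident]] smooth_on_differentiable)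
  have "- M \<in> SU2" if "M \<in> SU2" for M
    using that unfolding SU2_quat by (metis norm_minus_cancel quat_mat_lin(4))
  moreover have "intertwines (a i) x (- M)" if "intertwines (a i) x M" for i x M
    using that by (simp add: intertwines_def mm.minus_left mm.minus_right)
  moreover have "smooth_on (S \<inter> U i) (\<lambda>x. - h i x)" if "i \<in> I" for i
    using is_sectionD(1,2)[OF assms] that open_U by (intro smooth_on_minus) auto
  ultimately show ?thesis
  proof (unfold is_section_def, intro conjI ballI allI impI)
    show "open S" by (rule is_sectionD(1)[OF assms])
    fix i x v assume i: "i \<in> I" and x: "x \<in> S \<inter> U i"
    have h: "bpst x v = gauge_transform (h i) (a i) x v"
      using assms i x unfolding is_section_def by blast
    show "bpst x v = mat_adj (- h i x) ** a i x v ** - h i x + mat_adj (- h i x) ** fd (\<lambda>x. - h i x) x v"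
      unfolding d[OF i x] adj h by (simp add: mm.minus_left mm.minus_right)
  next
    fix i x j assume i: "i \<in> I" and x: "x \<in> S \<inter> U i" and j: "j \<in> I" "x \<in> U j"
    have "h i x = G i j x ** h j x" using assms i x j unfolding is_section_def by blast
    then show "- h i x = G i j x ** - h j x" by (simp only: mm.minus_right)
  qed (use assms[unfolded is_section_def] in blast)+
qed

lemma is_section_glue:
  assumes "open S"
    and loc: "\<And>x. x \<in> S \<Longrightarrow> \<exists>T k. is_section T k \<and> x \<in> T \<and> (\<forall>i\<in>I. \<forall>y\<in>S \<inter> T \<inter> U i. h i y = k i y)"
  shows "is_section S h"
  unfolding is_section_def
proof (intro conjI ballI allI impI assms(1))
  fix i assume i: "i \<in> I"
  show "smooth_on (S \<inter> U i) (h i)"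
  proof (rule smooth_on_local)
    fix x assume x: "x \<in> S \<inter> U i"
    then obtain T k where T: "is_section T k" "x \<in> T" "\<forall>i\<in>I. \<forall>y\<in>S \<inter> T \<inter> U i. h i y = k i y"
      using loc by blast
    have o: "open (S \<inter> T \<inter> U i)" using assms(1) is_sectionD(1)[OF T(1)] open_U[OF i] by blast
    have "smooth_on (S \<inter> T \<inter> U i) (k i)"
      by (rule smooth_on_subset[OF is_sectionD(2)[OF T(1) i]]) blast
    then have "smooth_on (S \<inter> T \<inter> U i) (h i)"
      by (rule smooth_on_cong[OF o]) (use T(3) i in auto)
    then show "\<exists>T. open T \<and> x \<in> T \<and> smooth_on T (h i)" using o x T(2) by blast
  qed
  fix x assume x: "x \<in> S \<inter> U i"
  then obtain T k where T: "is_section T k" "x \<in> T" "\<forall>i\<in>I. \<forall>y\<in>S \<inter> T \<inter> U i. h i y = k i y"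
    using loc by blast
  have o: "open (S \<inter> T \<inter> U i)" using assms(1) is_sectionD(1)[OF T(1)] open_U[OF i] by blast
  have hk: "h i x = k i x" using T x i by auto
  have fd: "fd (h i) x = fd (k i) x"
    by (rule fd_cong[OF o]) (use T x i in auto)
  note k = is_sectionD[OF T(1)] i T(2) x
  show "h i x \<in> SU2" "intertwines (a i) x (h i x)" using k unfolding hk by blast+
  show "bpst x v = gauge_transform (h i) (a i) x v" for v
    using k unfolding hk fd by blast
  show "h i x = G i j x ** h j x" if "j \<in> I" "x \<in> U j" for j
    using is_sectionD(6)[OF T(1) i that(1) T(2) _ that(2)] T(3) that x T(2) unfolding hk by auto
qed

lemma is_section_subset: "is_section S h \<Longrightarrow> open T \<Longrightarrow> T \<subseteq> S \<Longrightarrow> is_section T h"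
  by (rule is_section_glue) blast+

text \<open>At each point the two values are equal or opposite, that is, at distance 0 or 2 sqrt 2.
  Hence agreement and disagreement are both open conditions, and the cocycle makes them independent
  of the trivialization.\<close>

lemma is_section_agree:
  assumes h: "is_section S h" and k: "is_section T k" and W: "connected W" "W \<subseteq> S \<inter> T"
    and x: "x \<in> W" "x \<in> U i" "i \<in> I" "k i x = h i x"
    and y: "y \<in> W" "y \<in> U j" "j \<in> I"
  shows "k j y = h j y"
proof -
  let ?P = "\<lambda>z. \<exists>i\<in>I. z \<in> U i \<and> k i z = h i z"
  have all: "k j z = h j z" if P: "?P z" and zj: "z \<in> S \<inter> T \<inter> U j" "j \<in> I" for z j
  proof -
    obtain i where i: "i \<in> I" "z \<in> U i" "k i z = h i z" using P by blast
    have "h j z = G j i z ** h i z" "k j z = G j i z ** k i z"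
      using is_sectionD(6)[OF h] is_sectionD(6)[OF k] zj i(1,2) by blast+
    then show ?thesis using i(3) by simp
  qed
  have "?P y"
  proof (rule connected_induction_simple[OF W(1), where P = ?P and a = x and b = y])
    show "?P x" using x by blast
    fix z assume z: "z \<in> W"
    obtain m where m: "m \<in> I" "z \<in> U m" using cover by blast
    have zi: "z \<in> S \<inter> U m" "z \<in> T \<inter> U m" using z W(2) m by auto
    define O' where "O' = S \<inter> T \<inter> U m"
    have O': "open O'" "z \<in> O'"
      using is_sectionD(1)[OF h] is_sectionD(1)[OF k] open_U m zi by (auto simp: O'_def)
    have "smooth_on O' (h m)" "smooth_on O' (k m)"
      unfolding O'_def
      by (rule smooth_on_subset[OF is_sectionD(2)[OF h m(1)]] smooth_on_subset[OF is_sectionD(2)[OF k m(1)]]; blast)+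
    then have "continuous_on O' (\<lambda>z. norm (k m z - h m z))"
      by (intro continuous_intros smooth_on_continuous)
    then have "isCont (\<lambda>z. norm (k m z - h m z)) z"
      using O' continuous_on_eq_continuous_at by blast
    then obtain d where d: "d > 0" "\<And>y. dist y z < d \<Longrightarrow>
        dist (norm (k m y - h m y)) (norm (k m z - h m z)) < 1"
      unfolding continuous_at_eps_delta using zero_less_one by metis
    define N where "N = O' \<inter> ball z d"
    have val: "norm (k m y - h m y) = 0 \<or> norm (k m y - h m y) \<ge> 2" if "y \<in> O'" for y
    proof -
      have s: "h m y \<in> SU2" "k m y \<in> SU2" "intertwines (a m) y (h m y)" "intertwines (a m) y (k m y)"
        using h k m that unfolding is_section_def O'_def by blast+
      have "norm (h m y) = sqrt 2" using s(1) by (auto simp: SU2_quat norm_quat_mat)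
      moreover have "norm (- h m y - h m y) = 2 * norm (h m y)"
        using norm_scaleR[of "-2" "h m y"] by (simp add: scaleR_2)
      ultimately show ?thesis using intertwines_unique_up_to_sign[OF s] by auto
    qed
    show "\<exists>N. openin (top_of_set W) N \<and> z \<in> N \<and> (\<forall>p\<in>N. \<forall>q\<in>N. ?P p \<longrightarrow> ?P q)"
    proof (intro exI conjI ballI impI)
      show "openin (top_of_set W) (W \<inter> N)" unfolding N_def using O'(1) by (intro openin_open_Int) auto
      show "z \<in> W \<inter> N" using z O' d(1) by (simp add: N_def)
      fix p q assume pq: "p \<in> W \<inter> N" "q \<in> W \<inter> N" and "?P p"
      then have "k m p = h m p" using all[OF \<open>?P p\<close>] m W(2) unfolding N_def O'_def by blast
      then have "dist 0 (norm (k m z - h m z)) < 1"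
        using d(2)[of p] pq(1) by (simp add: N_def dist_commute)
      then have "norm (k m z - h m z) = 0" using val[OF O'(2)] by (auto simp: dist_real_def)
      then have "dist (norm (k m q - h m q)) 0 < 1"
        using d(2)[of q] pq(2) by (simp add: N_def dist_commute)
      then have "norm (k m q - h m q) = 0" using val[of q] pq(2) by (auto simp: dist_real_def N_def)
      then show "?P q" using m pq(2) unfolding N_def O'_def by auto
    qed
  qed (use x y in auto)
  then show ?thesis using all[of y j] y W(2) by blast
qed

lemma is_section_sign:
  assumes "is_section S h" "is_section T k" "x \<in> S \<inter> T" "i \<in> I" "x \<in> U i"
  obtains k' where "is_section T k'" "k' i x = h i x"
proof -
  have "h i x \<in> SU2" "k i x \<in> SU2" "intertwines (a i) x (h i x)" "intertwines (a i) x (k i x)"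
    using assms unfolding is_section_def by blast+
  then have "k i x = h i x \<or> k i x = - h i x" by (rule intertwines_unique_up_to_sign)
  then show thesis
    using that[OF assms(2)] that[OF is_section_uminus[OF assms(2)]] by auto
qed

text \<open>After a change of sign the two sections match at one common point, and connectedness
  spreads this over the overlap.\<close>

lemma is_section_union:
  assumes h: "is_section S h" and k: "is_section T k" and W: "connected (S \<inter> T)" "S \<inter> T \<noteq> {}"
  shows "\<exists>l. is_section (S \<union> T) l"
proof -
  obtain x where x: "x \<in> S \<inter> T" using W(2) by blast
  obtain i where i: "i \<in> I" "x \<in> U i" using cover by blast
  obtain k' where k': "is_section T k'" "k' i x = h i x"
    using is_section_sign[OF h k x i] .
  have agree: "k' j y = h j y" if "y \<in> S \<inter> T" "y \<in> U j" "j \<in> I" for j y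
    using is_section_agree[OF h k'(1) W(1) subset_refl x i(2,1) k'(2) that] .
  define l where "l j y = (if y \<in> S then h j y else k' j y)" for j y
  have "is_section (S \<union> T) l"
  proof (rule is_section_glue)
    show "open (S \<union> T)" using is_sectionD(1)[OF h] is_sectionD(1)[OF k] by blast
    fix x assume "x \<in> S \<union> T"
    then show "\<exists>T' k. is_section T' k \<and> x \<in> T' \<and> (\<forall>i\<in>I. \<forall>y\<in>(S \<union> T) \<inter> T' \<inter> U i. l i y = k i y)"
    proof
      assume "x \<in> S" then show ?thesis using h by (intro exI[of _ S] exI[of _ h]) (auto simp: l_def)
    next
      assume "x \<in> T" then show ?thesis
        using k'(1) agree by (intro exI[of _ T] exI[of _ k']) (auto simp: l_def)
    qed
  qed
  then show ?thesis by blast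
qed

text \<open>Path lifting along the segment from the origin to x, by connectedness of the parameter
  interval. Convexity of the domain is part of the invariant because it makes the overlap with the
  next ball connected.\<close>

lemma is_section_near_segment:
  assumes local: "\<And>x. \<exists>T h. is_section T h \<and> x \<in> T"
  shows "\<exists>C h. convex C \<and> 0 \<in> C \<and> x \<in> C \<and> is_section C h"
proof -
  define P where "P t \<longleftrightarrow> (\<exists>C h. convex C \<and> closed_segment 0 (t *\<^sub>R x) \<subseteq> C \<and> is_section C h)" for t :: real
  have ball: "\<exists>d h. d > 0 \<and> is_section (ball z d) h" for z
  proof -
    obtain T h where T: "is_section T h" "z \<in> T" using local by blast
    then obtain d where "d > 0" "ball z d \<subseteq> T"
      using is_sectionD(1)[OF T(1)] open_contains_ball by blast
    then show ?thesis using is_section_subset[OF T(1) open_ball] by blast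
  qed
  have "P 1"
  proof (rule connected_induction_simple[where S = "{0..1::real}" and P = P and a = 0 and b = 1])
    obtain d h where "d > 0" "is_section (ball 0 d) h" using ball by blast
    then show "P 0" unfolding P_def by (intro exI[of _ "ball 0 d"] exI[of _ h]) auto
    fix s :: real assume s: "s \<in> {0..1}"
    obtain d k where d: "d > 0" "is_section (ball (s *\<^sub>R x) d) k" using ball by blast
    let ?N = "{0..1} \<inter> (\<lambda>t. t *\<^sub>R x) -` ball (s *\<^sub>R x) d"
    have "openin (top_of_set {0..1}) ?N"
      by (intro continuous_openin_preimage_gen continuous_intros open_ball)
    moreover have "s \<in> ?N" using s d(1) by simp
    moreover have "P t'" if t: "t \<in> ?N" "t' \<in> ?N" "P t" for t t'
    proof -
      obtain C h where C: "convex C" "closed_segment 0 (t *\<^sub>R x) \<subseteq> C" "is_section C h"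
        using t(3) unfolding P_def by blast
      let ?B = "ball (s *\<^sub>R x) d"
      have tx: "t *\<^sub>R x \<in> C \<inter> ?B" using C(2) t(1) by auto
      have "connected (C \<inter> ?B)" using C(1) by (intro convex_connected convex_Int) auto
      then obtain l where l: "is_section (C \<union> ?B) l"
        using is_section_union[OF C(3) d(2)] tx by blast
      have "closed_segment 0 (t' *\<^sub>R x) \<subseteq> C \<union> ?B"
      proof
        fix z assume "z \<in> closed_segment 0 (t' *\<^sub>R x)"
        then obtain r where r: "0 \<le> r" "r \<le> 1" "z = r *\<^sub>R (t' *\<^sub>R x)" by (auto simp: in_segment)
        define m where "m = r * t'"
        have m: "0 \<le> m" "m \<le> t'" "z = m *\<^sub>R x"
          using r t(2) mult_left_le[of r t'] by (auto simp: m_def mult.commute)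
        show "z \<in> C \<union> ?B"
        proof (cases "m \<le> t")
          case True
          have "z \<in> closed_segment 0 (t *\<^sub>R x)"
          proof (cases "t = 0")
            case True then show ?thesis using m \<open>m \<le> t\<close> by simp
          next
            case False
            then have "z = (m / t) *\<^sub>R (t *\<^sub>R x)" "0 \<le> m / t" "m / t \<le> 1"
              using m True t(1) by auto
            then show ?thesis unfolding in_segment by (intro exI[of _ "m / t"]) simp
          qed
          then show ?thesis using C(2) by blast
        next
          case False
          have "m \<in> closed_segment t t'" using False m by (auto simp: closed_segment_eq_real_ivl)
          then have "m *\<^sub>R x \<in> closed_segment (t *\<^sub>R x) (t' *\<^sub>R x)"
            using closed_segment_linear_image[of "\<lambda>t. t *\<^sub>R x" t t'] by (auto simp: linear_iff scaleR_add_left)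
          moreover have "closed_segment (t *\<^sub>R x) (t' *\<^sub>R x) \<subseteq> ?B"
            using t(1,2) by (intro closed_segment_subset) auto
          ultimately show ?thesis using m(3) by blast
        qed
      qed
      \<comment> \<open>The union need not be convex; a convex neighborhood of the compact segment
        inside it restores the invariant.\<close>
      moreover have "open (C \<union> ?B)" by (rule is_sectionD(1)[OF l])
      ultimately obtain C' where C': "open C'" "convex C'" "closed_segment 0 (t' *\<^sub>R x) \<subseteq> C'" "C' \<subseteq> C \<union> ?B"
        using convex_nbhd[OF compact_segment convex_closed_segment] by metis
      then show "P t'" unfolding P_def using is_section_subset[OF l C'(1,4)] by blast
    qed
    ultimately show "\<exists>N. openin (top_of_set {0..1}) N \<and> s \<in> N \<and> (\<forall>t\<in>N. \<forall>t'\<in>N. P t \<longrightarrow> P t')"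
      by blast
  qed auto
  then show ?thesis unfolding P_def using ends_in_segment by (metis scaleR_one subsetD)
qed

text \<open>This is where four-space being simply connected enters, in the form of star-shapedness.
  All sections are normalized at the origin; two convex domains meet in a convex set containing it,
  so the sections agree on the overlap and may be glued pointwise.\<close>

lemma global_section:
  assumes local: "\<And>x. \<exists>T h. is_section T h \<and> x \<in> T"
  shows "\<exists>h. is_section UNIV h"
proof -
  obtain i where i: "i \<in> I" "0 \<in> U i" using cover by blast
  obtain T0 h0 where h0: "is_section T0 h0" "0 \<in> T0" using local by blast
  have "\<exists>C h. convex C \<and> 0 \<in> C \<and> x \<in> C \<and> is_section C h \<and> h i 0 = h0 i 0" for x
  proof -
    obtain C h where C: "convex C" "0 \<in> C" "x \<in> C" "is_section C h"
      using is_section_near_segment[OF local] by blast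
    then show ?thesis using is_section_sign[OF h0(1) C(4) _ i] h0(2) by (metis IntI)
  qed
  then obtain C h where C: "\<And>x. convex (C x)" "\<And>x. 0 \<in> C x" "\<And>x. x \<in> C x" "\<And>x. is_section (C x) (h x)"
      "\<And>x. h x i 0 = h0 i 0" by metis
  have "is_section UNIV (\<lambda>j y. h y j y)"
  proof (rule is_section_glue)
    fix x :: "real^4"
    have "h y j y = h x j y" if "j \<in> I" "y \<in> C x" "y \<in> U j" for j y
    proof (rule is_section_agree[OF C(4) C(4), of "C x \<inter> C y" x y 0 i y j])
      show "connected (C x \<inter> C y)" using C(1) by (intro convex_connected convex_Int)
    qed (use C that i in auto)
    then show "\<exists>T k. is_section T k \<and> x \<in> T \<and> (\<forall>j\<in>I. \<forall>y\<in>UNIV \<inter> T \<inter> U j. h y j y = k j y)"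
      using C by (intro exI[of _ "C x"] exI[of _ "h x"]) auto
  qed auto
  then show ?thesis by blast
qed

text \<open>The lift found in one trivialization is carried to the others by the transition
  functions; the cocycle rule makes the results compatible.\<close>

lemma local_section:
  assumes ex: "\<And>i x. i \<in> I \<Longrightarrow> x \<in> U i \<Longrightarrow> wt x^4 * sd_norm (a i) x \<le> 96"
      "\<And>i x. i \<in> I \<Longrightarrow> x \<in> U i \<Longrightarrow> sd_norm (a i) x \<noteq> 0"
      "\<And>i x. i \<in> I \<Longrightarrow> x \<in> U i \<Longrightarrow> slap (\<lambda>y. wt y^4 * sd_norm (a i) y) x = 0"
  shows "\<exists>T h. is_section T h \<and> p \<in> T"
proof -
  obtain j where j: "j \<in> I" "p \<in> U j" using cover by blast
  obtain T k where T: "open T" "p \<in> T" "T \<subseteq> U j" "smooth_on T k" "\<And>x. x \<in> T \<Longrightarrow> k x \<in> SU2"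
    "\<And>x. x \<in> T \<Longrightarrow> intertwines (a j) x (k x)"
    "\<And>x v. x \<in> T \<Longrightarrow> bpst x v = gauge_transform k (a j) x v"
    using yang_mills_field.local_gauge[OF ym[OF j(1)] j(2) ex[OF j(1)]] by metis
  define h where "h i x = G i j x ** k x" for i x
  have adj: "mat_adj (M ** N) = mat_adj N ** mat_adj M" for M N
    by (simp add: cmat_eq_iff mat_adj_def cmat_mult_nth mult.commute)
  have "is_section T h"
    unfolding is_section_def
  proof (intro conjI ballI allI impI T(1))
    fix i assume i: "i \<in> I"
    have o: "open (T \<inter> U i)" using T(1) open_U i by blast
    have sG: "smooth_on (T \<inter> U i) (G i j)"
      by (rule smooth_on_subset[OF G_smooth[OF i j(1)]]) (use T(3) in blast)
    have sk: "smooth_on (T \<inter> U i) k" by (rule smooth_on_subset[OF T(4)]) blast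
    show "smooth_on (T \<inter> U i) (h i)"
      unfolding h_def by (intro smooth_on_cmat_mult o sG sk)
    fix x assume x: "x \<in> T \<inter> U i"
    then have xj: "x \<in> U i \<inter> U j" "x \<in> T" using T(3) by auto
    show "h i x \<in> SU2" unfolding h_def using SU2_mult[OF G_SU2[OF i j(1) xj(1)] T(5)[OF xj(2)]] .
    have int: "frame s x ** h i x = h i x ** E"
      if "G i j x ** s' x = s x ** G i j x" "frame s' x ** k x = k x ** E" for s s' E
    proof -
      have "frame s x ** G i j x = G i j x ** frame s' x"
        unfolding frame_def mm.scaleR_left mm.scaleR_right that(1) ..
      then have "frame s x ** h i x = G i j x ** (frame s' x ** k x)"
        unfolding h_def by (simp only: matrix_mul_assoc)
      then show ?thesis unfolding that(2) h_def by (simp only: matrix_mul_assoc)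
    qed
    show "intertwines (a i) x (h i x)"
      using T(6)[OF xj(2)] int[where s = "sd1 (a i)" and s' = "sd1 (a j)", OF sd_trans(1)[OF i j(1) xj(1)]] int[where s = "sd2 (a i)" and s' = "sd2 (a j)", OF sd_trans(2)[OF i j(1) xj(1)]]
        int[where s = "sd3 (a i)" and s' = "sd3 (a j)", OF sd_trans(3)[OF i j(1) xj(1)]]
      unfolding intertwines_def by blast
    have fh: "fd (h i) x v = G i j x ** fd k x v + fd (G i j) x v ** k x" for v
      unfolding h_def
      by (intro fd_bilinear[OF bounded_bilinear_cmat_mult] smooth_on_differentiable[OF sG x]
          smooth_on_differentiable[OF sk x])
    show "bpst x v = gauge_transform (h i) (a i) x v" for v
    proof -
      have "mat_adj (h i x) ** fd (h i) x v
          = mat_adj (k x) ** (mat_adj (G i j x) ** G i j x) ** fd k x v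
            + mat_adj (k x) ** mat_adj (G i j x) ** fd (G i j) x v ** k x"
        unfolding fh h_def adj by (simp add: mm.add_right matrix_mul_assoc)
      also have "\<dots> = mat_adj (k x) ** fd k x v + mat_adj (k x) ** mat_adj (G i j x) ** fd (G i j) x v ** k x"
        by (simp add: SU2_adj(2)[OF G_SU2[OF i j(1) xj(1)]])
      finally show ?thesis
        unfolding T(7)[OF xj(2)] trans[OF i j(1) xj(1)] h_def adj
        by (simp add: mm.add_left mm.add_right matrix_mul_assoc)
    qed
    show "h i x = G i m x ** h m x" if "m \<in> I" "x \<in> U m" for m
      using G_cocycle[OF i that(1) j(1), of x] xj that unfolding h_def by (simp add: matrix_mul_assoc)
  qed
  then show ?thesis using T(2) by blast
qed

theorem gauge_equivalent_bpst:
  assumes bound: "\<And>i x. i \<in> I \<Longrightarrow> x \<in> U i \<Longrightarrow> wt x^4 * sd_norm (a i) x \<le> 96"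
    and nz: "i0 \<in> I" "x0 \<in> U i0" "sd_norm (a i0) x0 \<noteq> 0"
  shows "\<exists>h. is_section UNIV h"
proof -
  obtain M where M: "\<And>i x. i \<in> I \<Longrightarrow> x \<in> U i \<Longrightarrow> wt x^4 * sd_norm (a i) x = M"
    "\<And>i x. i \<in> I \<Longrightarrow> x \<in> U i \<Longrightarrow> slap (\<lambda>y. wt y^4 * sd_norm (a i) y) x = 0"
    using sd_norm_constant[OF bound] by blast
  have "M \<noteq> 0" using M(1)[OF nz(1,2)] nz(3) wt_pos[of x0] by auto
  then have "sd_norm (a i) x \<noteq> 0" if "i \<in> I" "x \<in> U i" for i x
    using M(1)[OF that] by auto
  then show ?thesis
    using global_section local_section bound M(2) by blast
qed

end

section \<open>Stereographic charts\<close>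

context gauge_field
begin

lemma fd_form_add:
  assumes "x \<in> U" shows "fd (\<lambda>y. a y (u + v)) x w = fd (\<lambda>y. a y u) x w + fd (\<lambda>y. a y v) x w"
proof -
  have "fd (\<lambda>y. a y (u + v)) x = fd (\<lambda>y. a y u + a y v) x"
    by (rule fd_cong[OF open_U assms]) (rule linear_add[OF linear_a])
  then show ?thesis by (simp add: fd_add diff_a assms)
qed

lemma fd_form_scaleR:
  assumes "x \<in> U" shows "fd (\<lambda>y. a y (r *\<^sub>R v)) x w = r *\<^sub>R fd (\<lambda>y. a y v) x w"
proof -
  have "fd (\<lambda>y. a y (r *\<^sub>R v)) x = fd (\<lambda>y. r *\<^sub>R a y v) x"
    by (rule fd_cong[OF open_U assms]) (rule linear_scale[OF linear_a])
  then show ?thesis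
    using fd_bounded_linear[OF bounded_linear_scaleR_right[of r] diff_a[OF assms]] by simp
qed

lemma linear_fd_form: "x \<in> U \<Longrightarrow> linear (\<lambda>v. fd (\<lambda>y. a y v) x w)"
  by (rule linearI) (simp_all add: fd_form_add fd_form_scaleR)

lemma linear_fd_a: "x \<in> U \<Longrightarrow> linear (fd (\<lambda>y. a y v) x)"
  using linear_frechet_derivative diff_a by blast

lemma linear_curvature_right: "x \<in> U \<Longrightarrow> linear (curvature a x u)"
proof (rule linearI)
  assume x: "x \<in> U"
  show "curvature a x u (v + w) = curvature a x u v + curvature a x u w" for v w
    unfolding curvature_def
    by (simp add: fd_form_add x linear_add[OF linear_fd_a[OF x]] linear_add[OF linear_a[OF x]] cm.add_right)
  show "curvature a x u (r *\<^sub>R v) = r *\<^sub>R curvature a x u v" for r v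
    unfolding curvature_def
    by (simp add: fd_form_scaleR x linear_scale[OF linear_fd_a[OF x]] linear_scale[OF linear_a[OF x]]
        cm.scaleR_right scaleR_add_right scaleR_diff_right)
qed

lemma linear_curvature_left: "x \<in> U \<Longrightarrow> linear (\<lambda>u. curvature a x u v)"
  using linear_compose_neg[OF linear_curvature_right[of x v]] curvature_swap[of x _ v]
  by simp

lemma curvature_scaleR:
  assumes "x \<in> U" shows "curvature a x (r *\<^sub>R u) (s *\<^sub>R v) = (r * s) *\<^sub>R curvature a x u v"
  using linear_scale[OF linear_curvature_left[OF assms]] linear_scale[OF linear_curvature_right[OF assms]]
  by simp

lemma curvature_minus:
  assumes "x \<in> U"
  shows "curvature a x (- u) v = - curvature a x u v" "curvature a x u (- v) = - curvature a x u v"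
  using linear_neg[OF linear_curvature_left[OF assms]] linear_neg[OF linear_curvature_right[OF assms]]
  by simp_all

lemma curvature_eq_0:
  assumes x: "x \<in> U"
    and "curvature a x (e4 1) (e4 2) = 0" "curvature a x (e4 1) (e4 3) = 0" "curvature a x (e4 1) (e4 4) = 0"
      "curvature a x (e4 3) (e4 4) = 0" "curvature a x (e4 4) (e4 2) = 0" "curvature a x (e4 2) (e4 3) = 0"
  shows "curvature a x u v = 0"
proof -
  have self: "curvature a x (e4 i) (e4 i) = 0" for i by (simp add: curvature_def)
  have ij: "curvature a x (e4 i) (e4 j) = 0" for i j
    using exhaust_4[of i] exhaust_4[of j] assms(2-7) self curvature_swap[of x] by (metis neg_equal_0_iff_equal)
  have "curvature a x (e4 i) = (\<lambda>v. 0)" for i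
    by (rule linear_eq_stdbasis[OF linear_curvature_right[OF x] linear_zero]) (auto simp: Basis_vec_def ij)
  then have "(\<lambda>u. curvature a x u v) = (\<lambda>u. 0)"
    by (intro linear_eq_stdbasis[OF linear_curvature_left[OF x] linear_zero]) (auto simp: Basis_vec_def)
  then show ?thesis by metis
qed

text \<open>The second derivatives of \<psi> enter symmetrically and cancel. In the proof the form
  is expanded in the coordinate basis, because both its base point and its argument vary.\<close>

lemma curvature_pullback:
  fixes \<psi> :: "real^4 \<Rightarrow> real^4"
  assumes S: "open S" "y \<in> S" and \<psi>: "smooth_on S \<psi>" "\<And>z. z \<in> S \<Longrightarrow> \<psi> z \<in> U"
    and a': "\<And>z v. z \<in> S \<Longrightarrow> a' z v = a (\<psi> z) (fd \<psi> z v)"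
  shows "curvature a' y u v = curvature a (\<psi> y) (fd \<psi> y u) (fd \<psi> y v)"
proof -
  have yU: "\<psi> y \<in> U" using \<psi>(2) S(2) .
  have d\<psi>: "\<psi> differentiable at y" using smooth_on_differentiable[OF \<psi>(1) S(2)] .
  have bas: "w = (\<Sum>k\<in>UNIV. (w $ k) *\<^sub>R e4 k)" for w :: "real^4"
    using basis_expansion[of w] by (simp add: scalar_mult_eq_scaleR)
  have 1: "fd (\<lambda>z. a' z v) y u = fd (\<lambda>z. a z (fd \<psi> y v)) (\<psi> y) (fd \<psi> y u)
      + a (\<psi> y) (fd (\<lambda>z. fd \<psi> z v) y u)" for u v
  proof -
    have e: "a' z v = (\<Sum>k\<in>UNIV. (fd \<psi> z v $ k) *\<^sub>R a (\<psi> z) (e4 k))" if "z \<in> S" for z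
    proof -
      have "a' z v = a (\<psi> z) (\<Sum>k\<in>UNIV. (fd \<psi> z v $ k) *\<^sub>R e4 k)"
        using a'[OF that] bas by metis
      then show ?thesis
        by (simp add: linear_sum[OF linear_a[OF \<psi>(2)[OF that]]] linear_scale[OF linear_a[OF \<psi>(2)[OF that]]])
    qed
    have d2: "(\<lambda>z. fd \<psi> z v) differentiable at y"
      using smooth_on_differentiable[OF smooth_on_fd[OF \<psi>(1)] S(2)] .
    have tm: "((\<lambda>z. (fd \<psi> z v $ k) *\<^sub>R a (\<psi> z) (e4 k)) has_derivative
        (\<lambda>u. (fd \<psi> y v $ k) *\<^sub>R fd (\<lambda>z. a z (e4 k)) (\<psi> y) (fd \<psi> y u)
          + (fd (\<lambda>z. fd \<psi> z v) y u $ k) *\<^sub>R a (\<psi> y) (e4 k))) (at y)" for k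
    proof (rule has_derivative_scaleR)
      show "((\<lambda>z. fd \<psi> z v $ k) has_derivative (\<lambda>u. fd (\<lambda>z. fd \<psi> z v) y u $ k)) (at y)"
        by (rule bounded_linear.has_derivative[OF bounded_linear_vec_nth differentiable_fd[OF d2]])
      show "((\<lambda>z. a (\<psi> z) (e4 k)) has_derivative (\<lambda>u. fd (\<lambda>z. a z (e4 k)) (\<psi> y) (fd \<psi> y u))) (at y)"
        using diff_chain_at[OF differentiable_fd[OF d\<psi>] differentiable_fd[OF diff_a[OF yU]]]
        by (simp add: o_def)
    qed
    have "fd (\<lambda>z. a' z v) y u = fd (\<lambda>z. \<Sum>k\<in>UNIV. (fd \<psi> z v $ k) *\<^sub>R a (\<psi> z) (e4 k)) y u"
      by (rule fun_cong[OF fd_cong[OF S]]) (rule e)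
    also have "\<dots> = (\<Sum>k\<in>UNIV. (fd \<psi> y v $ k) *\<^sub>R fd (\<lambda>z. a z (e4 k)) (\<psi> y) (fd \<psi> y u)
          + (fd (\<lambda>z. fd \<psi> z v) y u $ k) *\<^sub>R a (\<psi> y) (e4 k))"
    proof -
      have "((\<lambda>z. \<Sum>k\<in>UNIV. (fd \<psi> z v $ k) *\<^sub>R a (\<psi> z) (e4 k)) has_derivative
          (\<lambda>u. \<Sum>k\<in>UNIV. (fd \<psi> y v $ k) *\<^sub>R fd (\<lambda>z. a z (e4 k)) (\<psi> y) (fd \<psi> y u)
            + (fd (\<lambda>z. fd \<psi> z v) y u $ k) *\<^sub>R a (\<psi> y) (e4 k))) (at y)"
        by (rule has_derivative_sum) (rule tm)
      from fd_eq[OF this] show ?thesis by simp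
    qed
    also have "\<dots> = fd (\<lambda>z. a z (\<Sum>k\<in>UNIV. (fd \<psi> y v $ k) *\<^sub>R e4 k)) (\<psi> y) (fd \<psi> y u)
        + a (\<psi> y) (\<Sum>k\<in>UNIV. (fd (\<lambda>z. fd \<psi> z v) y u $ k) *\<^sub>R e4 k)"
      by (simp add: sum.distrib linear_sum[OF linear_a[OF yU]] linear_scale[OF linear_a[OF yU]]
          linear_sum[OF linear_fd_form[OF yU]] linear_scale[OF linear_fd_form[OF yU]])
    finally show ?thesis unfolding bas[symmetric] .
  qed
  have 2: "fd (\<lambda>z. fd \<psi> z v) y u = fd (\<lambda>z. fd \<psi> z u) y v" by (rule fd_commute[OF S \<psi>(1)])
  show ?thesis unfolding curvature_def 1 2 a'[OF S(2)] by simp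
qed

end

section \<open>The curvature norm and conformal invariance\<close>

lemma so4_inner_su2:
  assumes "X \<in> su2" shows "so4_inner c (realify X) (realify X) = 2 * c * (X \<bullet> X)"
proof -
  obtain x where x: "x$1 = 0" "X = quat_mat x" using assms by (rule su2E)
  have n: "realify X $ i $ j = to_R4 (quat_mat x *v to_C2 (e4 j)) $ i" for i j
    by (simp add: realify_def matrix_def x(2))
  have cols: "to_R4 (quat_mat x *v to_C2 (e4 1)) = vector [x$1, x$2, - x$3, x$4]"
    "to_R4 (quat_mat x *v to_C2 (e4 2)) = vector [- x$2, x$1, - x$4, - x$3]"
    "to_R4 (quat_mat x *v to_C2 (e4 3)) = vector [x$3, x$4, x$1, - x$2]"
    "to_R4 (quat_mat x *v to_C2 (e4 4)) = vector [- x$4, x$3, x$2, x$1]"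
    by (simp_all add: real4_eq_iff to_R4_def to_C2_def matrix_vector_mult_def sum_2 quat_mat_nth axis_def)
  \<comment> \<open>A unit imaginary quaternion acts on four-space as a square root of -1, so the
    trace of its square is -4, while its squared matrix norm is 2.\<close>
  have "trace (realify X ** realify X) = - 4 * (x \<bullet> x)"
    unfolding trace_def matrix_matrix_mult_def
    by (simp add: sum_4 n cols x(1) inner_real4)
  then show ?thesis by (simp add: so4_inner_def x(2) quat_mat_inner)
qed

text \<open>Passing to the full double sum avoids enumerating the pairs i < j in the unusual order
  of the type \<open>4\<close>.\<close>

lemma sum_ordered_pairs:
  fixes f :: "'a::{finite, linorder} \<Rightarrow> 'a \<Rightarrow> real"
  assumes "\<And>i j. f i j = f j i" "\<And>i. f i i = 0"
  shows "(\<Sum>i\<in>UNIV. \<Sum>j\<in>UNIV. f i j) = 2 * (\<Sum>(i, j)\<in>{(i, j). i < j}. f i j)"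
proof -
  let ?L = "{(i, j). i < j} :: ('a \<times> 'a) set"
  have "(\<Sum>i\<in>UNIV. \<Sum>j\<in>UNIV. f i j) = (\<Sum>(i, j)\<in>UNIV. f i j)"
    by (simp add: sum.cartesian_product)
  also have "\<dots> = (\<Sum>(i, j)\<in>?L \<union> prod.swap ` ?L. f i j)"
    by (rule sum.mono_neutral_right) (use assms(2) in \<open>force simp: not_less_iff_gr_or_eq image_iff\<close>)+
  also have "\<dots> = (\<Sum>(i, j)\<in>?L. f i j) + (\<Sum>(i, j)\<in>prod.swap ` ?L. f i j)"
    by (rule sum.union_disjoint) auto
  also have "(\<Sum>(i, j)\<in>prod.swap ` ?L. f i j) = (\<Sum>(i, j)\<in>?L. f i j)"
    by (subst sum.reindex) (auto intro!: sum.cong assms(1) simp: inj_on_def)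
  finally show ?thesis by simp
qed

context gauge_field
begin

lemma curvature_norm_bound:
  assumes x: "x \<in> U" and c: "c > 0" and le: "curvature_norm c a x \<le> 4 / gamma_const c"
  shows "wt x^4 * sd_norm a x \<le> 96"
proof -
  define n where "n i j = curvature a x (e4 i) (e4 j) \<bullet> curvature a x (e4 i) (e4 j)" for i j
  \<comment> \<open>The frame orthonormal for the round metric contributes (w / 2)^4, and
    \<open>so4_inner_su2\<close> contributes 2 c.\<close>
  define k where "k = wt x^4 / 8 * c"
  let ?S = "n 1 2 + n 1 3 + n 1 4 + n 3 4 + n 4 2 + n 2 3"
  have k: "k > 0" using c zero_less_power[OF wt_pos, of x 4] by (simp add: k_def)
  have "so4_inner c (realify (curvature a x (round_frame x i) (round_frame x j)))
      (realify (curvature a x (round_frame x i) (round_frame x j))) = k * n i j" for i j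
  proof -
    have "curvature a x (round_frame x i) (round_frame x j) = (wt x / 2 * (wt x / 2)) *\<^sub>R curvature a x (e4 i) (e4 j)"
      unfolding round_frame_def by (rule curvature_scaleR[OF x])
    then show ?thesis
      unfolding so4_inner_su2[OF curvature_su2[OF x]]
      by (simp add: k_def n_def power4_eq_xxxx)
  qed
  then have cn: "curvature_norm c a x = sqrt (\<Sum>(i, j)\<in>{(i, j). i < j}. k * n i j)"
    unfolding curvature_norm_def by (simp cong: sum.cong)
  have n: "n i j = n j i" "n i i = 0" for i j
    unfolding n_def using curvature_swap[of x "e4 i" "e4 j"] by (simp_all add: curvature_def[of a x "e4 i" "e4 i"])
  have "sqrt (\<Sum>(i, j)\<in>{(i, j). i < j}. k * n i j) \<le> sqrt (6 * c)"
    using le c unfolding cn gamma_const_def by simp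
  then have "(\<Sum>(i, j)\<in>{(i, j). i < j}. k * n i j) \<le> 6 * c" by simp
  moreover have "(\<Sum>i\<in>UNIV. \<Sum>j\<in>UNIV. k * n i j) = 2 * (\<Sum>(i, j)\<in>{(i, j). i < j}. k * n i j)"
    by (rule sum_ordered_pairs) (use n in auto)
  ultimately have "(\<Sum>i\<in>UNIV. \<Sum>j\<in>UNIV. k * n i j) \<le> 12 * c" by simp
  then have "k * ?S \<le> 6 * c"
    unfolding sum_4 by (simp add: n(2) n(1)[of 2 1] n(1)[of 3 1] n(1)[of 4 1] n(1)[of 4 3] n(1)[of 2 4] n(1)[of 3 2] algebra_simps)
  then have S48: "wt x^4 * ?S \<le> 48"
  proof -
    assume "k * ?S \<le> 6 * c"
    moreover have "k * ?S = c * (wt x^4 * ?S) / 8" unfolding k_def by simp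
    ultimately have "c * (wt x^4 * ?S) \<le> c * 48" by linarith
    then show ?thesis using c by (simp only: mult_le_cancel_left_pos)
  qed
  \<comment> \<open>What is given up here is the squared norm of X - Y, that is, the anti-self-dual
    part.\<close>
  have par: "(X + Y) \<bullet> (X + Y) \<le> 2 * (X \<bullet> X) + 2 * (Y \<bullet> Y)" for X Y :: cmat2
    using inner_ge_zero[of "X - Y"] by (simp add: inner_add inner_diff inner_commute)
  have "sd_norm a x \<le> 2 * ?S"
    unfolding sd_norm_def sd1_def sd2_def sd3_def n_def
    using par[of "curvature a x (e4 1) (e4 2)" "curvature a x (e4 3) (e4 4)"]
      par[of "curvature a x (e4 1) (e4 3)" "curvature a x (e4 4) (e4 2)"]
      par[of "curvature a x (e4 1) (e4 4)" "curvature a x (e4 2) (e4 3)"] by simp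
  then have "wt x^4 * sd_norm a x \<le> wt x^4 * (2 * ?S)"
    by (intro mult_left_mono) auto
  also have "\<dots> = 2 * (wt x^4 * ?S)"
    by (rule mult.left_commute)
  finally show ?thesis using S48 by linarith
qed

end

text \<open>For k times the identity in dimension four, the square root of the determinant is k^2
  and raising two indices costs k^-2. The weights cancel before the derivative is taken.\<close>

lemma yang_mills_conformal:
  assumes "\<And>w. codiff_curvature round_metric a x w = 0"
  shows "(\<Sum>i\<in>UNIV. cov_deriv a (\<lambda>y. curvature a y (e4 i) (e4 j)) x (e4 i)) = 0"
proof -
  define k where "k y = 4 / (wt y)\<^sup>2" for y :: "real^4"
  have k: "k y > 0" for y using wt_pos[of y] by (simp add: k_def)
  have G: "round_metric y = mat (k y)" for y by (simp add: round_metric_def k_def)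
  have "mat r ** mat s = (mat (r * s) :: real^4^4)" for r s
    by (simp add: vec_eq_iff forall_4 matrix_matrix_mult_def sum_4 mat_def)
  then have inv: "matrix_inv (round_metric y) = mat (1 / k y)" for y
    unfolding G using k[of y] by (intro matrix_inv_eq) simp_all
  have det: "sqrt (det (round_metric y)) = (k y)\<^sup>2" for y
  proof -
    have "det (round_metric y) = (\<Prod>i\<in>UNIV. round_metric y $ i $ i)"
      by (rule det_diagonal) (simp add: G mat_def)
    also have "\<dots> = k y ^ 4" by (simp add: G mat_def)
    finally show ?thesis using k[of y] by (simp add: real_sqrt_unique flip: power_mult)
  qed
  have delta: "(\<Sum>m\<in>UNIV. \<Sum>l\<in>UNIV. (if m = i then if l = j then h m l else 0 else 0)) = h i j"
    for i j :: 4 and h :: "4 \<Rightarrow> 4 \<Rightarrow> cmat2"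
  proof -
    have "(\<Sum>l\<in>UNIV. (if m = i then if l = j then h m l else 0 else 0)) = (if m = i then h m j else 0)" for m
      by (cases "m = i") simp_all
    then show ?thesis by simp
  qed
  have raised: "sqrt (det (round_metric y)) *\<^sub>R curvature_raised round_metric a i j y = curvature a y (e4 i) (e4 j)" for y i j
  proof -
    have "curvature_raised round_metric a i j y = (\<Sum>m\<in>UNIV. \<Sum>l\<in>UNIV.
        (if m = i then if l = j then (1 / k y * (1 / k y)) *\<^sub>R curvature a y (e4 m) (e4 l) else 0 else 0))"
      unfolding curvature_raised_def inv by (intro sum.cong refl) (simp add: mat_def)
    also have "\<dots> = (1 / k y * (1 / k y)) *\<^sub>R curvature a y (e4 i) (e4 j)"
      by (rule delta)
    finally show ?thesis using k[of y] by (simp add: det power2_eq_square)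
  qed
  define W where "W j = (\<Sum>i\<in>UNIV. cov_deriv a (\<lambda>y. curvature a y (e4 i) (e4 j)) x (e4 i))" for j
  have "codiff_curvature round_metric a x (e4 j) = (\<Sum>m\<in>UNIV. \<Sum>l\<in>UNIV.
      (if m = j then if l = j then k x *\<^sub>R (- (1 / (k x)\<^sup>2) *\<^sub>R W l) else 0 else 0))"
    unfolding codiff_curvature_def raised W_def[symmetric]
    by (intro sum.cong refl) (simp only: det, simp add: mat_def axis_def G)
  also have "\<dots> = k x *\<^sub>R (- (1 / (k x)\<^sup>2) *\<^sub>R W j)"
    by (rule delta)
  finally have "W j = 0" using assms k[of x] by simp
  then show ?thesis by (simp add: W_def)
qed

section \<open>Stereographic projection and its inverse\<close>

lemma stereo_frameD:
  assumes "stereo_frame p L"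
  shows "norm p = 1" "linear L" "norm (L x) = norm x" "p \<bullet> L x = 0" "L x \<bullet> L y = x \<bullet> y"
proof -
  show 1: "norm p = 1" "linear L" "norm (L x) = norm x" "p \<bullet> L x = 0" for x
    using assms by (auto simp: stereo_frame_def S4_def tangent_S4_def)
  show "L x \<bullet> L y = x \<bullet> y"
    unfolding dot_norm[of "L x"] dot_norm[of x] by (simp add: 1(3) flip: linear_add[OF 1(2)])
qed

text \<open>\<open>adjoint L\<close> annihilates p and inverts L on the hyperplane orthogonal to p.
  At the pole itself the division by zero yields the value 0.\<close>

definition stereo :: "real^5 \<Rightarrow> (real^4 \<Rightarrow> real^5) \<Rightarrow> real^5 \<Rightarrow> real^4" where
  "stereo p L q = (1 / (1 - q \<bullet> p)) *\<^sub>R adjoint L q"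

context
  fixes p :: "real^5" and L :: "real^4 \<Rightarrow> real^5"
  assumes fr: "stereo_frame p L"
begin

lemma smooth_inv_stereo: "open S \<Longrightarrow> smooth_on S (inv_stereo p L)"
proof -
  assume S: "open S"
  have bl: "bounded_linear L" using stereo_frameD(2)[OF fr] linear_conv_bounded_linear by blast
  have wp: "wt x \<noteq> 0" for x :: "real^4" using wt_pos[of x] by linarith
  have "smooth_on S (\<lambda>x. inverse (wt x) *\<^sub>R (2 *\<^sub>R L x + ((norm x)\<^sup>2 - 1) *\<^sub>R p))"
    by (intro smooth_on_scaleR smooth_on_inverse smooth_on_add smooth_on_diff smooth_on_const smooth_on_norm_sq
        smooth_on_ident smooth_on_linear[OF bl] smooth_wt S wp)
  then show ?thesis unfolding inv_stereo_def[abs_def] by (simp add: inverse_eq_divide)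
qed

lemma norm_inv_stereo: "norm (inv_stereo p L x) = 1"
proof -
  have sq: "(norm (2 *\<^sub>R L x + t *\<^sub>R p))\<^sup>2 = 4 * (norm x)\<^sup>2 + t\<^sup>2" for t
    using stereo_frameD(1,4,5)[OF fr] unfolding power2_norm_eq_inner
    by (simp add: inner_add inner_commute[of "L x" p] norm_eq_1 power2_eq_square)
  have "(norm (2 *\<^sub>R L x + ((norm x)\<^sup>2 - 1) *\<^sub>R p))\<^sup>2 = (wt x)\<^sup>2"
    unfolding sq by (simp add: power2_eq_square algebra_simps)
  then have "norm (2 *\<^sub>R L x + ((norm x)\<^sup>2 - 1) *\<^sub>R p) = wt x"
    by (rule power2_eq_imp_eq) (auto simp: add_nonneg_nonneg)
  then show ?thesis using wt_pos[of x] by (simp add: inv_stereo_def)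
qed

lemma inv_stereo_S4: "inv_stereo p L x \<in> S4"
  using norm_inv_stereo by (simp add: S4_def)

lemma fd_inv_stereo_tangent: "fd (inv_stereo p L) x v \<in> tangent_S4 (inv_stereo p L x)"
proof -
  have d: "inv_stereo p L differentiable at x"
    using smooth_on_differentiable[OF smooth_inv_stereo[OF open_UNIV]] by blast
  have "(\<lambda>x. inv_stereo p L x \<bullet> inv_stereo p L x) = (\<lambda>x. 1)"
    using norm_inv_stereo by (simp add: norm_eq_1)
  then show ?thesis
    using fd_bilinear[OF bounded_bilinear_inner d d, of v] by (simp add: tangent_S4_def inner_commute)
qed

lemma inv_stereo_inner_pole: "inv_stereo p L x \<bullet> p = 1 - 2 / wt x"
proof -
  have t: "(2 *\<^sub>R L x + t *\<^sub>R p) \<bullet> p = t" for t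
    using stereo_frameD(1,4)[OF fr] by (simp add: inner_add inner_commute[of "L x" p] norm_eq_1)
  show ?thesis
    unfolding inv_stereo_def inner_scaleR_left t using wt_pos[of x] by (simp add: field_simps)
qed

lemma inj_inv_stereo: "inj (inv_stereo p L)"
proof (rule injI)
  fix x y assume e: "inv_stereo p L x = inv_stereo p L y"
  then have "2 / wt x = 2 / wt y" using inv_stereo_inner_pole[of x] inv_stereo_inner_pole[of y] by simp
  then have w: "(norm x)\<^sup>2 = (norm y)\<^sup>2" using wt_pos[of x] wt_pos[of y] by (simp add: frac_eq_eq)
  then have "L x = L y" using e wt_pos[of y] by (simp add: inv_stereo_def)
  then have "norm (L (x - y)) = 0" by (simp add: linear_diff[OF stereo_frameD(2)[OF fr]])
  then show "x = y" using stereo_frameD(3)[OF fr] by simp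
qed

text \<open>By dimension count L maps onto the hyperplane orthogonal to p, so q = L z + s p with s =
  q \<bullet> p. The rest is the one-variable computation with |z|^2 = (1 - s) (1 + s).\<close>

lemma inv_stereo_stereo:
  assumes "norm q = 1" "q \<bullet> p \<noteq> 1"
  shows "inv_stereo p L (stereo p L q) = q"
proof -
  note f = stereo_frameD[OF fr]
  define s where "s = q \<bullet> p"
  have qq: "q \<bullet> q = 1" "p \<bullet> p = 1" using assms(1) f(1) by (simp_all add: norm_eq_1)
  have "inj L"
  proof (rule injI)
    fix x y assume "L x = L y"
    then have "norm (L (x - y)) = 0" by (simp add: linear_diff[OF f(2)])
    then show "x = y" by (simp add: f(3))
  qed
  then have "dim (range L) = DIM(real^4)"
    using dim_image_eq[OF f(2), of UNIV] by simp
  moreover have "dim {v. p \<bullet> v = 0} = DIM(real^5) - 1"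
    by (rule dim_hyperplane) (use f(1) in auto)
  ultimately have "range L = {v. p \<bullet> v = 0}"
    by (intro subspace_dim_equal linear_subspace_image f(2) subspace_UNIV subspace_hyperplane)
      (auto simp: f(4))
  moreover have "p \<bullet> (q - s *\<^sub>R p) = 0" by (simp add: inner_diff_right qq s_def inner_commute)
  ultimately obtain z where z: "q - s *\<^sub>R p = L z" by blast
  have "adjoint L q = z"
  proof (rule vector_eq_rdot[THEN iffD1], rule allI)
    fix y
    have "y \<bullet> adjoint L q = L y \<bullet> q" by (rule adjoint_works[OF f(2)])
    also have "\<dots> = L y \<bullet> (L z + s *\<^sub>R p)" by (simp flip: z)
    also have "\<dots> = y \<bullet> z" by (simp add: inner_add_right f(5) inner_commute[of "L y" p] f(4))
    finally show "adjoint L q \<bullet> y = z \<bullet> y" by (simp add: inner_commute)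
  qed
  then have st: "stereo p L q = (1 / (1 - s)) *\<^sub>R z" by (simp add: stereo_def s_def)
  have s1: "1 - s \<noteq> 0" using assms(2) by (simp add: s_def)
  have "z \<bullet> z = (q - s *\<^sub>R p) \<bullet> (q - s *\<^sub>R p)" unfolding z f(5) ..
  also have "\<dots> = (1 - s) * (1 + s)"
    by (simp add: inner_diff inner_commute[of p q] qq flip: s_def) (simp add: algebra_simps)
  finally have zz: "z \<bullet> z = (1 - s) * (1 + s)" .
  have n: "(norm (stereo p L q))\<^sup>2 = (1 + s) / (1 - s)"
    unfolding st power2_norm_eq_inner using s1 by (simp add: zz divide_simps)
  have w: "wt (stereo p L q) = 2 / (1 - s)" "(norm (stereo p L q))\<^sup>2 - 1 = 2 * s / (1 - s)"
    unfolding n using s1 by (simp_all add: field_simps)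
  have "inv_stereo p L (stereo p L q) = ((1 - s) / 2) *\<^sub>R ((2 / (1 - s)) *\<^sub>R (q - s *\<^sub>R p) + (2 * s / (1 - s)) *\<^sub>R p)"
    unfolding inv_stereo_def w by (simp add: st linear_scale[OF f(2)] z)
  also have "\<dots> = q - s *\<^sub>R p + s *\<^sub>R p"
  proof -
    have "(1 - s) / 2 * (2 / (1 - s)) = 1" "(1 - s) / 2 * (2 * s / (1 - s)) = s"
      using s1 by simp_all
    then show ?thesis by (simp only: scaleR_add_right scaleR_scaleR scaleR_one)
  qed
  finally show ?thesis by simp
qed

end

lemma smooth_stereo_compose:
  assumes "stereo_frame p L" "open S" "smooth_on S f" "\<And>x. x \<in> S \<Longrightarrow> f x \<bullet> p \<noteq> 1"
  shows "smooth_on S (\<lambda>x. stereo p L (f x))"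
proof -
  have "bounded_linear (adjoint L)"
    using adjoint_linear[OF stereo_frameD(2)[OF assms(1)]] linear_conv_bounded_linear by blast
  then have 1: "smooth_on S (\<lambda>x. adjoint L (f x))"
    using smooth_on_bounded_linear[OF assms(2) _ assms(3)] by blast
  have 2: "smooth_on S (\<lambda>x. 1 - f x \<bullet> p)"
    by (rule smooth_on_diff[OF assms(2) smooth_on_const smooth_on_inner[OF assms(2,3) smooth_on_const]])
  have 3: "smooth_on S (\<lambda>x. inverse (1 - f x \<bullet> p))"
    by (rule smooth_on_inverse[OF assms(2) 2]) (use assms(4) in force)
  have "smooth_on S (\<lambda>x. inverse (1 - f x \<bullet> p) *\<^sub>R adjoint L (f x))"
    by (rule smooth_on_scaleR[OF assms(2) 3 1])
  then show ?thesis by (simp add: stereo_def inverse_eq_divide)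
qed

section \<open>Quaternionic conjugation as an orientation-reversing isometry\<close>

lemma qcnj_qcnj [simp]: "qcnj (qcnj x) = x"
  by (simp add: real4_eq_iff qcnj_nth)

lemma norm_qcnj [simp]: "norm (qcnj x) = norm x"
  by (simp add: norm_eq_sqrt_inner inner_real4 qcnj_nth)

lemma linear_qcnj: "linear qcnj"
  by (rule linearI) (simp_all add: real4_eq_iff qcnj_nth)

lemma bounded_linear_qcnj: "bounded_linear qcnj"
  using linear_qcnj linear_conv_bounded_linear by blast

lemma fd_qcnj: "fd qcnj x = qcnj"
  by (rule fd_eq) (rule bounded_linear_imp_has_derivative[OF bounded_linear_qcnj])

lemma anti_bpst_qcnj: "anti_bpst x v = bpst (qcnj x) (qcnj v)"
  by (simp add: anti_bpst_def bpst_def)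

text \<open>A frame L may have either orientation, so the reflected chart is again admissible; in it
  the anti-self-dual part of the curvature becomes the self-dual one.\<close>

lemma stereo_frame_qcnj:
  assumes "stereo_frame p L" shows "stereo_frame p (\<lambda>x. L (qcnj x))"
  using assms linear_compose[OF linear_qcnj, of L] by (simp add: stereo_frame_def o_def)

lemma inv_stereo_qcnj: "inv_stereo p (\<lambda>x. L (qcnj x)) x = inv_stereo p L (qcnj x)"
  by (simp add: inv_stereo_def)

section \<open>The connection on the sphere in stereographic charts\<close>

context su2_connection
begin

abbreviation chart :: "real^5 \<Rightarrow> (real^4 \<Rightarrow> real^5) \<Rightarrow> 'i \<Rightarrow> (real^4) set" where
  "chart p L i \<equiv> inv_stereo p L -` V i"

abbreviation form :: "real^5 \<Rightarrow> (real^4 \<Rightarrow> real^5) \<Rightarrow> 'i \<Rightarrow> real^4 \<Rightarrow> real^4 \<Rightarrow> cmat2" where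
  "form p L i \<equiv> pullback (inv_stereo p L) (A i)"

lemma open_chart:
  assumes "stereo_frame p L" "i \<in> I" shows "open (chart p L i)"
proof -
  obtain O' where O': "open O'" "V i = S4 \<inter> O'"
    using open_cover[OF assms(2)] by (auto simp: openin_open)
  then have "chart p L i = inv_stereo p L -` O'" using inv_stereo_S4[OF assms(1)] by auto
  then show ?thesis
    using O'(1) smooth_on_continuous[OF smooth_inv_stereo[OF assms(1) open_UNIV]]
    by (simp add: open_vimage)
qed

lemma differentiable_inv_stereo: "stereo_frame p L \<Longrightarrow> inv_stereo p L differentiable at x"
  using smooth_on_differentiable[OF smooth_inv_stereo[OF _ open_UNIV]] by blast

lemma gauge_field_chart:
  assumes fr: "stereo_frame p L" and i: "i \<in> I"
  shows "gauge_field (chart p L i) (form p L i)"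
proof (rule gauge_field.intro)
  show "open (chart p L i)" by (rule open_chart[OF assms])
  show "smooth_on (chart p L i) (\<lambda>x. form p L i x v)" for v by (rule form_smooth[OF i fr])
  fix x assume x: "x \<in> chart p L i"
  have t: "fd (inv_stereo p L) x v \<in> tangent_S4 (inv_stereo p L x)" for v
    by (rule fd_inv_stereo_tangent[OF fr])
  have l: "linear (fd (inv_stereo p L) x)"
    using linear_frechet_derivative differentiable_inv_stereo[OF fr] by blast
  show "form p L i x v \<in> su2" for v
    unfolding pullback_def using form_su2[OF i _ t] x by simp
  show "linear (form p L i x)"
    by (rule linearI)
      (use x in \<open>simp_all add: pullback_def linear_add[OF l] linear_scale[OF l] form_add[OF i _ t t] form_scaleR[OF i _ t]\<close>)
qed

lemma r4_connection_chart:
  assumes fr: "stereo_frame p L" and "yang_mills"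
  shows "r4_connection I (chart p L) (\<lambda>i j x. g i j (inv_stereo p L x)) (form p L)"
proof (rule r4_connection.intro)
  show "\<exists>i\<in>I. x \<in> chart p L i" for x using cover inv_stereo_S4[OF fr, of x] by auto
  fix i assume i: "i \<in> I"
  show "yang_mills_field (chart p L i) (form p L i)"
  proof (rule yang_mills_field.intro[OF gauge_field_chart[OF fr i]], unfold_locales)
    fix x j assume "x \<in> chart p L i"
    then show "(\<Sum>k\<in>UNIV. cov_deriv (form p L i) (\<lambda>y. curvature (form p L i) y (e4 k) (e4 j)) x (e4 k)) = 0"
      using assms(2) i fr unfolding yang_mills_def by (intro yang_mills_conformal) auto
  qed
  fix j assume j: "j \<in> I"
  show "smooth_on (chart p L i \<inter> chart p L j) (\<lambda>x. g i j (inv_stereo p L x))"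
    using transition_smooth[OF i j fr] by (simp add: vimage_Int)
  fix x assume x: "x \<in> chart p L i \<inter> chart p L j"
  then have SU: "g i j (inv_stereo p L x) \<in> SU2" using transition_SU2[OF i j] by auto
  show "form p L j x w = mat_adj (g i j (inv_stereo p L x)) ** form p L i x w ** g i j (inv_stereo p L x)
      + mat_adj (g i j (inv_stereo p L x)) ** fd (\<lambda>x. g i j (inv_stereo p L x)) x w" for w
    using form_transition[OF i j fr, of x w] x unfolding SU2_adj(3)[OF SU] by simp
qed (use transition_SU2 transition_cocycle in auto)

lemma gauge_equiv_bpst:
  assumes fr: "stereo_frame p L" and "yang_mills" and c: "c > 0"
    and bound: "curvature_Linf c \<le> ereal (4 / gamma_const c)"
    and nz: "i \<in> I" "x \<in> chart p L i" "sd_norm (form p L i) x \<noteq> 0"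
  shows "gauge_equiv_stereo p L bpst"
proof -
  interpret R: r4_connection I "chart p L" "\<lambda>i j x. g i j (inv_stereo p L x)" "form p L"
    by (rule r4_connection_chart[OF assms(1,2)])
  have "wt y^4 * sd_norm (form p L j) y \<le> 96" if "j \<in> I" "y \<in> chart p L j" for j y
  proof (rule gauge_field.curvature_norm_bound[OF gauge_field_chart[OF fr that(1)] that(2) c])
    have "ereal (curvature_norm c (form p L j) y) \<le> curvature_Linf c"
      unfolding curvature_Linf_def using that fr by (intro Sup_upper) auto
    then show "curvature_norm c (form p L j) y \<le> 4 / gamma_const c"
      using bound order_trans by fastforce
  qed
  then obtain h where h: "R.is_section UNIV h"
    using R.gauge_equivalent_bpst[OF _ nz] by blast
  show ?thesis
    unfolding gauge_equiv_stereo_def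
  proof (intro exI[of _ h] conjI ballI allI impI)
    show "smooth_on (chart p L j) (h j)" if "j \<in> I" for j
      using R.is_sectionD(2)[OF h that] by simp
    show SU: "h j y \<in> SU2" if "j \<in> I" "inv_stereo p L y \<in> V j" for j y
      using R.is_sectionD(3)[OF h that(1)] that(2) by simp
    show "h j y = g j k (inv_stereo p L y) ** h k y"
      if "j \<in> I" "k \<in> I" "inv_stereo p L y \<in> V j \<inter> V k" for j k y
      using R.is_sectionD(6)[OF h that(1,2)] that(3) by simp
    show "bpst y v = matrix_inv (h j y) ** form p L j y v ** h j y + matrix_inv (h j y) ** fd (h j) y v"
      if "j \<in> I" "inv_stereo p L y \<in> V j" for j y v
      unfolding SU2_adj(3)[OF SU[OF that]]
      using R.is_sectionD(5)[OF h that(1), of y v] that(2) by simp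
  qed
qed

lemma form_qcnj:
  assumes "stereo_frame p L"
  shows "form p (\<lambda>x. L (qcnj x)) i y v = form p L i (qcnj y) (qcnj v)"
proof -
  have "inv_stereo p (\<lambda>x. L (qcnj x)) = (\<lambda>x. inv_stereo p L (qcnj x))"
    by (rule ext) (rule inv_stereo_qcnj)
  moreover have "fd (\<lambda>x. inv_stereo p L (qcnj x)) y v = fd (inv_stereo p L) (qcnj y) (qcnj v)"
    using fd_compose[OF bounded_linear_imp_differentiable[OF bounded_linear_qcnj] differentiable_inv_stereo[OF assms]]
    by (simp add: fd_qcnj)
  ultimately show ?thesis by (simp add: pullback_def)
qed

lemma gauge_equiv_anti_bpst:
  assumes fr: "stereo_frame p L" and "gauge_equiv_stereo p (\<lambda>x. L (qcnj x)) bpst"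
  shows "gauge_equiv_stereo p L anti_bpst"
proof -
  let ?L = "\<lambda>x. L (qcnj x)"
  obtain h where h: "\<And>i. i \<in> I \<Longrightarrow> smooth_on (chart p ?L i) (h i)"
    "\<And>i x. i \<in> I \<Longrightarrow> inv_stereo p ?L x \<in> V i \<Longrightarrow> h i x \<in> SU2"
    "\<And>i j x. i \<in> I \<Longrightarrow> j \<in> I \<Longrightarrow> inv_stereo p ?L x \<in> V i \<inter> V j \<Longrightarrow> h i x = g i j (inv_stereo p ?L x) ** h j x"
    "\<And>i x v. i \<in> I \<Longrightarrow> inv_stereo p ?L x \<in> V i \<Longrightarrow>
      bpst x v = matrix_inv (h i x) ** form p ?L i x v ** h i x + matrix_inv (h i x) ** fd (h i) x v"
    using assms(2) unfolding gauge_equiv_stereo_def by blast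
  have ch: "qcnj -` chart p ?L i = chart p L i" for i
    by (auto simp: inv_stereo_qcnj)
  have o: "open (chart p ?L i)" if "i \<in> I" for i
    by (rule open_chart[OF stereo_frame_qcnj[OF fr] that])
  show ?thesis
    unfolding gauge_equiv_stereo_def
  proof (intro exI[of _ "\<lambda>i x. h i (qcnj x)"] conjI ballI allI impI)
    show "smooth_on (chart p L i) (\<lambda>x. h i (qcnj x))" if "i \<in> I" for i
      using smooth_on_compose_linear[OF o[OF that] bounded_linear_qcnj h(1)[OF that]] unfolding ch .
    show "h i (qcnj x) \<in> SU2" if "i \<in> I" "inv_stereo p L x \<in> V i" for i x
      using h(2)[OF that(1), of "qcnj x"] that(2) by (simp add: inv_stereo_qcnj)
    show "h i (qcnj x) = g i j (inv_stereo p L x) ** h j (qcnj x)"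
      if "i \<in> I" "j \<in> I" "inv_stereo p L x \<in> V i \<inter> V j" for i j x
      using h(3)[OF that(1,2), of "qcnj x"] that(3) by (simp add: inv_stereo_qcnj)
    fix i x v assume i: "i \<in> I" and x: "inv_stereo p L x \<in> V i"
    have x': "qcnj x \<in> chart p ?L i" using x by (simp add: inv_stereo_qcnj)
    have "fd (\<lambda>x. h i (qcnj x)) x v = fd (h i) (qcnj x) (qcnj v)"
      using fd_compose[OF bounded_linear_imp_differentiable[OF bounded_linear_qcnj]
          smooth_on_differentiable[OF h(1)[OF i] x']] by (simp add: fd_qcnj)
    then show "anti_bpst x v = matrix_inv (h i (qcnj x)) ** form p L i x v ** h i (qcnj x)
        + matrix_inv (h i (qcnj x)) ** fd (\<lambda>x. h i (qcnj x)) x v"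
      using h(4)[OF i, of "qcnj x" "qcnj v"] x' by (simp add: anti_bpst_qcnj form_qcnj[OF fr])
  qed
qed

text \<open>Conjugation fixes the first basis vector and negates the other three, so in the
  reflected chart \<open>sd1\<close> becomes F34 - F12, and similarly for the others. With the sums
  also zero, every component vanishes.\<close>

lemma curvature_eq_0_if_sd_eq_0:
  assumes fr: "stereo_frame p L" and i: "i \<in> I" and x: "x \<in> chart p L i"
    and sd: "sd_norm (form p L i) x = 0" "sd_norm (form p (\<lambda>x. L (qcnj x)) i) (qcnj x) = 0"
  shows "curvature (form p L i) x u v = 0"
proof -
  interpret gauge_field "chart p L i" "form p L i" by (rule gauge_field_chart[OF fr i])
  let ?L = "\<lambda>x. L (qcnj x)" and ?F = "\<lambda>i' j'. curvature (form p L i) x (e4 i') (e4 j')"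
  have "curvature (form p ?L i) (qcnj x) u v = curvature (form p L i) (qcnj (qcnj x)) (fd qcnj (qcnj x) u) (fd qcnj (qcnj x) v)" for u v
  proof (rule curvature_pullback[of "chart p ?L i"])
    show "open (chart p ?L i)" by (rule open_chart[OF stereo_frame_qcnj[OF fr] i])
    show "smooth_on (chart p ?L i) qcnj" by (rule smooth_on_linear[OF bounded_linear_qcnj])
    show "form p ?L i z v = form p L i (qcnj z) (fd qcnj z v)" for z v
      unfolding fd_qcnj by (rule form_qcnj[OF fr])
  qed (use x in \<open>auto simp: inv_stereo_qcnj\<close>)
  then have c: "curvature (form p ?L i) (qcnj x) u v = curvature (form p L i) x (qcnj u) (qcnj v)" for u v
    by (simp add: fd_qcnj)
  have e: "qcnj (e4 1) = e4 1" "qcnj (e4 2) = - e4 2" "qcnj (e4 3) = - e4 3" "qcnj (e4 4) = - e4 4"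
    by (simp_all add: real4_eq_iff qcnj_nth axis_def)
  have z: "sd1 b y = 0 \<and> sd2 b y = 0 \<and> sd3 b y = 0" if "sd_norm b y = 0" for b y
    using that inner_ge_zero[of "sd1 b y"] inner_ge_zero[of "sd2 b y"] inner_ge_zero[of "sd3 b y"]
    unfolding sd_norm_def by (simp add: add_nonneg_eq_0_iff)
  have p: "?F 1 2 + ?F 3 4 = 0" "?F 1 3 + ?F 4 2 = 0" "?F 1 4 + ?F 2 3 = 0"
    using z[OF sd(1)] by (simp_all add: sd1_def sd2_def sd3_def)
  have m: "?F 3 4 - ?F 1 2 = 0" "?F 4 2 - ?F 1 3 = 0" "?F 2 3 - ?F 1 4 = 0"
    using z[OF sd(2)] by (simp_all add: sd1_def sd2_def sd3_def c e curvature_minus[OF x])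
  have half: "X = 0 \<and> Y = 0" if "X + Y = 0" "Y - X = 0" for X Y :: cmat2
  proof -
    have "2 *\<^sub>R X = (X + Y) - (Y - X)" by (simp add: scaleR_2)
    then have "X = 0" unfolding that by simp
    then show ?thesis using that(1) by simp
  qed
  show ?thesis
    by (rule curvature_eq_0[OF x])
      (simp_all only: half[OF p(1) m(1)] half[OF p(2) m(2)] half[OF p(3) m(3)])
qed

text \<open>Flatness is a condition on all charts, whereas the main argument works in one. Away from
  p the charts are related by a smooth map and the curvature is natural; p itself corresponds to at
  most one point of the other chart, where continuity gives the claim.\<close>

lemma curvature_other_chart:
  assumes fr: "stereo_frame p L" and fr': "stereo_frame p' L'" and i: "i \<in> I" and y: "y \<in> chart p' L' i"
    and flat: "\<And>x u v. x \<in> chart p L i \<Longrightarrow> curvature (form p L i) x u v = 0"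
  shows "curvature (form p' L' i) y u v = 0"
proof -
  let ?\<phi> = "inv_stereo p L" and ?\<phi>' = "inv_stereo p' L'"
  interpret gauge_field "chart p L i" "form p L i" by (rule gauge_field_chart[OF fr i])
  interpret G': gauge_field "chart p' L' i" "form p' L' i" by (rule gauge_field_chart[OF fr' i])
  have off_pole: "curvature (form p' L' i) z u v = 0" if z: "z \<in> chart p' L' i" "?\<phi>' z \<bullet> p \<noteq> 1" for z
  proof -
    define S where "S = chart p' L' i \<inter> {z. ?\<phi>' z \<bullet> p \<noteq> 1}"
    define \<psi> where "\<psi> z = stereo p L (?\<phi>' z)" for z
    have "open {z. ?\<phi>' z \<bullet> p \<noteq> 1}"
      using smooth_on_continuous[OF smooth_inv_stereo[OF fr' open_UNIV]]
      by (intro open_Collect_neq continuous_intros)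
    then have S: "open S" "z \<in> S" using G'.open_U z by (auto simp: S_def)
    have s\<psi>: "smooth_on S \<psi>"
      unfolding \<psi>_def
      by (rule smooth_stereo_compose[OF fr S(1) smooth_inv_stereo[OF fr' S(1)]]) (simp add: S_def)
    have inv: "?\<phi> (\<psi> z) = ?\<phi>' z" if "z \<in> S" for z
      unfolding \<psi>_def using that by (intro inv_stereo_stereo[OF fr] norm_inv_stereo[OF fr']) (simp add: S_def)
    have "fd ?\<phi>' z v = fd ?\<phi> (\<psi> z) (fd \<psi> z v)" if "z \<in> S" for z v
    proof -
      have "fd (\<lambda>z. ?\<phi> (\<psi> z)) z = fd ?\<phi>' z" by (rule fd_cong[OF S(1) that inv])
      then show ?thesis
        using fd_compose[OF smooth_on_differentiable[OF s\<psi> that] differentiable_inv_stereo[OF fr]] by metis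
    qed
    then have "curvature (form p' L' i) z u v = curvature (form p L i) (\<psi> z) (fd \<psi> z u) (fd \<psi> z v)"
      using inv by (intro curvature_pullback[OF S s\<psi>]) (auto simp: pullback_def S_def)
    also have "\<dots> = 0" using inv[OF S(2)] z(1) by (intro flat) simp
    finally show ?thesis .
  qed
  show ?thesis
  proof (cases "?\<phi>' y \<bullet> p = 1")
    case True
    have np: "norm p = 1" by (rule stereo_frameD(1)[OF fr])
    have pole: "?\<phi>' z = p" if "?\<phi>' z \<bullet> p = 1" for z
      using that np norm_inv_stereo[OF fr', of z] by (metis mult_1 norm_cauchy_schwarz_eq scaleR_one)
    have "?\<phi>' z \<bullet> p \<noteq> 1" if "z \<noteq> y" for z
      using pole[of z] pole[OF True] injD[OF inj_inv_stereo[OF fr'], of z y] that by auto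
    then have zero: "curvature (form p' L' i) z u v = 0" if "z \<in> chart p' L' i" "z \<noteq> y" for z
      using that off_pole by blast
    have "isCont (\<lambda>z. curvature (form p' L' i) z u v) y"
      using smooth_on_continuous[OF G'.smooth_curvature] G'.open_U y continuous_on_eq_continuous_at by blast
    then have "((\<lambda>z. curvature (form p' L' i) z u v) \<longlongrightarrow> curvature (form p' L' i) y u v) (at y)"
      by (simp add: isCont_def)
    moreover have "((\<lambda>z. curvature (form p' L' i) z u v) \<longlongrightarrow> 0) (at y)"
    proof (rule tendsto_eventually)
      show "\<forall>\<^sub>F z in at y. curvature (form p' L' i) z u v = 0"
        unfolding eventually_at_topological using G'.open_U y zero by blast
    qed
    ultimately show ?thesis by (rule tendsto_unique[OF trivial_limit_at])
  qed (use off_pole y in blast)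
qed

theorem bpst_or_anti_bpst:
  assumes c: "c > 0" and ym: "yang_mills" and nonflat: "\<not> flat"
    and bound: "curvature_Linf c \<le> ereal (4 / gamma_const c)" and fr: "stereo_frame p L"
  shows "gauge_equiv_stereo p L bpst \<or> gauge_equiv_stereo p L anti_bpst"
proof (rule ccontr)
  let ?L = "\<lambda>x. L (qcnj x)"
  assume contra: "\<not> ?thesis"
  have fr': "stereo_frame p ?L" by (rule stereo_frame_qcnj[OF fr])
  have "sd_norm (form p L i) x = 0" if "i \<in> I" "x \<in> chart p L i" for i x
    using gauge_equiv_bpst[OF fr ym c bound that] contra by blast
  moreover have "sd_norm (form p ?L i) x = 0" if "i \<in> I" "x \<in> chart p ?L i" for i x
    using gauge_equiv_bpst[OF fr' ym c bound that] gauge_equiv_anti_bpst[OF fr] contra by blast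
  moreover have "qcnj x \<in> chart p ?L i" if "x \<in> chart p L i" for i x
    using that by (simp add: inv_stereo_qcnj)
  ultimately have "curvature (form p L i) x u v = 0" if "i \<in> I" "x \<in> chart p L i" for i x u v
    using curvature_eq_0_if_sd_eq_0[OF fr that] that by blast
  then have "flat"
    unfolding flat_def using curvature_other_chart[OF fr] by auto
  then show False using nonflat by blast
qed

end

theorem theorem6:
  fixes I :: "'i set"
    and V :: "'i \<Rightarrow> (real^5) set"
    and g :: "'i \<Rightarrow> 'i \<Rightarrow> real^5 \<Rightarrow> cmat2"
    and A :: "'i \<Rightarrow> real^5 \<Rightarrow> real^5 \<Rightarrow> cmat2"
    and c :: real
  assumes "c > 0"
    and "su2_connection I V g A"
    and "su2_connection.yang_mills I V A"
    and "\<not> su2_connection.flat I V A"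
    and "su2_connection.curvature_Linf I V A c \<le> ereal (4 / gamma_const c)"
  shows "\<forall>p L. stereo_frame p L \<longrightarrow>
    su2_connection.gauge_equiv_stereo I V g A p L bpst \<or>
    su2_connection.gauge_equiv_stereo I V g A p L anti_bpst"
  using su2_connection.bpst_or_anti_bpst[OF assms(2,1,3,4,5)] by blast

end
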